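(* For every nonzero integer $k$, the space $H_k$ is the orthogonal direct sum of the subspaces $H_{k,j}$, $j\in\mathbb{A}_k$: $$H_k=\bigoplus_{j\in\mathbb{A}_k}H_{k,j}.$$
   Context: The Heisenberg group $\mathbb{H}^n$ is $\mathbb{R}^n\times\mathbb{R}^n\times\mathbb{R}$ with the group law $(x,u,\xi)(x',u',\xi')=(x+x',\,u+u',\,\xi+\xi'+\tfrac12(u\cdot x'-x\cdot u'))$. Fix $\mathbf{l}=(l_1,\dots,l_n)$ with $l_j>0$ real and $l_{j+1}/l_j\in\mathbb{Z}$ for all $j$. Put $p_i=l_i/l_1$ (so $p_1=1$), and for $m\in\mathbb{Z}^n$ write $ml=(m_1l_1,\dots,m_nl_n)$. Let $$\Lambda=\Gamma(\mathbf{l})=\mathbb{Z}^n\times(l_1\mathbb{Z}\times\cdots\times l_n\mathbb{Z})\times\tfrac{l_1}{2}\mathbb{Z},$$ a lattice subgroup of $\mathbb{H}^n$, and let $M=\Lambda\backslash\mathbb{H}^n$ with the invariant measure induced by Lebesgue measure. Functions on $M$ are identified with functions on $\mathbb{H}^n$ invariant under left translation by $\Lambda$. For $k\in\mathbb{Z}$ put $\lambda=\lambda(k)=4\pi k/l_1$ and $$H_k=\{F\in L^2(M): F(x,u,\xi)=e^{i\lambda(k)\xi}F(x,u,0)\}.$$ For $k\neq0$ let $\mathbb{A}_k=\mathbb{Z}/2kp_1\mathbb{Z}\times\mathbb{Z}/2kp_2\mathbb{Z}\times\cdots\times\mathbb{Z}/2kp_n\mathbb{Z}$. For a Schwartz function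 $f$ on $\mathbb{R}^n$ define $$V_kf(x,u,\xi)=e^{i\lambda\xi}e^{i\frac{\lambda}{2}x\cdot u}\sum_{m\in\mathbb{Z}^n}e^{i\lambda\sum_{j=1}^n l_jm_jx_j}f(u+ml),\qquad \lambda=\lambda(k).$$ For $k\neq 0$ the function $V_kf$ is $\Lambda$-invariant, and $V_k$ extends (up to a constant normalizing the measure on $M$) to an isometry of $L^2(\mathbb{R}^n)$ into $H_k$. For $j\in\mathbb{A}_k$ (choosing an integer representative) define $V_{k,j}f(x,u,\xi)=e^{2\pi i j\cdot x}V_kf(x,u,\xi)$ and let $H_{k,j}=V_{k,j}(L^2(\mathbb{R}^n))$. The space $H_{k,j}$ does not depend on the chosen representative of $j$. *)

theory Defs
  imports "HOL-Analysis.Analysis"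
begin

section \<open>Schwartz functions on Euclidean space\<close>

definition partial_deriv :: "'n::finite \<Rightarrow> (real^'n \<Rightarrow> complex) \<Rightarrow> real^'n \<Rightarrow> complex" where
  "partial_deriv i f x = vector_derivative (\<lambda>t. f (x + t *\<^sub>R axis i 1)) (at 0)"

definition iter_partial :: "'n::finite list \<Rightarrow> (real^'n \<Rightarrow> complex) \<Rightarrow> real^'n \<Rightarrow> complex" where
  "iter_partial is f = foldr partial_deriv is f"

text \<open>If all iterated partial derivatives are differentiable everywhere, then all of them are
  continuous; so the first conjunct says that \<open>f\<close> is smooth.\<close>

definition schwartz :: "(real^'n::finite \<Rightarrow> complex) \<Rightarrow> bool" where
  "schwartz f \<longleftrightarrow>
     (\<forall>is. iter_partial is f differentiable_on UNIV) \<and>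
     (\<forall>is N. \<exists>C. \<forall>x. norm x ^ N * cmod (iter_partial is f x) \<le> C)"


section \<open>Square-integrable functions\<close>

text \<open>Elements of \<open>L\<^sup>2\<close> are handled through Borel representatives.  All subspaces
  considered below are stable under modification on null sets (within the ambient space).\<close>

definition L2 :: "'a measure \<Rightarrow> ('a \<Rightarrow> complex) set" where
  "L2 \<mu> = {f \<in> borel_measurable \<mu>. integrable \<mu> (\<lambda>x. (cmod (f x))\<^sup>2)}"

definition L2_inner :: "'a measure \<Rightarrow> ('a \<Rightarrow> complex) \<Rightarrow> ('a \<Rightarrow> complex) \<Rightarrow> complex" where
  "L2_inner \<mu> f g = (LINT x|\<mu>. f x * cnj (g x))"

definition L2_tendsto ::
    "'a measure \<Rightarrow> (nat \<Rightarrow> 'a \<Rightarrow> complex) \<Rightarrow> ('a \<Rightarrow> complex) \<Rightarrow> bool" where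
  "L2_tendsto \<mu> \<phi> f \<longleftrightarrow>
     (\<lambda>n. \<integral>\<^sup>+x. ennreal ((cmod (\<phi> n x - f x))\<^sup>2) \<partial>\<mu>) \<longlonglongrightarrow> 0"

text \<open>In the next two definitions \<open>E\<close> is an ambient space of square-integrable representatives.
  The closedness condition, applied to constant sequences, makes a closed subspace stable
  under equality almost everywhere.\<close>

definition closed_subspace ::
    "'a measure \<Rightarrow> ('a \<Rightarrow> complex) set \<Rightarrow> ('a \<Rightarrow> complex) set \<Rightarrow> bool" where
  "closed_subspace \<mu> E S \<longleftrightarrow>
     S \<subseteq> E \<and> (\<lambda>_. 0) \<in> S \<and>
     (\<forall>F\<in>S. \<forall>G\<in>S. (\<lambda>p. F p + G p) \<in> S) \<and>
     (\<forall>c. \<forall>F\<in>S. (\<lambda>p. c * F p) \<in> S) \<and>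
     (\<forall>\<Phi>. \<forall>F\<in>E. (\<forall>n. \<Phi> n \<in> S) \<and> L2_tendsto \<mu> \<Phi> F \<longrightarrow> F \<in> S)"

text \<open>For a finite family of closed subspaces the Hilbert-space direct sum is the algebraic one;
  uniqueness of the decomposition (almost everywhere) follows from orthogonality.  As the
  \<open>S i\<close> are stable under equality almost everywhere, the sum may be taken pointwise.\<close>

definition orthogonal_direct_sum ::
    "'a measure \<Rightarrow> ('a \<Rightarrow> complex) set \<Rightarrow> ('a \<Rightarrow> complex) set \<Rightarrow>
     'i set \<Rightarrow> ('i \<Rightarrow> ('a \<Rightarrow> complex) set) \<Rightarrow> bool" where
  "orthogonal_direct_sum \<mu> E H I S \<longleftrightarrow>
     finite I \<and>
     (\<forall>i\<in>I. closed_subspace \<mu> E (S i)) \<and>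
     (\<forall>i\<in>I. \<forall>j\<in>I. i \<noteq> j \<longrightarrow> (\<forall>F\<in>S i. \<forall>G\<in>S j. L2_inner \<mu> F G = 0)) \<and>
     H = {\<lambda>p. \<Sum>i\<in>I. F i p |F. \<forall>i\<in>I. F i \<in> S i}"


section \<open>The Heisenberg group and the nilmanifold\<close>

type_synonym 'n heis = "(real^'n) \<times> (real^'n) \<times> real"

fun heis_mult :: "'n::finite heis \<Rightarrow> 'n heis \<Rightarrow> 'n heis" where
  "heis_mult (x, u, \<xi>) (x', u', \<xi>') = (x + x', u + u', \<xi> + \<xi>' + (u \<bullet> x' - x \<bullet> u') / 2)"

text \<open>The coordinates \<open>1, \<dots>, n\<close> are the elements of a finite linearly ordered type, and
  \<open>first\<close> is the coordinate \<open>1\<close>.  The condition \<open>l\<^sub>j\<^sub>+\<^sub>1 / l\<^sub>j \<in> \<int>\<close> is imposed on pairs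
  of consecutive coordinates.\<close>

definition first :: "'n::{finite,linorder}" where
  "first = Min UNIV"

definition admissible :: "real^'n::{finite,linorder} \<Rightarrow> bool" where
  "admissible l \<longleftrightarrow>
     (\<forall>j. 0 < l $ j) \<and>
     (\<forall>i j. i < j \<and> {i<..<j} = {} \<longrightarrow> l $ j / l $ i \<in> \<int>)"

definition int_scale :: "int^'n::finite \<Rightarrow> real^'n \<Rightarrow> real^'n" where
  "int_scale m l = (\<chi> j. of_int (m $ j) * l $ j)"

definition lattice :: "real^'n::{finite,linorder} \<Rightarrow> 'n heis set" where
  "lattice l = {(\<chi> j. of_int (a $ j), int_scale b l, of_int c * (l $ first / 2)) |
                 (a :: (int, 'n) vec) (b :: (int, 'n) vec) (c :: int). True}"

definition lattice_invariant ::
    "real^'n::{finite,linorder} \<Rightarrow> ('n heis \<Rightarrow> complex) \<Rightarrow> bool" where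
  "lattice_invariant l F \<longleftrightarrow> (\<forall>\<gamma>\<in>lattice l. \<forall>p. F (heis_mult \<gamma> p) = F p)"

definition fund_domain :: "real^'n::{finite,linorder} \<Rightarrow> 'n heis set" where
  "fund_domain l =
     {x. \<forall>j. 0 \<le> x $ j \<and> x $ j < 1} \<times>
     {u. \<forall>j. 0 \<le> u $ j \<and> u $ j < l $ j} \<times>
     {0..<l $ first / 2}"

text \<open>Functions on the quotient \<open>M\<close> of the group by left translations from the lattice are
  lattice-invariant functions on the group; their integral over \<open>M\<close> is the Lebesgue integral
  over the fundamental domain above.\<close>

definition measure_M :: "real^'n::{finite,linorder} \<Rightarrow> 'n heis measure" where
  "measure_M l = restrict_space lborel (fund_domain l)"

definition L2_M :: "real^'n::{finite,linorder} \<Rightarrow> ('n heis \<Rightarrow> complex) set" where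
  "L2_M l = {F \<in> borel_measurable borel. lattice_invariant l F \<and> F \<in> L2 (measure_M l)}"

lemma fund_domain_unique_translate:
  fixes l :: "real^'n::{finite,linorder}"
  assumes "admissible l"
  shows "\<exists>!\<gamma>. \<gamma> \<in> lattice l \<and> heis_mult \<gamma> p \<in> fund_domain l"
proof -
  have pos: "0 < l $ j" for j
    using assms by (simp add: admissible_def)
  have floor_unique_scaled: "(0 \<le> t + of_int a * d \<and> t + of_int a * d < d) \<longleftrightarrow> a = - \<lfloor>t / d\<rfloor>"
    if d: "0 < d" for t d :: real and a :: int
  proof -
    have "(0 \<le> t + of_int a * d \<and> t + of_int a * d < d) \<longleftrightarrow>
          of_int (- a) \<le> t / d \<and> t / d < of_int (- a) + 1"
      using d by (auto simp: field_simps)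
    also have "\<dots> \<longleftrightarrow> \<lfloor>t / d\<rfloor> = - a"
      by (simp only: floor_eq_iff)
    finally show ?thesis by auto
  qed
  obtain x u \<xi> where p: "p = (x, u, \<xi>)" by (cases p)
  define a :: "(int, 'n) vec" where "a = (\<chi> j. - \<lfloor>x $ j / 1\<rfloor>)"
  define b :: "(int, 'n) vec" where "b = (\<chi> j. - \<lfloor>u $ j / l $ j\<rfloor>)"
  define s where "s = \<xi> + (int_scale b l \<bullet> x - (\<chi> j. of_int (a $ j)) \<bullet> u) / 2"
  define c where "c = - \<lfloor>s / (l $ first / 2)\<rfloor>"
  have key: "heis_mult (\<chi> j. of_int (a' $ j), int_scale b' l, of_int c' * (l $ first / 2)) p
               \<in> fund_domain l \<longleftrightarrow> a' = a \<and> b' = b \<and> c' = c" for a' b' :: "(int, 'n) vec" and c' :: int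
  proof -
    have A: "(\<forall>j. 0 \<le> of_int (a' $ j) + x $ j \<and> of_int (a' $ j) + x $ j < 1) \<longleftrightarrow> a' = a"
      using floor_unique_scaled[of 1] by (simp add: a_def vec_eq_iff add.commute)
    have B: "(\<forall>j. 0 \<le> int_scale b' l $ j + u $ j \<and> int_scale b' l $ j + u $ j < l $ j) \<longleftrightarrow> b' = b"
      using floor_unique_scaled[OF pos] by (simp add: b_def int_scale_def vec_eq_iff add.commute)
    have C: "(0 \<le> s + of_int c' * (l $ first / 2) \<and> s + of_int c' * (l $ first / 2) < l $ first / 2)
               \<longleftrightarrow> c' = c"
      unfolding c_def by (rule floor_unique_scaled) (use pos[of first] in simp)
    have "heis_mult (\<chi> j. of_int (a' $ j), int_scale b' l, of_int c' * (l $ first / 2)) p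
               \<in> fund_domain l \<longleftrightarrow> a' = a \<and> b' = b \<and>
            (0 \<le> of_int c' * (l $ first / 2) + \<xi> +
                 (int_scale b' l \<bullet> x - (\<chi> j. of_int (a' $ j)) \<bullet> u) / 2 \<and>
             of_int c' * (l $ first / 2) + \<xi> +
                 (int_scale b' l \<bullet> x - (\<chi> j. of_int (a' $ j)) \<bullet> u) / 2 < l $ first / 2)"
      unfolding p fund_domain_def heis_mult.simps mem_Times_iff fst_conv snd_conv mem_Collect_eq
        atLeastLessThan_iff vector_add_component vec_lambda_beta A B ..
    also have "\<dots> \<longleftrightarrow> a' = a \<and> b' = b \<and> c' = c"
      using C unfolding s_def by (auto simp: algebra_simps)
    finally show ?thesis .
  qed
  show ?thesis
  proof (rule ex1I)
    show "(\<chi> j. of_int (a $ j), int_scale b l, of_int c * (l $ first / 2)) \<in> lattice l \<and>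
          heis_mult (\<chi> j. of_int (a $ j), int_scale b l, of_int c * (l $ first / 2)) p
            \<in> fund_domain l"
      using key by (auto simp: lattice_def)
  next
    fix \<gamma> assume "\<gamma> \<in> lattice l \<and> heis_mult \<gamma> p \<in> fund_domain l"
    then show "\<gamma> = (\<chi> j. of_int (a $ j), int_scale b l, of_int c * (l $ first / 2))"
      using key by (auto simp: lattice_def)
  qed
qed


section \<open>The spaces \<open>H\<^sub>k\<close> and \<open>H\<^sub>k\<^sub>,\<^sub>j\<close>\<close>

definition freq :: "real^'n::{finite,linorder} \<Rightarrow> int \<Rightarrow> real" where
  "freq l k = 4 * pi * of_int k / l $ first"

text \<open>As the hyperplane \<open>\<xi> = 0\<close> is a null set, the defining condition of \<open>H\<^sub>k\<close> is required
  of some representative.\<close>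

definition Hk :: "real^'n::{finite,linorder} \<Rightarrow> int \<Rightarrow> ('n heis \<Rightarrow> complex) set" where
  "Hk l k = {F \<in> L2_M l. \<exists>G\<in>L2_M l. (AE p in measure_M l. F p = G p) \<and>
               (\<forall>x u \<xi>. G (x, u, \<xi>) = cis (freq l k * \<xi>) * G (x, u, 0))}"

definition V_schwartz ::
    "real^'n::{finite,linorder} \<Rightarrow> int \<Rightarrow> ((real, 'n) vec \<Rightarrow> complex) \<Rightarrow> 'n heis \<Rightarrow> complex" where
  "V_schwartz l k f = (\<lambda>(x, u, \<xi>).
     cis (freq l k * \<xi>) * cis (freq l k / 2 * (x \<bullet> u)) *
     (\<Sum>\<^sub>\<infinity>m::(int, 'n) vec. cis (freq l k * (\<Sum>j\<in>UNIV. l $ j * of_int (m $ j) * x $ j)) *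
                     f (u + int_scale m l)))"

text \<open>The continuous extension of \<open>V\<^sub>k\<close> to \<open>L\<^sup>2\<close>, as a relation between representatives:
  \<open>G\<close> is a version of \<open>V\<^sub>k f\<close>.\<close>

definition is_V ::
    "real^'n::{finite,linorder} \<Rightarrow> int \<Rightarrow> ((real, 'n) vec \<Rightarrow> complex) \<Rightarrow> ('n heis \<Rightarrow> complex) \<Rightarrow> bool" where
  "is_V l k f G \<longleftrightarrow> f \<in> L2 lborel \<and> G \<in> L2_M l \<and>
     (\<exists>\<phi>. (\<forall>n. schwartz (\<phi> n)) \<and> L2_tendsto lborel \<phi> f \<and>
          L2_tendsto (measure_M l) (\<lambda>n. V_schwartz l k (\<phi> n)) G)"

definition Hkj ::
    "real^'n::{finite,linorder} \<Rightarrow> int \<Rightarrow> (int, 'n) vec \<Rightarrow> ('n heis \<Rightarrow> complex) set" where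
  "Hkj l k j = {\<lambda>(x, u, \<xi>). cis (2 * pi * (\<Sum>i\<in>UNIV. of_int (j $ i) * x $ i)) * G (x, u, \<xi>) |
                 f G. is_V l k f G}"

text \<open>The product of the cyclic groups of order \<open>\<bar>2 k l\<^sub>i / l\<^sub>1\<bar>\<close>, as a set of residue classes
  of integer vectors.\<close>

definition Ak :: "real^'n::{finite,linorder} \<Rightarrow> int \<Rightarrow> (int, 'n) vec set set" where
  "Ak l k = UNIV // {(a, b). \<forall>i. \<exists>q::int.
              of_int (a $ i) - of_int (b $ i) = 2 * of_int k * (l $ i / l $ first) * of_int q}"

end

theory Submission
  imports Defs
begin

text \<open>Write a function of \<open>H\<^sub>k\<close> as \<open>e\<^sup>i\<^sup>\<lambda>\<^sup>\<xi> e\<^sup>i\<^sup>\<lambda>\<^sup>x\<^sup>u\<^sup>/\<^sup>2 h(x, u)\<close>.  Invariance under the lattice makes \<open>h\<close>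
  periodic in \<open>x\<close>, and ties the Fourier coefficient of index \<open>q + 2 k p m\<close> at \<open>u\<close> to that of index
  \<open>q\<close> at \<open>u + m l\<close>; so the frequencies of one residue class modulo \<open>2 k p\<close> assemble to one function
  on \<open>\<real>\<^sup>n\<close>.  For finitely many Schwartz functions in distinct residue classes, Parseval on the torus and
  tiling \<open>\<real>\<^sup>n\<close> by translates of the cell \<open>\<Prod>[0, l\<^sub>j)\<close> give
  \<open>\<parallel>\<Sum> V\<^sub>k\<^sub>,\<^sub>j f\<^sub>j\<parallel>\<^sup>2 = l\<^sub>1/2 \<Sum> \<parallel>f\<^sub>j\<parallel>\<^sup>2\<close>.  This identity yields orthogonality, shows that \<open>H\<^sub>k\<^sub>,\<^sub>j\<close> is the closure of
  the waves \<open>V\<^sub>k\<^sub>,\<^sub>j f\<close> with \<open>f\<close> Schwartz, and makes each component of a convergent sequence of sums of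
  waves a Cauchy sequence.  It remains to see that the sums of waves are dense in \<open>H\<^sub>k\<close>: products of
  trigonometric polynomials in \<open>x\<close> and smooth bumps in \<open>u\<close> supported in the cell are such sums, and
  they approximate the indicators of boxes.\<close>

section \<open>Mean square convergence\<close>

text \<open>All objects are functions, not classes modulo null sets, and this shapes the proof:
  \<open>Hk\<close> asks for a representative that is equivariant in \<xi> at every point, and the
  direct sum is a pointwise identity. So limits are built by \<open>lim0\<close>, which keeps
  pointwise identities, and a null function is moved into one component at the end. The modulus is 2
  k p because \<open>freq l k * l $ i\<close> is 2 pi times 2 k p_i: the exponentials in V_k are the
  characters of index 2 k p m, and the character of index j shifts them to one coset. With one
  representative per coset, each index in Z^n occurs exactly once: Parseval uses that none repeats,
  density that none is missed. The constant l_1/2 is the length of the \<xi>-side of the fundamental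
  domain. Bumps supported in the cell are used because, at points of the cell, only one term of the
  lattice sum survives; a character times a bump is then exactly one wave, with no Fourier
  coefficients to estimate. V_k is never extended as an operator to L2: since it scales norms,
  completeness recovers the preimage of a limit of waves.\<close>

definition sqnorm :: "'a measure \<Rightarrow> ('a \<Rightarrow> complex) \<Rightarrow> ennreal" where
  "sqnorm \<mu> f = (\<integral>\<^sup>+x. ennreal ((cmod (f x))\<^sup>2) \<partial>\<mu>)"

lemma L2_tendsto_sqnorm: "L2_tendsto \<mu> \<phi> f \<longleftrightarrow> (\<lambda>n. sqnorm \<mu> (\<lambda>x. \<phi> n x - f x)) \<longlonglongrightarrow> 0"
  by (simp add: L2_tendsto_def sqnorm_def)

lemma L2_iff: "f \<in> L2 \<mu> \<longleftrightarrow> f \<in> borel_measurable \<mu> \<and> sqnorm \<mu> f < \<infinity>"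
  by (auto simp: L2_def sqnorm_def integrable_iff_bounded)

lemma cmod_add_sq_le: "(cmod (a + b))\<^sup>2 \<le> 2 * (cmod a)\<^sup>2 + 2 * (cmod b)\<^sup>2"
proof -
  have "(cmod (a + b))\<^sup>2 \<le> (cmod a + cmod b)\<^sup>2"
    by (simp add: norm_triangle_ineq power_mono)
  also have "\<dots> \<le> 2 * (cmod a)\<^sup>2 + 2 * (cmod b)\<^sup>2"
    using sum_squares_bound[of "cmod a" "cmod b"] by (simp add: power2_sum)
  finally show ?thesis .
qed

lemma ennreal_lin2: "0 \<le> a \<Longrightarrow> 0 \<le> b \<Longrightarrow> ennreal (2 * a + 2 * b) = 2 * ennreal a + 2 * ennreal b"
  by (simp add: ennreal_mult)

text \<open>For squared norms the factor 2 replaces Minkowski's inequality. It is harmless, since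
  such bounds serve only for finiteness, for limits equal to 0 and for Cauchy estimates.\<close>

lemma sqnorm_add:
  assumes [measurable]: "f \<in> borel_measurable \<mu>" "g \<in> borel_measurable \<mu>"
  shows "sqnorm \<mu> (\<lambda>x. f x + g x) \<le> 2 * sqnorm \<mu> f + 2 * sqnorm \<mu> g"
proof -
  have "sqnorm \<mu> (\<lambda>x. f x + g x)
      \<le> (\<integral>\<^sup>+x. 2 * ennreal ((cmod (f x))\<^sup>2) + 2 * ennreal ((cmod (g x))\<^sup>2) \<partial>\<mu>)"
    unfolding sqnorm_def
    by (intro nn_integral_mono)
      (simp add: ennreal_lin2[symmetric] ennreal_leI cmod_add_sq_le del: ennreal_plus)
  also have "\<dots> = 2 * sqnorm \<mu> f + 2 * sqnorm \<mu> g"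
    unfolding sqnorm_def by (subst nn_integral_add) (auto simp: nn_integral_cmult)
  finally show ?thesis .
qed

lemma sqnorm_cmult:
  assumes [measurable]: "f \<in> borel_measurable \<mu>"
  shows "sqnorm \<mu> (\<lambda>x. c * f x) = ennreal ((cmod c)\<^sup>2) * sqnorm \<mu> f"
  unfolding sqnorm_def
  by (subst nn_integral_cmult[symmetric]) (auto simp: norm_mult power_mult_distrib ennreal_mult)

lemma sqnorm_commute: "sqnorm \<mu> (\<lambda>x. f x - g x) = sqnorm \<mu> (\<lambda>x. g x - f x)"
  by (simp add: sqnorm_def norm_minus_commute)

lemma sqnorm_cong: "(\<And>x. x \<in> space \<mu> \<Longrightarrow> cmod (f x) = cmod (g x)) \<Longrightarrow> sqnorm \<mu> f = sqnorm \<mu> g"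
  unfolding sqnorm_def by (intro nn_integral_cong) auto

lemma sqnorm_zero [simp]: "sqnorm \<mu> (\<lambda>x. 0) = 0"
  by (simp add: sqnorm_def)

lemma sqnorm_triangle:
  assumes [measurable]: "f \<in> borel_measurable \<mu>" "g \<in> borel_measurable \<mu>" "h \<in> borel_measurable \<mu>"
  shows "sqnorm \<mu> (\<lambda>x. f x - h x) \<le> 2 * sqnorm \<mu> (\<lambda>x. f x - g x) + 2 * sqnorm \<mu> (\<lambda>x. g x - h x)"
  using sqnorm_add[of "\<lambda>x. f x - g x" \<mu> "\<lambda>x. g x - h x"] by simp

lemma ennreal_tendsto_0_mono:
  fixes f g :: "nat \<Rightarrow> ennreal"
  assumes "g \<longlonglongrightarrow> 0" "\<And>n. f n \<le> g n"
  shows "f \<longlonglongrightarrow> 0"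
  using tendsto_sandwich[of "\<lambda>_. 0" f sequentially g 0] assms by auto

lemma ennreal_tendsto_0_lin:
  fixes f g :: "nat \<Rightarrow> ennreal"
  assumes "f \<longlonglongrightarrow> 0" "g \<longlonglongrightarrow> 0"
  shows "(\<lambda>n. 2 * f n + 2 * g n) \<longlonglongrightarrow> 0"
proof -
  have "(\<lambda>n. 2 * f n + 2 * g n) \<longlonglongrightarrow> 2 * 0 + 2 * 0"
    by (intro tendsto_add tendsto_intros ennreal_tendsto_cmult assms) auto
  then show ?thesis by simp
qed

lemma L2_tendsto_add:
  assumes [measurable]: "\<And>n. \<phi> n \<in> borel_measurable \<mu>" "f \<in> borel_measurable \<mu>"
    "\<And>n. \<psi> n \<in> borel_measurable \<mu>" "g \<in> borel_measurable \<mu>"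
    and "L2_tendsto \<mu> \<phi> f" "L2_tendsto \<mu> \<psi> g"
  shows "L2_tendsto \<mu> (\<lambda>n x. \<phi> n x + \<psi> n x) (\<lambda>x. f x + g x)"
  unfolding L2_tendsto_sqnorm
proof (rule ennreal_tendsto_0_mono[OF ennreal_tendsto_0_lin])
  show "(\<lambda>n. sqnorm \<mu> (\<lambda>x. \<phi> n x - f x)) \<longlonglongrightarrow> 0" "(\<lambda>n. sqnorm \<mu> (\<lambda>x. \<psi> n x - g x)) \<longlonglongrightarrow> 0"
    using assms by (auto simp: L2_tendsto_sqnorm)
  show "sqnorm \<mu> (\<lambda>x. \<phi> n x + \<psi> n x - (f x + g x))
      \<le> 2 * sqnorm \<mu> (\<lambda>x. \<phi> n x - f x) + 2 * sqnorm \<mu> (\<lambda>x. \<psi> n x - g x)" for n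
    using sqnorm_add[of "\<lambda>x. \<phi> n x - f x" \<mu> "\<lambda>x. \<psi> n x - g x"] by (simp add: algebra_simps)
qed

lemma L2_tendsto_cmult:
  assumes [measurable]: "\<And>n. \<phi> n \<in> borel_measurable \<mu>" "f \<in> borel_measurable \<mu>"
    and "L2_tendsto \<mu> \<phi> f"
  shows "L2_tendsto \<mu> (\<lambda>n x. c * \<phi> n x) (\<lambda>x. c * f x)"
proof -
  have "(\<lambda>n. ennreal ((cmod c)\<^sup>2) * sqnorm \<mu> (\<lambda>x. \<phi> n x - f x)) \<longlonglongrightarrow> ennreal ((cmod c)\<^sup>2) * 0"
    using assms by (intro ennreal_tendsto_cmult) (auto simp: L2_tendsto_sqnorm)
  moreover have "sqnorm \<mu> (\<lambda>x. c * \<phi> n x - c * f x)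
      = ennreal ((cmod c)\<^sup>2) * sqnorm \<mu> (\<lambda>x. \<phi> n x - f x)" for n
    using sqnorm_cmult[of "\<lambda>x. \<phi> n x - f x" \<mu> c] by (simp add: right_diff_distrib)
  ultimately show ?thesis by (simp add: L2_tendsto_sqnorm)
qed

lemma L2_tendsto_sum:
  assumes "finite I" and [measurable]: "\<And>i n. i \<in> I \<Longrightarrow> \<phi> i n \<in> borel_measurable \<mu>"
    "\<And>i. i \<in> I \<Longrightarrow> f i \<in> borel_measurable \<mu>"
    and "\<And>i. i \<in> I \<Longrightarrow> L2_tendsto \<mu> (\<phi> i) (f i)"
  shows "L2_tendsto \<mu> (\<lambda>n x. \<Sum>i\<in>I. \<phi> i n x) (\<lambda>x. \<Sum>i\<in>I. f i x)"
  using assms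
proof (induction I rule: finite_induct)
  case empty
  then show ?case by (simp add: L2_tendsto_sqnorm)
next
  case (insert i I)
  have "L2_tendsto \<mu> (\<lambda>n x. \<phi> i n x + (\<Sum>i\<in>I. \<phi> i n x)) (\<lambda>x. f i x + (\<Sum>i\<in>I. f i x))"
    using insert by (intro L2_tendsto_add borel_measurable_sum) auto
  then show ?case using insert by simp
qed

lemma L2_tendsto_unique:
  assumes [measurable]: "\<And>n. \<phi> n \<in> borel_measurable \<mu>" "f \<in> borel_measurable \<mu>"
     "g \<in> borel_measurable \<mu>"
    and "L2_tendsto \<mu> \<phi> f" "L2_tendsto \<mu> \<phi> g"
  shows "AE x in \<mu>. f x = g x"
proof -
  have "(\<lambda>n. 2 * sqnorm \<mu> (\<lambda>x. \<phi> n x - f x) + 2 * sqnorm \<mu> (\<lambda>x. \<phi> n x - g x)) \<longlonglongrightarrow> 0"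
    by (intro ennreal_tendsto_0_lin) (use assms in \<open>auto simp: L2_tendsto_sqnorm\<close>)
  moreover have "sqnorm \<mu> (\<lambda>x. f x - g x)
      \<le> 2 * sqnorm \<mu> (\<lambda>x. \<phi> n x - f x) + 2 * sqnorm \<mu> (\<lambda>x. \<phi> n x - g x)" for n
    using sqnorm_triangle[of f \<mu> "\<phi> n" g] by (simp add: sqnorm_commute[of _ f])
  ultimately have "(\<lambda>_::nat. sqnorm \<mu> (\<lambda>x. f x - g x)) \<longlonglongrightarrow> 0"
    by (rule ennreal_tendsto_0_mono)
  then have "sqnorm \<mu> (\<lambda>x. f x - g x) = 0"
    by (simp add: LIMSEQ_const_iff)
  then show ?thesis
    unfolding sqnorm_def by (subst (asm) nn_integral_0_iff_AE) (auto simp: ennreal_eq_0_iff)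
qed

lemma L2_tendsto_cong_AE:
  assumes "L2_tendsto \<mu> \<phi> f" "AE x in \<mu>. f x = g x"
  shows "L2_tendsto \<mu> \<phi> g"
proof -
  have "sqnorm \<mu> (\<lambda>x. \<phi> n x - f x) = sqnorm \<mu> (\<lambda>x. \<phi> n x - g x)" for n
    unfolding sqnorm_def by (rule nn_integral_cong_AE) (use assms(2) in auto)
  then show ?thesis using assms(1) by (simp add: L2_tendsto_sqnorm)
qed

lemma L2_add: "f \<in> L2 \<mu> \<Longrightarrow> g \<in> L2 \<mu> \<Longrightarrow> (\<lambda>x. f x + g x) \<in> L2 \<mu>"
  unfolding L2_iff
  by (auto intro: le_less_trans[OF sqnorm_add] simp: ennreal_mult_less_top)

lemma L2_cmult: "f \<in> L2 \<mu> \<Longrightarrow> (\<lambda>x. c * f x) \<in> L2 \<mu>"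
  unfolding L2_iff by (auto simp: sqnorm_cmult ennreal_mult_less_top)

lemma L2_tendsto_dominated:
  assumes [measurable]: "\<And>n. \<phi> n \<in> borel_measurable \<mu>" "f \<in> borel_measurable \<mu>" "w \<in> borel_measurable \<mu>"
    and bound: "\<And>n x. x \<in> space \<mu> \<Longrightarrow> cmod (\<phi> n x) \<le> w x"
    and w: "(\<integral>\<^sup>+x. ennreal ((w x)\<^sup>2) \<partial>\<mu>) < \<infinity>"
    and lim: "AE x in \<mu>. (\<lambda>n. \<phi> n x) \<longlonglongrightarrow> f x"
  shows "L2_tendsto \<mu> \<phi> f"
proof -
  have "(\<lambda>n. \<integral>\<^sup>+x. ennreal ((cmod (\<phi> n x - f x))\<^sup>2) \<partial>\<mu>) \<longlonglongrightarrow> (\<integral>\<^sup>+x. 0 \<partial>\<mu>)"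
  proof (rule nn_integral_dominated_convergence[where w = "\<lambda>x. 4 * ennreal ((w x)\<^sup>2)"])
    show "(\<integral>\<^sup>+x. 4 * ennreal ((w x)\<^sup>2) \<partial>\<mu>) < \<infinity>"
      using w by (simp add: nn_integral_cmult ennreal_mult_less_top)
    show "AE x in \<mu>. (\<lambda>n. ennreal ((cmod (\<phi> n x - f x))\<^sup>2)) \<longlonglongrightarrow> 0"
      using lim
    proof eventually_elim
      case (elim x)
      have "(\<lambda>n. (cmod (\<phi> n x - f x))\<^sup>2) \<longlonglongrightarrow> (cmod (f x - f x))\<^sup>2"
        by (intro tendsto_intros elim)
      then show ?case by (simp flip: ennreal_0 add: tendsto_ennrealI)
    qed
    \<comment> \<open>The limit inherits the bound \<open>w\<close>, so the difference is at most
      \<open>2 * w x\<close>; squaring produces the 4.\<close>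
    show "AE x in \<mu>. ennreal ((cmod (\<phi> n x - f x))\<^sup>2) \<le> 4 * ennreal ((w x)\<^sup>2)" for n
      using lim AE_space
    proof eventually_elim
      case (elim x)
      have "cmod (f x) \<le> w x"
        by (rule LIMSEQ_le_const2[OF tendsto_norm[OF elim(1)]]) (use bound elim in auto)
      then have "cmod (\<phi> n x - f x) \<le> 2 * w x"
        using norm_triangle_ineq4[of "\<phi> n x" "f x"] bound[OF elim(2), of n] by linarith
      then have "(cmod (\<phi> n x - f x))\<^sup>2 \<le> 4 * (w x)\<^sup>2"
        using power_mono[of "cmod (\<phi> n x - f x)" "2 * w x" 2] by (simp add: power_mult_distrib)
      then have "ennreal ((cmod (\<phi> n x - f x))\<^sup>2) \<le> ennreal (4 * (w x)\<^sup>2)" by (rule ennreal_leI)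
      then show ?case by (simp add: ennreal_mult)
    qed
  qed auto
  then show ?thesis by (simp add: L2_tendsto_def)
qed

section \<open>Completeness of L2\<close>

definition L2_Cauchy :: "'a measure \<Rightarrow> (nat \<Rightarrow> 'a \<Rightarrow> complex) \<Rightarrow> bool" where
  "L2_Cauchy \<mu> \<phi> \<longleftrightarrow>
     (\<forall>e>0. \<exists>N. \<forall>m\<ge>N. \<forall>n\<ge>N. sqnorm \<mu> (\<lambda>x. \<phi> m x - \<phi> n x) < ennreal e)"

lemma L2_tendsto_eventually:
  assumes "L2_tendsto \<mu> \<phi> f" "0 < e"
  shows "\<forall>\<^sub>F n in sequentially. sqnorm \<mu> (\<lambda>x. \<phi> n x - f x) < ennreal e"
  using assms order_tendstoD(2)[of "\<lambda>n. sqnorm \<mu> (\<lambda>x. \<phi> n x - f x)" 0 sequentially "ennreal e"]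
  by (auto simp: L2_tendsto_sqnorm)

lemma ennreal_quarters: 
  assumes "a < ennreal (e/4)" "b < ennreal (e/4)" "0 < e"
  shows "2 * a + 2 * b < ennreal e"
proof -
  obtain a' b' where *: "a = ennreal a'" "b = ennreal b'" "0 \<le> a'" "0 \<le> b'"
    using assms(1,2) by (cases a; cases b) auto
  have "2 * a + 2 * b = ennreal (2 * a' + 2 * b')"
    using * by (simp add: ennreal_mult)
  also have "\<dots> < ennreal e"
    using assms * by (intro ennreal_lessI) (auto simp: ennreal_less_iff)
  finally show ?thesis .
qed

lemma L2_tendsto_imp_Cauchy:
  assumes [measurable]: "\<And>n. \<phi> n \<in> borel_measurable \<mu>" "f \<in> borel_measurable \<mu>"
    and "L2_tendsto \<mu> \<phi> f"
  shows "L2_Cauchy \<mu> \<phi>"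
  unfolding L2_Cauchy_def
proof (intro allI impI)
  fix e :: real assume e: "0 < e"
  obtain N where N: "\<And>n. n \<ge> N \<Longrightarrow> sqnorm \<mu> (\<lambda>x. \<phi> n x - f x) < ennreal (e / 4)"
    using L2_tendsto_eventually[OF assms(3), of "e/4"] e by (auto simp: eventually_sequentially)
  have "sqnorm \<mu> (\<lambda>x. \<phi> m x - \<phi> n x) < ennreal e" if "m \<ge> N" "n \<ge> N" for m n
    using sqnorm_triangle[of "\<phi> m" \<mu> f "\<phi> n"] N[OF that(1)] N[OF that(2)] e
      ennreal_quarters[of "sqnorm \<mu> (\<lambda>x. \<phi> m x - f x)" e "sqnorm \<mu> (\<lambda>x. \<phi> n x - f x)"]
    by (simp add: sqnorm_commute[of _ f]) 
  then show "\<exists>N. \<forall>m\<ge>N. \<forall>n\<ge>N. sqnorm \<mu> (\<lambda>x. \<phi> m x - \<phi> n x) < ennreal e" by blast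
qed

text \<open>The value 0 at points of divergence, in place of the arbitrary one of \<^const>\<open>lim\<close>, preserves
  identities of the form \<open>\<phi> n p = c * \<phi> n q\<close> in the limit at every point.\<close>

definition lim0 :: "(nat \<Rightarrow> 'a \<Rightarrow> complex) \<Rightarrow> 'a \<Rightarrow> complex" where
  "lim0 \<phi> x = (if convergent (\<lambda>n. \<phi> n x) then lim (\<lambda>n. \<phi> n x) else 0)"

lemma borel_measurable_lim0:
  assumes [measurable]: "\<And>n. \<phi> n \<in> borel_measurable \<mu>"
  shows "lim0 \<phi> \<in> borel_measurable \<mu>"
  unfolding lim0_def[abs_def] Cauchy_convergent_iff[symmetric] by measurable

text \<open>The rate \<open>8 ^ - k\<close> leaves room for the weights \<open>2 ^ k\<close>, which turn square-summable
  increments into summable ones by \<open>2 t \<le> 2 ^ - k + 2 ^ k t\<^sup>2\<close>.\<close>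

lemma AE_convergent_of_fast_Cauchy:
  assumes [measurable]: "\<And>n. \<phi> n \<in> borel_measurable \<mu>"
    and fast: "\<And>k. sqnorm \<mu> (\<lambda>x. \<phi> (Suc k) x - \<phi> k x) < ennreal ((1/8) ^ k)"
  shows "AE x in \<mu>. convergent (\<lambda>k. \<phi> k x)"
proof -
  have "(\<integral>\<^sup>+x. (\<Sum>k. ennreal (2 ^ k * (cmod (\<phi> (Suc k) x - \<phi> k x))\<^sup>2)) \<partial>\<mu>)
      = (\<Sum>k. \<integral>\<^sup>+x. ennreal (2 ^ k * (cmod (\<phi> (Suc k) x - \<phi> k x))\<^sup>2) \<partial>\<mu>)"
    by (rule nn_integral_suminf) auto
  also have "\<dots> = (\<Sum>k. ennreal (2 ^ k) * sqnorm \<mu> (\<lambda>x. \<phi> (Suc k) x - \<phi> k x))"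
    unfolding sqnorm_def by (subst nn_integral_cmult[symmetric]) (auto simp: ennreal_mult)
  also have "\<dots> \<le> (\<Sum>k. ennreal ((1/4) ^ k))"
  proof (rule suminf_le)
    fix k
    have "ennreal (2 ^ k) * sqnorm \<mu> (\<lambda>x. \<phi> (Suc k) x - \<phi> k x) \<le> ennreal (2 ^ k) * ennreal ((1/8) ^ k)"
      using fast[of k] by (intro mult_left_mono) auto
    also have "\<dots> = ennreal ((1/4) ^ k)"
      by (simp flip: ennreal_mult power_mult_distrib)
    finally show "ennreal (2 ^ k) * sqnorm \<mu> (\<lambda>x. \<phi> (Suc k) x - \<phi> k x) \<le> ennreal ((1/4) ^ k)" .
  qed auto
  also have "\<dots> = ennreal (\<Sum>k. (1/4) ^ k)"
    by (rule suminf_ennreal2) (auto intro: summable_geometric)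
  finally have "(\<integral>\<^sup>+x. (\<Sum>k. ennreal (2 ^ k * (cmod (\<phi> (Suc k) x - \<phi> k x))\<^sup>2)) \<partial>\<mu>) \<noteq> \<infinity>"
    by (auto simp: top_unique)
  then have "AE x in \<mu>. (\<Sum>k. ennreal (2 ^ k * (cmod (\<phi> (Suc k) x - \<phi> k x))\<^sup>2)) \<noteq> \<infinity>"
    by (intro nn_integral_noteq_infinite) auto
  then show ?thesis
  proof eventually_elim
    case (elim x)
    have "summable (\<lambda>k. 2 ^ k * (cmod (\<phi> (Suc k) x - \<phi> k x))\<^sup>2)"
      using elim by (intro summable_suminf_not_top) auto
    then have "summable (\<lambda>k. (1/2) ^ k + 2 ^ k * (cmod (\<phi> (Suc k) x - \<phi> k x))\<^sup>2)"
      by (intro summable_add summable_geometric) auto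
    then have "summable (\<lambda>k. \<phi> (Suc k) x - \<phi> k x)"
    proof (rule summable_comparison_test'[where N = 0])
      fix k :: nat
      let ?t = "cmod (\<phi> (Suc k) x - \<phi> k x)"
      have "0 \<le> (1 - 2 ^ k * ?t)\<^sup>2 / 2 ^ k" by simp
      also have "\<dots> = (1/2) ^ k + 2 ^ k * ?t\<^sup>2 - 2 * ?t"
        by (simp add: power2_diff field_simps power2_eq_square power_divide)
      finally show "?t \<le> (1/2) ^ k + 2 ^ k * ?t\<^sup>2"
        using norm_ge_zero[of "\<phi> (Suc k) x - \<phi> k x"] by linarith
    qed
    then have "convergent (\<lambda>n. (\<Sum>k<n. \<phi> (Suc k) x - \<phi> k x) + \<phi> 0 x)"
      by (intro convergent_add convergent_const) (simp add: summable_iff_convergent)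
    then show ?case by (simp add: sum_lessThan_telescope[of "\<lambda>k. \<phi> k x"])
  qed
qed

text \<open>The limit is exhibited as \<open>lim0\<close> of a subsequence rather than merely
  asserted to exist: invariance and equivariance can then be transferred to it at every
  point.\<close>

theorem L2_complete:
  assumes [measurable]: "\<And>n. \<phi> n \<in> borel_measurable \<mu>"
    and Cauchy: "L2_Cauchy \<mu> \<phi>"
  obtains r :: "nat \<Rightarrow> nat" where "strict_mono r" "L2_tendsto \<mu> \<phi> (lim0 (\<lambda>k. \<phi> (r k)))"
proof -
  have "\<exists>N. \<forall>m\<ge>N. \<forall>n\<ge>N. sqnorm \<mu> (\<lambda>x. \<phi> m x - \<phi> n x) < ennreal ((1/8) ^ k)" for k :: nat
    using Cauchy unfolding L2_Cauchy_def by (metis zero_less_divide_1_iff zero_less_numeral zero_less_power)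
  then obtain N where N: "\<And>k m n. m \<ge> N k \<Longrightarrow> n \<ge> N k \<Longrightarrow>
      sqnorm \<mu> (\<lambda>x. \<phi> m x - \<phi> n x) < ennreal ((1/8) ^ k)" by metis
  \<comment> \<open>Summing the thresholds makes \<open>r k\<close> at least \<open>N k\<close>; the
    summand k makes \<open>r\<close> strictly increasing.\<close>
  define r where "r k = (\<Sum>i\<le>k. N i) + k" for k
  have r: "strict_mono r" by (auto simp: strict_mono_Suc_iff r_def)
  have Nr: "N k \<le> r k" for k
    unfolding r_def by (auto intro: trans_le_add1 member_le_sum)
  have "AE x in \<mu>. convergent (\<lambda>k. \<phi> (r k) x)"
    using r Nr by (intro AE_convergent_of_fast_Cauchy N)
      (auto intro: order_trans[OF Nr strict_mono_leD[OF r]])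
  then have conv: "AE x in \<mu>. (\<lambda>k. \<phi> (r k) x) \<longlonglongrightarrow> lim0 (\<lambda>k. \<phi> (r k)) x"
    by eventually_elim (simp add: lim0_def convergent_LIMSEQ_iff)
  let ?F = "lim0 (\<lambda>k. \<phi> (r k))"
  have [measurable]: "?F \<in> borel_measurable \<mu>"
    by (rule borel_measurable_lim0) simp
  \<comment> \<open>The comparison sequence takes, for each m, the best rate whose threshold m has
    passed. If m has passed none, the infimum is over the empty set and equals infinity, which
    bounds trivially.\<close>
  have "(\<lambda>m. sqnorm \<mu> (\<lambda>x. \<phi> m x - ?F x)) \<longlonglongrightarrow> 0"
  proof (rule ennreal_tendsto_0_mono[where g="\<lambda>m. INF k\<in>{k. N k \<le> m}. ennreal ((1/8)^k)"]; (intro INF_greatest)?)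
    have "\<forall>\<^sub>F m in sequentially. (INF k\<in>{k. N k \<le> m}. ennreal ((1/8)^k)) < e" if e: "0 < e" for e
    proof -
      have "(\<lambda>k. ennreal ((1/8)^k)) \<longlonglongrightarrow> ennreal 0"
        by (intro tendsto_ennrealI LIMSEQ_realpow_zero) auto
      from order_tendstoD(2)[OF this, of e] e obtain k where k: "ennreal ((1/8)^k) < e"
        by (auto simp: eventually_sequentially)
      show ?thesis
        using eventually_ge_at_top[of "N k"]
      proof eventually_elim
        case (elim m)
        then have "(INF k\<in>{k. N k \<le> m}. ennreal ((1/8)^k)) \<le> ennreal ((1/8)^k)"
          by (intro INF_lower) simp
        then show ?case using k by (rule le_less_trans)
      qed
    qed
    then show "(\<lambda>m. INF k\<in>{k. N k \<le> m}. ennreal ((1/8)^k)) \<longlonglongrightarrow> 0"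
      by (intro order_tendstoI) auto
  next
    fix m k assume "k \<in> {k. N k \<le> m}"
    then have mk: "N k \<le> m" by simp
    \<comment> \<open>Fatou's lemma along the subsequence: the distance to the limit is at most the
      liminf of the distances to \<open>\<phi> (r i)\<close>, all below the rate once
      \<open>i \<ge> k\<close>.\<close>
    have "sqnorm \<mu> (\<lambda>x. \<phi> m x - ?F x)
        = (\<integral>\<^sup>+x. liminf (\<lambda>i. ennreal ((cmod (\<phi> m x - \<phi> (r i) x))\<^sup>2)) \<partial>\<mu>)"
      unfolding sqnorm_def
    proof (rule nn_integral_cong_AE)
      show "AE x in \<mu>. ennreal ((cmod (\<phi> m x - ?F x))\<^sup>2) =
            liminf (\<lambda>i. ennreal ((cmod (\<phi> m x - \<phi> (r i) x))\<^sup>2))"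
        using conv
      proof eventually_elim
        case (elim x)
        have "(\<lambda>i. ennreal ((cmod (\<phi> m x - \<phi> (r i) x))\<^sup>2)) \<longlonglongrightarrow> ennreal ((cmod (\<phi> m x - ?F x))\<^sup>2)"
          by (intro tendsto_ennrealI tendsto_intros elim)
        then show ?case by (rule lim_imp_Liminf[symmetric, rotated]) simp
      qed
    qed
    also have "\<dots> \<le> liminf (\<lambda>i. \<integral>\<^sup>+x. ennreal ((cmod (\<phi> m x - \<phi> (r i) x))\<^sup>2) \<partial>\<mu>)"
      by (rule nn_integral_liminf) simp
    also have "\<dots> \<le> ennreal ((1/8)^k)"
    proof (rule Liminf_le)
      show "\<forall>\<^sub>F i in sequentially.
          (\<integral>\<^sup>+x. ennreal ((cmod (\<phi> m x - \<phi> (r i) x))\<^sup>2) \<partial>\<mu>) \<le> ennreal ((1/8)^k)"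
        using eventually_ge_at_top[of k]
      proof eventually_elim
        case (elim i)
        then have "N k \<le> r i" using Nr[of k] strict_mono_leD[OF r, of k i] by linarith
        then show ?case using N[OF mk, of "r i"] by (simp add: sqnorm_def)
      qed
    qed simp
    finally show "sqnorm \<mu> (\<lambda>x. \<phi> m x - ?F x) \<le> ennreal ((1/8)^k)" .
  qed
  then show ?thesis using that r by (simp add: L2_tendsto_sqnorm)
qed

lemma L2_tendsto_imp_L2:
  assumes "\<And>n. \<phi> n \<in> L2 \<mu>" "f \<in> borel_measurable \<mu>" "L2_tendsto \<mu> \<phi> f"
  shows "f \<in> L2 \<mu>"
proof -
  have [measurable]: "\<phi> n \<in> borel_measurable \<mu>" for n using assms by (auto simp: L2_iff)
  note assms(2)[measurable]
  obtain n where n: "sqnorm \<mu> (\<lambda>x. \<phi> n x - f x) < ennreal 1"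
    using L2_tendsto_eventually[OF assms(3), of 1] by (auto simp: eventually_sequentially)
  then have "sqnorm \<mu> (\<lambda>x. f x - \<phi> n x) < \<infinity>"
    by (subst sqnorm_commute) (auto elim: less_trans)
  then have "(\<lambda>x. f x - \<phi> n x) \<in> L2 \<mu>" by (simp add: L2_iff)
  from L2_add[OF this assms(1)[of n]] show ?thesis by simp
qed

section \<open>Inner products and limits\<close>

lemma borel_measurable_cnj [measurable]:
  "f \<in> borel_measurable M \<Longrightarrow> (\<lambda>x. cnj (f x)) \<in> borel_measurable M"
  by (rule borel_measurable_continuous_on[OF continuous_on_cnj[OF continuous_on_id]])

lemma L2_integrable_inner:
  assumes "f \<in> L2 \<mu>" "g \<in> L2 \<mu>"
  shows "integrable \<mu> (\<lambda>x. f x * cnj (g x))"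
proof (rule Bochner_Integration.integrable_bound)
  show "integrable \<mu> (\<lambda>x. (cmod (f x))\<^sup>2 + (cmod (g x))\<^sup>2)"
    using assms by (auto simp: L2_def)
  have [measurable]: "f \<in> borel_measurable \<mu>" "g \<in> borel_measurable \<mu>" using assms by (auto simp: L2_def)
  show "(\<lambda>x. f x * cnj (g x)) \<in> borel_measurable \<mu>" by measurable
  show "AE x in \<mu>. norm (f x * cnj (g x)) \<le> norm ((cmod (f x))\<^sup>2 + (cmod (g x))\<^sup>2)"
  proof (intro AE_I2)
    fix x
    have "2 * (cmod (f x) * cmod (g x)) \<le> (cmod (f x))\<^sup>2 + (cmod (g x))\<^sup>2"
      using sum_squares_bound[of "cmod (f x)" "cmod (g x)"] by (simp add: mult.assoc)
    moreover have "0 \<le> cmod (f x) * cmod (g x)" by simp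
    ultimately have "cmod (f x) * cmod (g x) \<le> (cmod (f x))\<^sup>2 + (cmod (g x))\<^sup>2" by linarith
    then show "norm (f x * cnj (g x)) \<le> norm ((cmod (f x))\<^sup>2 + (cmod (g x))\<^sup>2)"
      by (simp add: norm_mult)
  qed
qed

lemma L2_inner_commute: "L2_inner \<mu> g f = cnj (L2_inner \<mu> f g)"
  unfolding L2_inner_def by (subst Bochner_Integration.integral_cnj[symmetric]) (simp add: mult.commute)

text \<open>The weighted inequality 2 a b <= s b^2 + a^2 / s stands in for Cauchy-Schwarz and avoids
  square roots of \<open>ennreal\<close> values. The weight s is left free so that the term with the
  fixed function can be made small.\<close>

lemma L2_inner_bound:
  assumes "f \<in> L2 \<mu>" "g \<in> L2 \<mu>" "0 < s"
  shows "ennreal (2 * cmod (L2_inner \<mu> f g)) \<le> ennreal s * sqnorm \<mu> g + ennreal (1/s) * sqnorm \<mu> f"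
proof -
  have [measurable]: "f \<in> borel_measurable \<mu>" "g \<in> borel_measurable \<mu>" using assms by (auto simp: L2_def)
  have "ennreal (2 * cmod (L2_inner \<mu> f g)) = 2 * ennreal (cmod (L2_inner \<mu> f g))"
    by (simp add: ennreal_mult)
  also have "\<dots> \<le> 2 * (\<integral>\<^sup>+x. ennreal (cmod (f x * cnj (g x))) \<partial>\<mu>)"
    unfolding L2_inner_def by (intro mult_left_mono integral_norm_bound_ennreal L2_integrable_inner assms) auto
  also have "\<dots> = (\<integral>\<^sup>+x. ennreal (2 * cmod (f x * cnj (g x))) \<partial>\<mu>)"
    by (subst nn_integral_cmult[symmetric]) (auto simp: ennreal_mult)
  also have "\<dots> \<le> (\<integral>\<^sup>+x. ennreal s * ennreal ((cmod (g x))\<^sup>2) + ennreal (1/s) * ennreal ((cmod (f x))\<^sup>2) \<partial>\<mu>)"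
  proof (rule nn_integral_mono)
    fix x
    have "0 \<le> (s * cmod (g x) - cmod (f x))\<^sup>2 / s" using assms(3) by simp
    also have "\<dots> = s * (cmod (g x))\<^sup>2 + 1/s * (cmod (f x))\<^sup>2 - 2 * (cmod (f x) * cmod (g x))"
      using assms(3) by (simp add: field_simps power2_eq_square)
    finally have "2 * cmod (f x * cnj (g x)) \<le> s * (cmod (g x))\<^sup>2 + 1/s * (cmod (f x))\<^sup>2"
      by (simp add: norm_mult)
    then have "ennreal (2 * cmod (f x * cnj (g x))) \<le> ennreal (s * (cmod (g x))\<^sup>2 + 1/s * (cmod (f x))\<^sup>2)"
      by (rule ennreal_leI)
    also have "\<dots> = ennreal s * ennreal ((cmod (g x))\<^sup>2) + ennreal (1/s) * ennreal ((cmod (f x))\<^sup>2)"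
      using assms(3) by (simp add: ennreal_mult' del: times_divide_eq_left mult_1)
    finally show "ennreal (2 * cmod (f x * cnj (g x))) \<le>
        ennreal s * ennreal ((cmod (g x))\<^sup>2) + ennreal (1/s) * ennreal ((cmod (f x))\<^sup>2)" .
  qed
  also have "\<dots> = ennreal s * sqnorm \<mu> g + ennreal (1/s) * sqnorm \<mu> f"
    unfolding sqnorm_def by (subst nn_integral_add) (auto simp: nn_integral_cmult)
  finally show ?thesis .
qed

lemma L2_inner_zero_limit:
  assumes \<phi>: "\<And>n. \<phi> n \<in> L2 \<mu>" and f: "f \<in> L2 \<mu>" and g: "g \<in> L2 \<mu>"
    and lim: "L2_tendsto \<mu> \<phi> f" and zero: "\<And>n. L2_inner \<mu> (\<phi> n) g = 0"
  shows "L2_inner \<mu> f g = 0"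
proof (rule ccontr)
  assume neq: "L2_inner \<mu> f g \<noteq> 0"
  define d where "d = cmod (L2_inner \<mu> f g)"
  have d: "0 < d" using neq by (simp add: d_def)
  obtain b where b: "sqnorm \<mu> g = ennreal b" "0 \<le> b"
    using g by (cases "sqnorm \<mu> g") (auto simp: L2_iff)
  \<comment> \<open>This weight gives \<open>s * b \<le> d\<close>, so of the lower bound 2 d an
    amount d is left to the term that tends to 0. The summand 1 covers the case b = 0.\<close>
  define s where "s = d / (b + 1)"
  have s: "0 < s" "s * b \<le> d" using d b by (auto simp: s_def field_simps)
  have diff: "(\<lambda>x. f x - \<phi> n x) \<in> L2 \<mu>" for n
    using L2_add[OF f L2_cmult[OF \<phi>[of n], of "-1"]] by simp
  have "L2_inner \<mu> (\<lambda>x. f x - \<phi> n x) g = L2_inner \<mu> f g" for n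
  proof -
    have "L2_inner \<mu> (\<lambda>x. f x - \<phi> n x) g = L2_inner \<mu> f g - L2_inner \<mu> (\<phi> n) g"
      unfolding L2_inner_def left_diff_distrib
      by (intro Bochner_Integration.integral_diff L2_integrable_inner f g \<phi>)
    then show ?thesis using zero by simp
  qed
  then have "ennreal (2 * d) \<le> ennreal s * ennreal b + ennreal (1/s) * sqnorm \<mu> (\<lambda>x. \<phi> n x - f x)" for n
    using L2_inner_bound[OF diff[of n] g s(1)] b(1) by (simp add: d_def sqnorm_commute[of \<mu> f])
  moreover obtain n where "sqnorm \<mu> (\<lambda>x. \<phi> n x - f x) < ennreal (s * d)"
    using L2_tendsto_eventually[OF lim, of "s * d"] s d by (auto simp: eventually_sequentially)
  then obtain c where c: "sqnorm \<mu> (\<lambda>x. \<phi> n x - f x) = ennreal c" "0 \<le> c" "c < s * d"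
    by (cases "sqnorm \<mu> (\<lambda>x. \<phi> n x - f x)") (auto simp: ennreal_less_iff)
  ultimately have "ennreal (2 * d) \<le> ennreal (s * b + 1/s * c)"
    using s b c by (metis ennreal_mult' ennreal_plus mult_nonneg_nonneg less_imp_le zero_le_divide_1_iff)
  then have "2 * d \<le> s * b + 1/s * c" using s b c by (subst (asm) ennreal_le_iff) auto
  moreover have "1/s * c < d" using c s by (simp add: field_simps)
  ultimately show False using s by linarith
qed

text \<open>Boxes form an intersection-stable generator, so Dynkin's theorem leads from boxes to all
  Borel sets; simple functions and dominated limits do the rest. Finiteness of the measure makes the
  constant 1 an admissible bound in \<open>lim1\<close>.\<close>

lemma L2_induct_box:
  fixes \<nu> :: "'a::euclidean_space measure" and P :: "('a \<Rightarrow> complex) \<Rightarrow> bool"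
  assumes fin: "finite_measure \<nu>" and sets [measurable_cong]: "sets \<nu> = sets borel"
    and box: "\<And>a b. P (indicator (box a b))"
    and add: "\<And>f g. f \<in> borel_measurable borel \<Longrightarrow> g \<in> borel_measurable borel \<Longrightarrow>
       P f \<Longrightarrow> P g \<Longrightarrow> P (\<lambda>x. f x + g x)"
    and cmult: "\<And>c f. f \<in> borel_measurable borel \<Longrightarrow> P f \<Longrightarrow> P (\<lambda>x. c * f x)"
    and lim: "\<And>\<phi> f. (\<And>n. \<phi> n \<in> borel_measurable borel) \<Longrightarrow> f \<in> borel_measurable borel \<Longrightarrow>
       (\<And>n. P (\<phi> n)) \<Longrightarrow> L2_tendsto \<nu> \<phi> f \<Longrightarrow> P f"
    and f: "f \<in> L2 \<nu>"
  shows "P f"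
proof -
  interpret finite_measure \<nu> by fact
  have space [simp]: "space \<nu> = UNIV" using sets_eq_imp_space_eq[OF sets] by simp
  have lim1: "P g" if "\<And>n. \<phi> n \<in> borel_measurable borel" "g \<in> borel_measurable borel" "\<And>n. P (\<phi> n)"
    "\<And>n x. cmod (\<phi> n x) \<le> 1" "\<And>x. (\<lambda>n. \<phi> n x) \<longlonglongrightarrow> g x" for \<phi> g
    by (rule lim[of \<phi>, OF that(1-3)], rule L2_tendsto_dominated[where w="\<lambda>_. 1"])
      (use that emeasure_finite[of UNIV] in \<open>auto simp: top.not_eq_extremum[symmetric] simp del: emeasure_finite\<close>)
  have zero: "P (\<lambda>x. 0)" using cmult[OF _ box[of 0 0], of 0] by simp
  have sum: "P (\<lambda>x. \<Sum>i\<in>I. \<phi> i x)"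
    if "finite I" "\<And>i. i \<in> I \<Longrightarrow> \<phi> i \<in> borel_measurable borel" "\<And>i. i \<in> I \<Longrightarrow> P (\<phi> i)" for I :: "'b set" and \<phi>
    using that by (induction I rule: finite_induct) (auto intro!: zero add borel_measurable_sum)
  \<comment> \<open>Complements are obtained by subtraction from the whole space, which is no box
    and has to be exhausted by boxes.\<close>
  have one: "P (indicator UNIV)"
  proof (rule lim1[of "\<lambda>n. indicator (box (- (real n *\<^sub>R One)) (real n *\<^sub>R One))"])
    fix x :: 'a
    show "(\<lambda>n. indicator (box (- (real n *\<^sub>R One)) (real n *\<^sub>R One)) x) \<longlonglongrightarrow> (indicator UNIV x :: complex)"
    proof (rule tendsto_eventually)
      obtain N where N: "norm x < real N" using reals_Archimedean2 by blast
      have "x \<in> box (- (real n *\<^sub>R One)) (real n *\<^sub>R One)" if "n \<ge> N" for n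
        using that N Basis_le_norm[of _ x] by (force simp: mem_box abs_le_iff)
      then show "\<forall>\<^sub>F n in sequentially. indicator (box (- (real n *\<^sub>R One)) (real n *\<^sub>R One)) x = (indicator UNIV x::complex)"
        unfolding eventually_sequentially by (intro exI[of _ N]) (simp add: indicator_def)
    qed
  qed (auto intro: box split: split_indicator)
  have ind: "P (indicator S)" if "S \<in> sets borel" for S :: "'a set"
  proof -
    let ?G = "range (\<lambda>(a, b). box a b :: 'a set)"
    have "Int_stable ?G" "?G \<subseteq> Pow UNIV" "S \<in> sigma_sets UNIV ?G"
      using that by (auto simp: Int_stable_def box_Int_box borel_eq_box)
    then show ?thesis
    proof (induction rule: sigma_sets_induct_disjoint)
      case (basic A)
      then show ?case using box by auto
    next
      case empty
      then show ?case using zero by (simp add: indicator_def)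
    next
      case (compl A)
      then have [measurable]: "A \<in> sets borel" by (simp add: borel_eq_box)
      have "P (\<lambda>x. indicator UNIV x + (- 1) * indicator A x)"
        by (intro add cmult one compl) auto
      also have "(\<lambda>x. indicator UNIV x + (- 1) * indicator A x) = (indicator (UNIV - A) :: _ \<Rightarrow> complex)"
        by (auto simp: indicator_def)
      finally show ?case .
    next
      case (union A)
      then have [measurable]: "A i \<in> sets borel" for i by (auto simp: borel_eq_box)
      \<comment> \<open>By disjointness the partial sums are themselves indicators, hence bounded by
        1 as \<open>lim1\<close> requires.\<close>
      have ps: "(\<Sum>i<n. indicator (A i) x) = (indicator (\<Union>i<n. A i) x :: complex)" for n x
        using union(1)
        by (intro indicator_UN_disjoint[symmetric]) (auto simp: disjoint_family_on_def)
      show ?case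
      proof (rule lim1[of "\<lambda>n x. \<Sum>i<n. indicator (A i) x"])
        show "P (\<lambda>x. \<Sum>i<n. indicator (A i) x)" for n
          by (intro sum) (use union in auto)
        show "(\<lambda>n. \<Sum>i<n. indicator (A i) x) \<longlonglongrightarrow> (indicator (\<Union> (range A)) x :: complex)" for x
          unfolding ps by (rule LIMSEQ_indicator_UN)
      qed (auto simp: ps split: split_indicator)
    qed
  qed
  have [measurable]: "f \<in> borel_measurable borel" using f by (auto simp: L2_iff measurable_cong_sets[OF sets refl])
  then obtain s where s: "\<And>i. simple_function borel (s i)" "\<And>x. (\<lambda>i. s i x) \<longlonglongrightarrow> f x"
      "\<And>i x. cmod (s i x) \<le> 2 * cmod (f x)"
    using borel_measurable_implies_sequence_metric[of f borel 0] by (auto simp: dist_norm) 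
  have [measurable]: "s i \<in> borel_measurable borel" for i
    by (intro borel_measurable_simple_function s)
  show ?thesis
  proof (rule lim[of s])
    show "P (s i)" for i
    proof -
      have fin: "finite (range (s i))" using simple_functionD(1)[OF s(1)[of i]] by simp
      have "P (\<lambda>x. \<Sum>y\<in>range (s i). y * indicator (s i -` {y}) x)"
      proof (intro sum cmult ind fin)
        show "s i -` {y} \<in> sets borel" for y
          using measurable_sets[of "s i" borel borel "{y}"] by simp
        then show "(\<lambda>x. y * indicator (s i -` {y}) x) \<in> borel_measurable borel" for y
          by (intro borel_measurable_times borel_measurable_indicator) auto
        show "indicator (s i -` {y}) \<in> borel_measurable borel" for y
          by (intro borel_measurable_indicator) (use \<open>\<And>y. s i -` {y} \<in> sets borel\<close> in auto)
      qed
      also have "(\<lambda>x. \<Sum>y\<in>range (s i). y * indicator (s i -` {y}) x) = s i"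
        using fin by (auto simp: indicator_def fun_eq_iff if_distrib sum.delta' cong: if_cong)
      finally show ?thesis .
    qed
    show "L2_tendsto \<nu> s f"
    proof (rule L2_tendsto_dominated[where w="\<lambda>x. 2 * cmod (f x)"])
      have "(\<integral>\<^sup>+ x. ennreal ((2 * cmod (f x))\<^sup>2) \<partial>\<nu>) = 4 * sqnorm \<nu> f"
        unfolding sqnorm_def by (subst nn_integral_cmult[symmetric]) (auto simp: power_mult_distrib ennreal_mult)
      then show "(\<integral>\<^sup>+ x. ennreal ((2 * cmod (f x))\<^sup>2) \<partial>\<nu>) < \<infinity>"
        using f by (simp add: L2_iff ennreal_mult_less_top)
    qed (use s in auto)
  qed auto
qed

section \<open>Schwartz functions\<close>

lemma differentiable_imp_partial:
  fixes f :: "real^'n::finite \<Rightarrow> complex"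
  assumes "f differentiable at x"
  shows "((\<lambda>t. f (x + t *\<^sub>R axis i 1)) has_vector_derivative partial_deriv i f x) (at 0)"
proof -
  have "(\<lambda>t::real. x + t *\<^sub>R axis i 1) differentiable at 0"
    unfolding differentiable_def
    by (rule exI, rule has_derivative_add[OF has_derivative_const has_derivative_scaleR_left[OF has_derivative_ident]])
  then have "(f \<circ> (\<lambda>t. x + t *\<^sub>R axis i 1)) differentiable at 0"
    by (rule differentiable_chain_at) (use assms in simp)
  then have "(\<lambda>t. f (x + t *\<^sub>R axis i 1)) differentiable at 0" by (simp add: o_def)
  then show ?thesis
    unfolding partial_deriv_def by (simp add: vector_derivative_works[symmetric])
qed

lemma iter_partial_Nil [simp]: "iter_partial [] f = f"
  by (simp add: iter_partial_def)

lemma iter_partial_Cons [simp]: "iter_partial (i # is) f = partial_deriv i (iter_partial is f)"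
  by (simp add: iter_partial_def)

lemma schwartz_differentiable: "schwartz f \<Longrightarrow> iter_partial is f differentiable at x"
  by (auto simp: schwartz_def differentiable_on_def)

lemma iter_partial_add:
  assumes "schwartz f" "schwartz g"
  shows "iter_partial is (\<lambda>x. f x + g x) = (\<lambda>x. iter_partial is f x + iter_partial is g x)"
proof (induction "is")
  case (Cons i "is")
  have "partial_deriv i (\<lambda>x. iter_partial is f x + iter_partial is g x) x
      = partial_deriv i (iter_partial is f) x + partial_deriv i (iter_partial is g) x" for x
    unfolding partial_deriv_def[of i "\<lambda>x. iter_partial is f x + iter_partial is g x"]
    by (intro vector_derivative_at has_vector_derivative_add differentiable_imp_partial
        schwartz_differentiable assms)
  then show ?case using Cons by auto
qed simp

lemma iter_partial_cmult:
  assumes "schwartz f"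
  shows "iter_partial is (\<lambda>x. c * f x) = (\<lambda>x. c * iter_partial is f x)"
proof (induction "is")
  case (Cons i "is")
  have "partial_deriv i (\<lambda>x. c * iter_partial is f x) x = c * partial_deriv i (iter_partial is f) x" for x
    unfolding partial_deriv_def[of i "\<lambda>x. c * iter_partial is f x"]
    by (intro vector_derivative_at has_vector_derivative_mult_right differentiable_imp_partial
        schwartz_differentiable assms)
  then show ?case using Cons by auto
qed simp

lemma schwartz_add:
  assumes "schwartz f" "schwartz g"
  shows "schwartz (\<lambda>x. f x + g x)"
  unfolding schwartz_def iter_partial_add[OF assms]
proof (intro conjI allI)
  fix "is" N
  show "(\<lambda>x. iter_partial is f x + iter_partial is g x) differentiable_on UNIV"
    using assms by (auto simp: schwartz_def)
  obtain C D where *: "\<And>x. norm x ^ N * cmod (iter_partial is f x) \<le> C"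
      "\<And>x. norm x ^ N * cmod (iter_partial is g x) \<le> D"
    using assms unfolding schwartz_def by metis
  have "norm x ^ N * cmod (iter_partial is f x + iter_partial is g x) \<le> C + D" for x
  proof -
    have "norm x ^ N * cmod (iter_partial is f x + iter_partial is g x)
        \<le> norm x ^ N * (cmod (iter_partial is f x) + cmod (iter_partial is g x))"
      by (intro mult_left_mono norm_triangle_ineq) auto
    then show ?thesis using *[of x] by (simp add: distrib_left)
  qed
  then show "\<exists>C. \<forall>x. norm x ^ N * cmod (iter_partial is f x + iter_partial is g x) \<le> C" by blast
qed

lemma schwartz_cmult:
  assumes "schwartz f"
  shows "schwartz (\<lambda>x. c * f x)"
  unfolding schwartz_def iter_partial_cmult[OF assms]
proof (intro conjI allI)
  fix "is" N
  show "(\<lambda>x. c * iter_partial is f x) differentiable_on UNIV"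
    using assms by (auto simp: schwartz_def intro!: derivative_intros)
  obtain C where *: "\<And>x. norm x ^ N * cmod (iter_partial is f x) \<le> C"
    using assms unfolding schwartz_def by metis
  have "norm x ^ N * cmod (c * iter_partial is f x) \<le> cmod c * C" for x
    using mult_left_mono[OF *[of x], of "cmod c"] by (simp add: norm_mult mult_ac)
  then show "\<exists>C. \<forall>x. norm x ^ N * cmod (c * iter_partial is f x) \<le> C" by blast
qed

lemma schwartz_diff:
  assumes "schwartz f" "schwartz g"
  shows "schwartz (\<lambda>x. f x - g x)"
  using schwartz_add[OF assms(1) schwartz_cmult[OF assms(2), of "-1"]] by simp

lemma schwartz_borel [measurable]: "schwartz f \<Longrightarrow> f \<in> borel_measurable borel"
proof -
  assume "schwartz f"
  then have "iter_partial [] f differentiable_on UNIV" unfolding schwartz_def by blast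
  then show ?thesis
    by (auto intro!: borel_measurable_continuous_onI differentiable_imp_continuous_on)
qed

text \<open>\<open>D i n\<close> plays the n-th derivative of the i-th factor. A partial derivative
  of the product \<open>T \<kappa>\<close> only raises one entry of the multi-index, so these
  products are closed under differentiation, and each of them is continuous and vanishes off a
  compact box.\<close>

lemma schwartz_tensor:
  fixes D :: "'n::finite \<Rightarrow> nat \<Rightarrow> real \<Rightarrow> real"
  assumes deriv: "\<And>i n t. (D i n has_real_derivative D i (Suc n) t) (at t)"
    and supp: "\<And>i n t. t \<notin> {a$i..b$i} \<Longrightarrow> D i n t = 0"
  shows "schwartz (\<lambda>v::real^'n. of_real (\<Prod>i\<in>UNIV. D i 0 (v $ i)))"
proof -
  define T where "T \<kappa> = (\<lambda>v::real^'n. complex_of_real (\<Prod>i\<in>UNIV. D i (\<kappa> i) (v $ i)))" for \<kappa>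
  have partial: "partial_deriv i (T \<kappa>) = T (\<kappa>(i := Suc (\<kappa> i)))" for i \<kappa>
  proof
    fix v :: "real^'n"
    have split: "T \<kappa>' w = of_real (D i (\<kappa>' i) (w $ i) * (\<Prod>j\<in>UNIV-{i}. D j (\<kappa>' j) (w $ j)))" for \<kappa>' w
      unfolding T_def by (subst prod.remove[of UNIV i]) auto
    have "((\<lambda>t. complex_of_real (D i (\<kappa> i) (v $ i + t) * (\<Prod>j\<in>UNIV-{i}. D j (\<kappa> j) (v $ j)))) has_vector_derivative
        of_real (D i (Suc (\<kappa> i)) (v $ i) * (\<Prod>j\<in>UNIV-{i}. D j (\<kappa> j) (v $ j)))) (at 0)"
      using DERIV_shift[of "D i (\<kappa> i)" _ 0 "v $ i"] deriv[of i "\<kappa> i" "v $ i"]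
      by (intro has_vector_derivative_of_real DERIV_cmult_right) (simp add: add.commute)
    moreover have "T \<kappa> (v + t *\<^sub>R axis i 1) = of_real (D i (\<kappa> i) (v $ i + t) * (\<Prod>j\<in>UNIV-{i}. D j (\<kappa> j) (v $ j)))" for t
      unfolding split by (auto simp: axis_def intro!: prod.cong)
    moreover have "T (\<kappa>(i := Suc (\<kappa> i))) v =
        of_real (D i (Suc (\<kappa> i)) (v $ i) * (\<Prod>j\<in>UNIV-{i}. D j (\<kappa> j) (v $ j)))"
      unfolding split by (auto intro!: prod.cong)
    ultimately show "partial_deriv i (T \<kappa>) v = T (\<kappa>(i := Suc (\<kappa> i))) v"
      unfolding partial_deriv_def by (simp only: vector_derivative_at)
  qed
  have iter: "\<exists>\<kappa>. iter_partial is (T (\<lambda>_. 0)) = T \<kappa>" for "is"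
    by (induction "is") (auto simp: partial)
  have D_cont: "continuous_on UNIV (D i n)" for i n
    by (meson deriv DERIV_isCont continuous_at_imp_continuous_on)
  have T_diff: "T \<kappa> differentiable_on UNIV" for \<kappa>
  proof -
    have "(\<lambda>v::real^'n. D i (\<kappa> i) (v $ i)) differentiable at v" for i v
    proof -
      have "D i (\<kappa> i) \<circ> (\<lambda>v. v $ i) differentiable at v"
        using deriv by (intro differentiable_chain_at)
          (auto simp: real_differentiable_def intro: bounded_linear_imp_differentiable bounded_linear_vec_nth)
      then show ?thesis by (simp add: o_def)
    qed
    then have "\<forall>i v. \<exists>f'. ((\<lambda>v::real^'n. D i (\<kappa> i) (v $ i)) has_derivative f') (at v)"
      by (auto simp: differentiable_def)
    then obtain f' where "\<And>i v. ((\<lambda>v::real^'n. D i (\<kappa> i) (v $ i)) has_derivative f' i v) (at v)"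
      by metis
    then have "(T \<kappa> has_derivative
       (\<lambda>y. complex_of_real (\<Sum>i\<in>UNIV. f' i v y * (\<Prod>j\<in>UNIV-{i}. D j (\<kappa> j) (v $ j))))) (at v)" for v
      unfolding T_def by (intro has_derivative_of_real has_derivative_prod) auto
    then show ?thesis
      by (auto simp: differentiable_on_def differentiable_def)
  qed
  have T_bound: "\<exists>C. \<forall>x. norm x ^ N * cmod (T \<kappa> x) \<le> C" for N \<kappa>
  proof -
    have "continuous_on (cbox a b) (\<lambda>x. norm x ^ N * cmod (T \<kappa> x))"
      by (intro continuous_intros continuous_on_subset[OF differentiable_imp_continuous_on[OF T_diff]]) auto
    then have "bounded ((\<lambda>x. norm x ^ N * cmod (T \<kappa> x)) ` cbox a b)"
      by (intro compact_imp_bounded compact_continuous_image compact_cbox)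
    then obtain C where C: "0 < C" "\<And>x. x \<in> cbox a b \<Longrightarrow> norm x ^ N * cmod (T \<kappa> x) \<le> C"
      unfolding bounded_pos by force
    have "T \<kappa> x = 0" if out: "x \<notin> cbox a b" for x
    proof -
      obtain i where "x $ i \<notin> {a$i..b$i}" using out unfolding mem_box_cart atLeastAtMost_iff by blast
      then have "D i (\<kappa> i) (x $ i) = 0" by (rule supp)
      then show ?thesis unfolding T_def by (subst prod_zero) auto
    qed
    then have "norm x ^ N * cmod (T \<kappa> x) \<le> C" for x
      using C(1) C(2)[of x] by (cases "x \<in> cbox a b") auto
    then show ?thesis by blast
  qed
  have "schwartz (T (\<lambda>_. 0))"
    unfolding schwartz_def
  proof (intro conjI allI)
    fix "is" N
    obtain \<kappa> where "iter_partial is (T (\<lambda>_. 0)) = T \<kappa>" using iter by blast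
    then show "iter_partial is (T (\<lambda>_. 0)) differentiable_on UNIV"
        "\<exists>C. \<forall>x. norm x ^ N * cmod (iter_partial is (T (\<lambda>_. 0)) x) \<le> C"
      using T_diff T_bound by simp_all
  qed
  then show ?thesis by (simp add: T_def)
qed

subsection \<open>Bump functions\<close>

text \<open>The polynomial factor makes this family of one-sided flat functions closed under
  differentiation. The rate c is a parameter because the limit c -> 0 later turns bumps into
  indicators.\<close>

definition flat :: "real \<Rightarrow> real poly \<Rightarrow> real \<Rightarrow> real" where
  "flat c p t = (if 0 < t then poly p (1 / t) * exp (- c / t) else 0)"

text \<open>In the variable s = 1/t this is s^2 (c p(s) - p'(s)), the polynomial that appears when
  p(1/t) exp(-c/t) is differentiated.\<close>

definition flat_step :: "real \<Rightarrow> real poly \<Rightarrow> real poly" where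
  "flat_step c p = [:0, 0, 1:] * (smult c p - pderiv p)"

lemma poly_exp_tendsto_0:
  assumes "0 < c"
  shows "((\<lambda>s::real. poly p s * exp (- c * s)) \<longlongrightarrow> 0) at_top"
proof -
  have "((\<lambda>s::real. s ^ n * exp (- c * s)) \<longlongrightarrow> 0) at_top" for n
  proof -
    have "filterlim (\<lambda>s::real. c * s) at_top at_top"
      using assms by (intro filterlim_tendsto_pos_mult_at_top[OF tendsto_const]) (auto simp: filterlim_ident)
    then have "((\<lambda>s. (c * s) ^ n / exp (c * s)) \<longlongrightarrow> 0) at_top"
      by (rule filterlim_compose[OF tendsto_power_div_exp_0])
    then have "((\<lambda>s. (1 / c ^ n) * ((c * s) ^ n / exp (c * s))) \<longlongrightarrow> (1 / c ^ n) * 0) at_top"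
      by (intro tendsto_intros)
    moreover have "(\<lambda>s. (1 / c ^ n) * ((c * s) ^ n / exp (c * s))) = (\<lambda>s. s ^ n * exp (- c * s))"
      using assms by (auto simp: fun_eq_iff power_mult_distrib exp_minus field_simps)
    ultimately show ?thesis by simp
  qed
  then have "((\<lambda>s. \<Sum>i\<le>degree p. coeff p i * (s ^ i * exp (- c * s))) \<longlongrightarrow> (\<Sum>i\<le>degree p. coeff p i * 0)) at_top"
    by (intro tendsto_intros)
  then show ?thesis by (simp add: poly_altdef sum_distrib_right mult.assoc)
qed

lemma flat_deriv:
  assumes c: "0 < c"
  shows "(flat c p has_real_derivative flat c (flat_step c p) t) (at t)"
proof -
  consider "t < 0" | "t = 0" | "0 < t" by linarith
  then show ?thesis
  proof cases
    case 1
    have "(flat c p has_real_derivative 0) (at t)"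
      by (rule has_field_derivative_transform_within_open[of "\<lambda>_. 0" _ _ "{..<0}"])
        (use 1 in \<open>auto simp: flat_def\<close>)
    then show ?thesis using 1 by (simp add: flat_def)
  next
    case 2
    \<comment> \<open>In the variable s = 1/h the right difference quotient at 0 is s p(s) exp(-c
      s); the division by h accounts for the factor \<open>[:0, 1:]\<close>.\<close>
    have "((\<lambda>h. flat c p h / h) \<longlongrightarrow> 0) (at_right 0)"
      unfolding filterlim_at_right_to_top
    proof (rule Lim_transform_eventually[OF poly_exp_tendsto_0[OF c, of "[:0,1:] * p"]])
      show "\<forall>\<^sub>F x in at_top. poly ([:0, 1:] * p) x * exp (- c * x) = flat c p (inverse x) / inverse x"
        using eventually_gt_at_top[of 0] by eventually_elim (simp add: flat_def field_simps)
    qed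
    moreover have "((\<lambda>h. flat c p h / h) \<longlongrightarrow> 0) (at_left 0)"
      by (rule tendsto_eventually) (auto simp: flat_def eventually_at_filter)
    ultimately have "((\<lambda>h. flat c p h / h) \<longlongrightarrow> 0) (at 0)" by (rule filterlim_split_at_real[rotated])
    then show ?thesis using 2 by (simp add: has_field_derivative_iff flat_def)
  next
    case 3
    have "((\<lambda>t. poly p (1 / t) * exp (- c / t)) has_real_derivative
        poly (flat_step c p) (1 / t) * exp (- c / t)) (at t)"
    proof -
      have inv: "((\<lambda>t. d / t) has_real_derivative - d * (1 / t)\<^sup>2) (at t)" for d
        by (rule derivative_eq_intros refl | use 3 in \<open>simp add: power2_eq_square\<close>)+
      have "((\<lambda>t. poly p (1 / t) * exp (- c / t)) has_real_derivative
          (- 1 * (1 / t)\<^sup>2) * poly (pderiv p) (1 / t) * exp (- c / t)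
          + exp (- c / t) * (- (- c) * (1 / t)\<^sup>2) * poly p (1 / t)) (at t)"
        by (rule DERIV_mult[OF DERIV_chain2[OF poly_DERIV inv] DERIV_chain2[OF DERIV_exp inv],
              THEN DERIV_cong]) (simp add: mult_ac)
      then show ?thesis
        by (rule DERIV_cong) (simp add: flat_step_def algebra_simps power2_eq_square)
    qed
    then have "(flat c p has_real_derivative poly (flat_step c p) (1 / t) * exp (- c / t)) (at t)"
      by (rule has_field_derivative_transform_within_open[of _ _ _ "{0<..}"])
        (use 3 in \<open>auto simp: flat_def\<close>)
    then show ?thesis using 3 by (simp add: flat_def)
  qed
qed

text \<open>Products flat at both ends are not closed under differentiation, but by the Leibniz rule
  their sums are. The minus sign from the right end is absorbed into the polynomial.\<close>

inductive bump_like :: "real \<Rightarrow> real \<Rightarrow> real \<Rightarrow> (real \<Rightarrow> real) \<Rightarrow> bool" for c a b where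
  base: "bump_like c a b (\<lambda>t. flat c p (t - a) * flat c q (b - t))"
| add: "bump_like c a b f \<Longrightarrow> bump_like c a b g \<Longrightarrow> bump_like c a b (\<lambda>t. f t + g t)"

lemma bump_like_deriv:
  assumes "bump_like c a b f" "0 < c"
  shows "\<exists>g. bump_like c a b g \<and> (\<forall>t. (f has_real_derivative g t) (at t))"
  using assms(1)
proof induction
  case (base p q)
  let ?g = "\<lambda>t. flat c (flat_step c p) (t - a) * flat c q (b - t)
      + flat c p (t - a) * flat c (- flat_step c q) (b - t)"
  have neg: "flat c (- r) t = - flat c r t" for r t by (simp add: flat_def)
  have "((\<lambda>t. flat c p (t - a) * flat c q (b - t)) has_real_derivative ?g t) (at t)" for t
    unfolding neg
    by (rule derivative_eq_intros DERIV_chain2[OF flat_deriv[OF assms(2)]] refl | simp)+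
  moreover have "bump_like c a b ?g" by (intro bump_like.intros)
  ultimately show ?case by blast
next
  case (add f g)
  then obtain f' g' where "bump_like c a b f'" "bump_like c a b g'"
      "\<And>t. (f has_real_derivative f' t) (at t)" "\<And>t. (g has_real_derivative g' t) (at t)" by blast
  then show ?case
    by (intro exI[of _ "\<lambda>t. f' t + g' t"]) (auto intro: bump_like.add DERIV_add)
qed

lemma bump_like_support: "bump_like c a b f \<Longrightarrow> t \<notin> {a..b} \<Longrightarrow> f t = 0"
  by (induction rule: bump_like.induct) (auto simp: flat_def)

text \<open>Inside the open box every factor exp(-c/t) tends to 1 as c -> 0, outside the bump is 0,
  and it never exceeds 1. So dominated convergence gives the indicator of the box without
  mollifiers.\<close>

definition bump :: "real \<Rightarrow> real^'n \<Rightarrow> real^'n \<Rightarrow> real^'n::finite \<Rightarrow> complex" where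
  "bump c a b v = of_real (\<Prod>i\<in>UNIV. flat c 1 (v $ i - a $ i) * flat c 1 (b $ i - v $ i))"

lemma schwartz_bump:
  assumes c: "0 < c"
  shows "schwartz (bump c a b)"
proof -
  \<comment> \<open>A whole sequence of successive derivatives is chosen within
    \<open>bump_like\<close>; the clause for n = 0 pins its first member to the given
    factor.\<close>
  have "\<exists>D. \<forall>n. (bump_like c (a $ i) (b $ i) (D n) \<and>
        (n = 0 \<longrightarrow> D n = (\<lambda>t. flat c 1 (t - a $ i) * flat c 1 (b $ i - t)))) \<and>
        (\<forall>t. (D n has_real_derivative D (Suc n) t) (at t))" for i
    by (rule dependent_nat_choice) (auto intro: bump_like.base bump_like_deriv[OF _ c])
  then obtain D where D: "\<And>i n. bump_like c (a $ i) (b $ i) (D i n)"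
      "\<And>i. D i 0 = (\<lambda>t. flat c 1 (t - a $ i) * flat c 1 (b $ i - t))"
      "\<And>i n t. (D i n has_real_derivative D i (Suc n) t) (at t)"
    by metis
  have "schwartz (\<lambda>v. of_real (\<Prod>i\<in>UNIV. D i 0 (v $ i)))"
    by (rule schwartz_tensor[where D = D and a = a and b = b]) (fact D(3), rule bump_like_support[OF D(1)])
  then show ?thesis by (simp add: D(2) bump_def[abs_def])
qed

lemma schwartz_zero: "schwartz (\<lambda>_. 0)"
  using schwartz_cmult[OF schwartz_bump[of 1 0 0], of 0] by simp

lemma bump_eq_0: "v \<notin> box a b \<Longrightarrow> bump c a b v = 0"
proof -
  assume "v \<notin> box a b"
  then obtain i where "\<not> (a $ i < v $ i \<and> v $ i < b $ i)" by (auto simp: mem_box_cart)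
  then show ?thesis unfolding bump_def by (subst prod_zero[of _]) (auto simp: flat_def intro!: bexI[of _ i])
qed

lemma cmod_bump_le_1: "0 < c \<Longrightarrow> cmod (bump c a b v) \<le> 1"
  unfolding bump_def norm_of_real abs_prod
  by (intro prod_le_1) (auto simp: flat_def abs_mult mult_le_one)

lemma bump_tendsto_indicator:
  "(\<lambda>n. bump (1 / real (Suc n)) a b v) \<longlonglongrightarrow> indicator (box a b) v"
proof (cases "v \<in> box a b")
  case False
  then show ?thesis by (simp add: bump_eq_0)
next
  case True
  have flat: "(\<lambda>n. flat (1 / real (Suc n)) 1 t) \<longlonglongrightarrow> 1" if "0 < t" for t
  proof -
    have "(\<lambda>n. - (1 / real (Suc n)) / t) \<longlonglongrightarrow> - 0 / t"
      using that by (intro tendsto_intros LIMSEQ_Suc[OF lim_1_over_n]) auto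
    from tendsto_exp[OF this] show ?thesis using that by (simp add: flat_def)
  qed
  have "(\<lambda>n. bump (1 / real (Suc n)) a b v) \<longlonglongrightarrow> of_real (\<Prod>i\<in>(UNIV::'a set). 1 * 1)"
    unfolding bump_def using True
    by (intro tendsto_of_real tendsto_prod tendsto_mult flat) (auto simp: mem_box_cart)
  then show ?thesis using True by simp
qed

lemma bump_translate: "bump c (a + w) (b + w) v = bump c a b (v - w)"
  by (simp add: bump_def algebra_simps)

subsection \<open>Decay along the lattice\<close>

lemma summable_on_inverse_squares_int: "(\<lambda>m::int. 1 / (1 + (of_int m)\<^sup>2) :: real) summable_on UNIV"
proof -
  have "summable (\<lambda>n. norm (1 / (1 + (real n)\<^sup>2)))"
  proof (rule summable_comparison_test'[where N = 1])
    show "summable (\<lambda>n. inverse (real n ^ 2))" by (rule inverse_power_summable) simp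
    show "norm (norm (1 / (1 + (real n)\<^sup>2))) \<le> inverse (real n ^ 2)" if "n \<ge> 1" for n
      using that by (simp add: divide_simps add_pos_nonneg)
  qed
  then have nat: "(\<lambda>n. 1 / (1 + (real n)\<^sup>2)) summable_on UNIV" by (rule norm_summable_imp_summable_on)
  have "(\<lambda>m::int. 1 / (1 + (of_int m)\<^sup>2) :: real) summable_on (range int)"
    by (subst summable_on_reindex) (use nat in \<open>auto simp: o_def\<close>)
  moreover have "(\<lambda>m::int. 1 / (1 + (of_int m)\<^sup>2) :: real) summable_on (range (\<lambda>n. - int n))"
    by (subst summable_on_reindex) (use nat in \<open>auto simp: o_def inj_def\<close>)
  ultimately have "(\<lambda>m::int. 1 / (1 + (of_int m)\<^sup>2) :: real) summable_on (range int \<union> range (\<lambda>n. - int n))"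
    by (rule summable_on_union)
  moreover have "range int \<union> range (\<lambda>n. - int n) = UNIV"
  proof (intro set_eqI iffI UNIV_I)
    show "m \<in> range int \<union> range (\<lambda>n. - int n)" for m
      by (cases m rule: int_cases2) auto
  qed
  ultimately show ?thesis by simp
qed

lemma summable_on_prod_inverse_squares:
  "(\<lambda>m::(int, 'n::finite) vec. \<Prod>i\<in>UNIV. 1 / (1 + (of_int (m $ i))\<^sup>2) :: real) summable_on UNIV"
proof -
  let ?g = "\<lambda>m::int. 1 / (1 + (of_int m)\<^sup>2) :: real"
  have "Infinite_Sum.abs_summable_on ?g UNIV"
    using summable_on_inverse_squares_int by simp
  then have "Infinite_Set_Sum.abs_summable_on ?g UNIV"
    by (simp only: abs_summable_equivalent)
  then have "Infinite_Set_Sum.abs_summable_on (\<lambda>m. \<Prod>i\<in>UNIV. ?g (m i)) (PiE (UNIV::'n set) (\<lambda>_. UNIV))"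
    by (intro abs_summable_on_prod_PiE) auto
  then have "Infinite_Sum.abs_summable_on (\<lambda>m. \<Prod>i\<in>UNIV. ?g (m i)) (UNIV :: ('n \<Rightarrow> int) set)"
    by (simp only: abs_summable_equivalent PiE_UNIV_domain Pi_UNIV)
  then have "(\<lambda>m. \<Prod>i\<in>UNIV. ?g (m i)) summable_on (UNIV :: ('n \<Rightarrow> int) set)"
    by (rule abs_summable_summable)
  moreover have "bij_betw vec_nth (UNIV :: ((int, 'n) vec) set) UNIV"
    by (rule bij_betwI[where g = vec_lambda]) (simp_all add: fun_eq_iff)
  ultimately show ?thesis
    using summable_on_reindex_bij_betw[of vec_nth UNIV UNIV "\<lambda>m. \<Prod>i\<in>UNIV. ?g (m i)"] by blast
qed

text \<open>This trades decay in the norm for decay in every coordinate separately, so that the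
  lattice sum is dominated by a product of one-dimensional sums.\<close>

lemma prod_one_plus_squares_le: "(\<Prod>i\<in>UNIV. 1 + (v $ i)\<^sup>2) \<le> 2 ^ CARD('n) * (1 + norm v ^ (2 * CARD('n)))"
  for v :: "real^'n::finite"
proof -
  have "(\<Prod>i\<in>UNIV. 1 + (v $ i)\<^sup>2) \<le> (\<Prod>i\<in>(UNIV::'n set). 1 + (norm v)\<^sup>2)"
  proof (rule prod_mono)
    fix i
    have "(v $ i)\<^sup>2 \<le> (norm v)\<^sup>2"
      using component_le_norm_cart[of v i] by (metis abs_le_square_iff abs_norm_cancel)
    then show "0 \<le> 1 + (v $ i)\<^sup>2 \<and> 1 + (v $ i)\<^sup>2 \<le> 1 + (norm v)\<^sup>2" by simp
  qed
  also have "\<dots> = (1 + (norm v)\<^sup>2) ^ CARD('n)" by simp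
  also have "\<dots> \<le> 2 ^ CARD('n) * (1 + norm v ^ (2 * CARD('n)))"
  proof (cases "norm v \<le> 1")
    case True
    then have "(norm v)\<^sup>2 \<le> 1" by (simp add: power_le_one)
    then have "(1 + (norm v)\<^sup>2) ^ CARD('n) \<le> 2 ^ CARD('n)" by (intro power_mono) auto
    also have "\<dots> \<le> 2 ^ CARD('n) * (1 + norm v ^ (2 * CARD('n)))" by simp
    finally show ?thesis .
  next
    case False
    then have "1 \<le> (norm v)\<^sup>2" by (simp add: one_le_power)
    then have "(1 + (norm v)\<^sup>2) ^ CARD('n) \<le> (2 * (norm v)\<^sup>2) ^ CARD('n)" by (intro power_mono) auto
    also have "\<dots> = 2 ^ CARD('n) * norm v ^ (2 * CARD('n))" by (simp add: power_mult_distrib power_mult)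
    also have "\<dots> \<le> 2 ^ CARD('n) * (1 + norm v ^ (2 * CARD('n)))" by simp
    finally show ?thesis .
  qed
  finally show ?thesis .
qed

text \<open>The majorant does not depend on u within a cube. Thus it gives both the absolute
  convergence of the lattice sum and a uniform bound for it on the fundamental domain.\<close>

lemma schwartz_lattice_decay:
  fixes l :: "real^'n::{finite,linorder}"
  assumes l: "\<And>j. 0 < l $ j" and f: "schwartz f"
  obtains A where "A summable_on UNIV" "\<And>m. 0 \<le> A m"
    "\<And>u m. (\<And>i. \<bar>u $ i\<bar> \<le> R) \<Longrightarrow> cmod (f (u + int_scale m l)) \<le> A m"
proof -
  let ?n = "CARD('n)"
  obtain C D where C: "\<And>x. norm x ^ 0 * cmod (iter_partial [] f x) \<le> C"
      and D: "\<And>x. norm x ^ (2 * ?n) * cmod (iter_partial [] f x) \<le> D"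
    using f unfolding schwartz_def by metis
  have CD: "cmod (f x) + norm x ^ (2 * ?n) * cmod (f x) \<le> C + D" for x
    using add_mono[OF C[of x] D[of x]] by simp
  define E where "E = 2 ^ ?n * (C + D)"
  have E: "(\<Prod>i\<in>UNIV. 1 + (v $ i)\<^sup>2) * cmod (f v) \<le> E" for v
  proof -
    have "(\<Prod>i\<in>UNIV. 1 + (v $ i)\<^sup>2) * cmod (f v) \<le> (2 ^ ?n * (1 + norm v ^ (2 * ?n))) * cmod (f v)"
      by (intro mult_right_mono prod_one_plus_squares_le) auto
    also have "\<dots> = 2 ^ ?n * (cmod (f v) + norm v ^ (2 * ?n) * cmod (f v))" by (simp add: algebra_simps)
    also have "\<dots> \<le> E" unfolding E_def by (intro mult_left_mono CD) auto
    finally show ?thesis .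
  qed
  have E0: "0 \<le> E"
    using order_trans[OF _ E[of 0]] by simp
  \<comment> \<open>With v = u + m l one has (m_i l_i)^2 <= 2 v_i^2 + 2 R^2 <= (2 R^2 + 2)(1 +
    v_i^2); hence 1 + m_i^2 <= \<open>K i * (1 + v_i^2)\<close>.\<close>
  define K where "K i = 1 + (2 * R\<^sup>2 + 2) / (l $ i)\<^sup>2" for i
  have K: "0 < K i" for i
    using l[of i] by (auto simp: K_def intro!: add_pos_nonneg)
  define A where "A m = E * (\<Prod>i\<in>UNIV. K i) * (\<Prod>i\<in>UNIV. 1 / (1 + (of_int (m $ i))\<^sup>2))" for m :: "(int, 'n) vec"
  have "cmod (f (u + int_scale m l)) \<le> A m" if u: "\<And>i. \<bar>u $ i\<bar> \<le> R" for u m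
  proof -
    let ?v = "u + int_scale m l"
    have le: "1 + (of_int (m $ i))\<^sup>2 \<le> K i * (1 + (?v $ i)\<^sup>2)" for i
    proof -
      have "of_int (m $ i) * l $ i = ?v $ i - u $ i" by (simp add: int_scale_def)
      then have "(of_int (m $ i))\<^sup>2 * (l $ i)\<^sup>2 = (?v $ i - u $ i)\<^sup>2" by (metis power_mult_distrib)
      also have "\<dots> \<le> 2 * (?v $ i)\<^sup>2 + 2 * (u $ i)\<^sup>2"
        using zero_le_power2[of "?v $ i + u $ i"] unfolding power2_sum power2_diff by linarith
      also have "\<dots> \<le> 2 * (?v $ i)\<^sup>2 + 2 * R\<^sup>2"
        using u[of i] abs_le_square_iff[of "u $ i" R] by simp
      finally have "(of_int (m $ i))\<^sup>2 \<le> (2 * (?v $ i)\<^sup>2 + 2 * R\<^sup>2) / (l $ i)\<^sup>2"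
        using l[of i] by (simp add: pos_le_divide_eq)
      also have "\<dots> \<le> ((2 * R\<^sup>2 + 2) * (1 + (?v $ i)\<^sup>2)) / (l $ i)\<^sup>2"
        by (intro divide_right_mono) (auto simp: algebra_simps)
      finally have "(of_int (m $ i))\<^sup>2 \<le> (2 * R\<^sup>2 + 2) / (l $ i)\<^sup>2 * (1 + (?v $ i)\<^sup>2)" by simp
      moreover have "K i * (1 + (?v $ i)\<^sup>2) = 1 + (?v $ i)\<^sup>2 + (2 * R\<^sup>2 + 2) / (l $ i)\<^sup>2 * (1 + (?v $ i)\<^sup>2)"
        unfolding K_def by (simp only: distrib_right mult_1)
      ultimately show ?thesis using zero_le_power2[of "?v $ i"] by linarith
    qed
    have "(\<Prod>i\<in>UNIV. 1 + (of_int (m $ i))\<^sup>2) \<le> (\<Prod>i\<in>UNIV. K i * (1 + (?v $ i)\<^sup>2))"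
      by (rule prod_mono) (rule conjI[OF _ le], simp)
    then have "(\<Prod>i\<in>UNIV. 1 + (of_int (m $ i))\<^sup>2) * cmod (f ?v)
        \<le> (\<Prod>i\<in>UNIV. K i * (1 + (?v $ i)\<^sup>2)) * cmod (f ?v)" by (intro mult_right_mono) auto
    also have "\<dots> = (\<Prod>i\<in>UNIV. K i) * ((\<Prod>i\<in>UNIV. 1 + (?v $ i)\<^sup>2) * cmod (f ?v))"
      by (simp add: prod.distrib)
    also have "\<dots> \<le> (\<Prod>i\<in>UNIV. K i) * E"
      by (intro mult_left_mono E prod_nonneg) (auto intro: less_imp_le K)
    finally have "cmod (f ?v) \<le> (\<Prod>i\<in>UNIV. K i) * E / (\<Prod>i\<in>UNIV. 1 + (of_int (m $ i))\<^sup>2)"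
      by (subst pos_le_divide_eq) (auto intro!: prod_pos add_pos_nonneg simp: mult.commute)
    then show ?thesis by (simp add: A_def prod_dividef mult.commute)
  qed
  moreover have "A summable_on UNIV"
    unfolding A_def[abs_def] by (intro summable_on_cmult_right summable_on_prod_inverse_squares)
  moreover have "0 \<le> A m" for m
    unfolding A_def by (intro mult_nonneg_nonneg prod_nonneg E0) (auto intro: less_imp_le K)
  ultimately show ?thesis using that by blast
qed

section \<open>Characters of the torus\<close>

definition chr :: "(int, 'n::finite) vec \<Rightarrow> real^'n \<Rightarrow> complex" where
  "chr q x = cis (2 * pi * (\<Sum>i\<in>UNIV. of_int (q $ i) * x $ i))"

lemma chr_0 [simp]: "chr 0 x = 1"
  by (simp add: chr_def)

lemma chr_add: "chr (p + q) x = chr p x * chr q x"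
  by (simp add: chr_def cis_mult distrib_right sum.distrib distrib_left)

lemma chr_diff: "chr (p - q) x = chr p x * chr (- q) x"
  using chr_add[of p "- q"] by simp

lemma cmod_chr [simp]: "cmod (chr q x) = 1"
  by (simp add: chr_def)

lemma cnj_chr: "cnj (chr q x) = chr (- q) x"
  by (simp add: chr_def cis_cnj sum_negf)

lemma chr_minus_cancel [simp]: "chr (- q) x * chr q x = 1" "chr q x * chr (- q) x = 1"
  by (simp_all flip: chr_add)

lemma cis_2pi_int: "t \<in> \<int> \<Longrightarrow> cis (2 * pi * t) = 1"
  by (auto simp: complex_eq_iff cos_integer_2pi sin_integer_2pi)

lemma chr_periodic: "(\<And>i. a $ i \<in> \<int>) \<Longrightarrow> chr q (a + x) = chr q x"
proof -
  assume "\<And>i. a $ i \<in> \<int>"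
  then have "cis (2 * pi * (\<Sum>i\<in>UNIV. of_int (q $ i) * a $ i)) = 1"
    by (intro cis_2pi_int) auto
  then show ?thesis
    by (simp add: chr_def distrib_left sum.distrib cis_mult[symmetric])
qed

lemma continuous_on_chr [continuous_intros]: "continuous_on S (chr q)"
  unfolding chr_def[abs_def] by (intro continuous_intros)

lemma borel_measurable_chr [measurable]: "chr q \<in> borel_measurable borel"
  by (intro borel_measurable_continuous_onI continuous_on_chr)

section \<open>Integration over the torus\<close>

definition unit_cube :: "(real^'n::finite) set" where
  "unit_cube = {x. \<forall>j. 0 \<le> x $ j \<and> x $ j < 1}"

definition torus :: "(real^'n::finite) measure" where
  "torus = restrict_space lborel unit_cube"

lemma unit_cube_borel [measurable]: "unit_cube \<in> sets borel"
  unfolding unit_cube_def by measurable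

lemma borel_imp_torus: "f \<in> borel_measurable borel \<Longrightarrow> f \<in> borel_measurable torus"
  unfolding torus_def by (intro measurable_restrict_space1) simp

lemma indicator_unit_cube: "indicator unit_cube x = (\<Prod>i\<in>UNIV. indicator {0..<1} (x $ i) :: real)"
  by (auto simp: indicator_def unit_cube_def)

lemma prod_Basis_vec: "(\<Prod>b\<in>(Basis :: (real^'n::finite) set). h b) = (\<Prod>i\<in>UNIV. h (axis i 1))"
proof -
  have eq: "(Basis :: (real^'n) set) = range (\<lambda>i. axis i 1)" by (auto simp: Basis_vec_def)
  have inj: "inj (\<lambda>i::'n. axis i (1::real))" by (auto simp: inj_def axis_eq_axis)
  show ?thesis unfolding eq prod.reindex[OF inj] o_def ..
qed

text \<open>\<open>lborel\<close> is the image of a product measure indexed by basis vectors, while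
  the factors are indexed by coordinates. The auxiliary \<open>F\<close> carries the family
  \<open>f\<close> over to the basis vectors, and then the integral of a product over a product
  measure factors.\<close>

lemma lborel_integral_prod:
  fixes f :: "'n::finite \<Rightarrow> real \<Rightarrow> complex"
  assumes int: "\<And>i. integrable lborel (f i)"
  shows "integrable lborel (\<lambda>x::real^'n. \<Prod>i\<in>UNIV. f i (x $ i))"
    and "(LINT x|lborel. (\<Prod>i\<in>UNIV. f i (x $ i :: real))) = (\<Prod>i\<in>(UNIV :: 'n set). LINT t|lborel. f i t)"
proof -
  interpret product_sigma_finite "\<lambda>_::real^'n. lborel :: real measure" ..
  let ?S = "\<lambda>g::real^'n \<Rightarrow> real. \<Sum>b\<in>Basis. g b *\<^sub>R b"
  have [measurable]: "f i \<in> borel_measurable borel" for i using int[of i] by auto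
  define F where "F b = f (SOME i. b = axis i 1)" for b :: "real^'n"
  have F: "F (axis i 1) = f i" for i
    unfolding F_def by (rule arg_cong[where f=f], rule some_equality) (auto simp: axis_eq_axis)
  have comp: "?S g $ i = g (axis i 1)" for g i
  proof -
    have "?S g $ i = ?S g \<bullet> axis i 1" by (simp add: inner_axis)
    also have "\<dots> = g (axis i 1)"
      by (rule inner_sum_left_Basis) (auto simp: Basis_vec_def)
    finally show ?thesis .
  qed
  have eq: "(\<Prod>i\<in>UNIV. f i (?S g $ i)) = (\<Prod>b\<in>Basis. F b (g b))" for g
    unfolding prod_Basis_vec comp F ..
  have meas: "?S \<in> measurable (\<Pi>\<^sub>M b\<in>Basis. lborel) borel" by measurable
  have Fint: "integrable lborel (F b)" for b by (simp add: F_def int)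
  have "integrable (\<Pi>\<^sub>M b\<in>Basis. lborel) (\<lambda>g. \<Prod>b\<in>Basis. F b (g b))"
    by (rule product_integrable_prod) (auto simp: Fint)
  then show "integrable lborel (\<lambda>x::real^'n. \<Prod>i\<in>UNIV. f i (x $ i))"
    by (subst lborel_eq, subst integrable_distr_eq[OF meas]) (measurable, simp only: eq)
  show "(LINT x|lborel. (\<Prod>i\<in>UNIV. f i (x $ i :: real))) = (\<Prod>i\<in>(UNIV :: 'n set). LINT t|lborel. f i t)"
  proof (subst lborel_eq, subst integral_distr[OF meas])
    show "(LINT g|(\<Pi>\<^sub>M b\<in>Basis. lborel). (\<Prod>i\<in>UNIV. f i (?S g $ i))) = (\<Prod>i\<in>UNIV. LINT t|lborel. f i t)"
      unfolding eq by (subst product_integral_prod) (simp_all add: Fint prod_Basis_vec F)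
  qed measurable
qed

lemma integral_cis_int:
  fixes n :: int
  shows "integrable lborel (\<lambda>t. indicator {0..<1} t *\<^sub>R cis (2 * pi * (of_int n * t)))"
    and "(LINT t|lborel. indicator {0..<1} t *\<^sub>R cis (2 * pi * (of_int n * t))) = (if n = 0 then 1 else 0)"
proof -
  have cont: "continuous_on S (\<lambda>t. cis (2 * pi * (of_int n * t)))" for S
    by (intro continuous_intros)
  \<comment> \<open>The cube is half-open so that it is a fundamental domain; the fundamental
    theorem of calculus wants a closed interval. The endpoint is a null set.\<close>
  have ae: "AE t in lborel. indicator {0..<1} t *\<^sub>R cis (2 * pi * (of_int n * t))
      = indicator {0..1} t *\<^sub>R cis (2 * pi * (of_int n * t))"
    using AE_lborel_singleton[of "1::real"] by eventually_elim (auto simp: indicator_def)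
  have [measurable]: "(\<lambda>t. cis (2 * pi * (of_int n * t))) \<in> borel_measurable borel"
    by (rule borel_measurable_continuous_onI[OF cont])
  have int: "integrable lborel (\<lambda>t. indicator {0..1} t *\<^sub>R cis (2 * pi * (of_int n * t)))"
    by (rule borel_integrable_compact) (auto simp: cont)
  show "integrable lborel (\<lambda>t. indicator {0..<1} t *\<^sub>R cis (2 * pi * (of_int n * t)))"
    by (subst integrable_cong_AE[OF _ _ ae]) (use int in auto)
  have "(LINT t|lborel. indicator {0..<1} t *\<^sub>R cis (2 * pi * (of_int n * t)))
      = (LINT t|lborel. indicator {0..1} t *\<^sub>R cis (2 * pi * (of_int n * t)))"
    by (rule integral_cong_AE[OF _ _ ae]) auto
  also have "\<dots> = (if n = 0 then 1 else 0)"
  proof (cases "n = 0")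
    case True
    then show ?thesis by simp
  next
    case False
    define c where "c = 2 * pi * of_int n"
    have c: "c \<noteq> 0" using False by (simp add: c_def)
    have "(LINT t|lborel. indicator {0..1} t *\<^sub>R cis (c * t)) = cis (c * 1) / (\<i> * c) - cis (c * 0) / (\<i> * c)"
    proof (rule integral_FTC_atLeastAtMost)
      have "((\<lambda>t. exp (\<i> * (complex_of_real c * complex_of_real t)) / (\<i> * c))
          has_vector_derivative exp (\<i> * (complex_of_real c * complex_of_real t))) (at t within {0..1})" for t
        by (rule has_vector_derivative_real_field)
          (use c in \<open>auto intro!: derivative_eq_intros simp: mult.left_commute[of "\<i>"]\<close>)
      then show "((\<lambda>t. cis (c * t) / (\<i> * c)) has_vector_derivative cis (c * t)) (at t within {0..1})" for t
        by (simp add: cis_conv_exp)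
      show "continuous_on {0..1} (\<lambda>t. cis (c * t))" by (intro continuous_intros)
    qed simp
    also have "cis (c * 1) = 1" unfolding c_def using cis_2pi_int[of "of_int n"] by simp
    finally show ?thesis using False by (simp add: c_def mult.assoc)
  qed
  finally show "(LINT t|lborel. indicator {0..<1} t *\<^sub>R cis (2 * pi * (of_int n * t))) = (if n = 0 then 1 else 0)" .
qed

lemma cis_sum: "finite A \<Longrightarrow> cis (\<Sum>i\<in>A. f i) = (\<Prod>i\<in>A. cis (f i))"
  by (induction A rule: finite_induct) (auto simp: cis_mult[symmetric])

lemma integral_chr:
  fixes q :: "(int, 'n::finite) vec"
  shows "integrable torus (chr q)" "(LINT x|torus. chr q x) = (if q = 0 then 1 else 0)"
proof -
  let ?f = "\<lambda>i t. indicator {0..<1} t *\<^sub>R cis (2 * pi * (of_int (q $ i) * t))"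
  have eq: "indicator unit_cube x *\<^sub>R chr q x = (\<Prod>i\<in>UNIV. ?f i (x $ i))" for x
    unfolding chr_def sum_distrib_left indicator_unit_cube
    by (simp add: cis_sum scaleR_conv_of_real prod.distrib)
  show "integrable torus (chr q)"
    unfolding torus_def
    by (subst integrable_restrict_space) (auto simp: eq[unfolded scaleR_conv_of_real] scaleR_conv_of_real
        intro!: lborel_integral_prod(1)[OF integral_cis_int(1), unfolded scaleR_conv_of_real])
  have "(LINT x|torus. chr q x) = (\<Prod>i\<in>UNIV. LINT t|lborel. ?f i t)"
    unfolding torus_def
    by (subst integral_restrict_space) (auto simp only: eq lborel_integral_prod(2)[OF integral_cis_int(1)] sets_lborel unit_cube_borel space_lborel Int_UNIV_right)
  also have "\<dots> = (if q = 0 then 1 else 0)"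
    by (auto simp: integral_cis_int(2) vec_eq_iff)
  finally show "(LINT x|torus. chr q x) = (if q = 0 then 1 else 0)" .
qed

text \<open>The trivial character has integral 1, so the volume needs no separate
  computation.\<close>

lemma emeasure_torus: "emeasure torus (space (torus :: (real^'n::finite) measure)) = 1"
proof -
  have one: "chr (0 :: (int, 'n) vec) = (\<lambda>_. 1)" by (simp add: fun_eq_iff)
  have "complex_of_real (measure torus (space (torus :: (real^'n) measure))) = 1"
    using integral_chr(2)[of "0 :: (int, 'n) vec"] by (simp add: torus_def scaleR_conv_of_real)
  moreover have "integrable (torus :: (real^'n) measure) (\<lambda>_. 1::complex)"
    using integral_chr(1)[of "0 :: (int, 'n) vec"] unfolding one .
  then have "emeasure torus (space (torus :: (real^'n) measure)) < \<infinity>"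
    by (auto simp: integrable_iff_bounded)
  ultimately show ?thesis
    by (simp add: emeasure_eq_ennreal_measure)
qed

section \<open>Parseval's identity for absolutely summable coefficients\<close>

lemma Parseval_finite:
  fixes c :: "(int, 'n::finite) vec \<Rightarrow> complex"
  assumes "finite S"
  shows "sqnorm torus (\<lambda>x. \<Sum>q\<in>S. c q * chr q x) = ennreal (\<Sum>q\<in>S. (cmod (c q))\<^sup>2)"
proof -
  let ?s = "\<lambda>x. \<Sum>q\<in>S. c q * chr q x"
  have sq: "complex_of_real ((cmod (?s x))\<^sup>2) = (\<Sum>q\<in>S. \<Sum>r\<in>S. c q * cnj (c r) * chr (q - r) x)" for x
    unfolding complex_norm_square cnj_sum sum_product
    by (intro sum.cong refl) (simp add: cnj_chr chr_diff mult_ac)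
  have int: "integrable torus (\<lambda>x. complex_of_real ((cmod (?s x))\<^sup>2))"
    unfolding sq by (intro Bochner_Integration.integrable_sum integrable_mult_right integral_chr(1))
  then have int': "integrable torus (\<lambda>x. (cmod (?s x))\<^sup>2)"
    unfolding complex_of_real_integrable_eq .
  have "complex_of_real (LINT x|torus. (cmod (?s x))\<^sup>2) = (LINT x|torus. complex_of_real ((cmod (?s x))\<^sup>2))"
    by (rule integral_complex_of_real[symmetric])
  also have "\<dots> = (\<Sum>q\<in>S. \<Sum>r\<in>S. c q * cnj (c r) * (if q - r = 0 then 1 else 0))"
    unfolding sq by (simp add: Bochner_Integration.integral_sum integrable_mult_right integral_chr)
  also have "\<dots> = (\<Sum>q\<in>S. c q * cnj (c q))"
    using assms by (intro sum.cong refl) (simp add: if_distrib[of "\<lambda>z. _ * z"] sum.delta' cong: if_cong)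
  also have "\<dots> = complex_of_real (\<Sum>q\<in>S. (cmod (c q))\<^sup>2)"
    by (simp add: complex_norm_square del: of_real_power)
  finally have "(LINT x|torus. (cmod (?s x))\<^sup>2) = (\<Sum>q\<in>S. (cmod (c q))\<^sup>2)"
    by (simp only: of_real_eq_iff)
  then show ?thesis
    unfolding sqnorm_def by (subst nn_integral_eq_integral[OF int']) auto
qed

text \<open>An enumeration of Z^n turns unordered sums into limits of sequences, which dominated
  convergence and the measurability of limits require.\<close>

definition enum_vec :: "nat \<Rightarrow> (int, 'n::finite) vec" where
  "enum_vec = from_nat_into UNIV"

lemma bij_enum_vec: "bij_betw (enum_vec :: nat \<Rightarrow> (int, 'n::finite) vec) UNIV UNIV"
proof -
  have inj: "inj (\<lambda>i::int. (\<chi> _. i) :: (int, 'n) vec)"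
    by (auto simp: inj_def vec_eq_iff)
  have "infinite (UNIV :: (int, 'n) vec set)"
  proof
    assume "finite (UNIV :: (int, 'n) vec set)"
    then have "finite (range (\<lambda>i::int. (\<chi> _. i) :: (int, 'n) vec))"
      by (rule finite_subset[OF subset_UNIV])
    then have "finite (UNIV :: int set)" by (rule finite_imageD[OF _ inj])
    then show False using infinite_UNIV_int by blast
  qed
  then show ?thesis
    unfolding enum_vec_def by (intro bij_betw_from_nat_into) auto
qed

lemma sum_enum_vec: "(\<Sum>q\<in>enum_vec ` {..<n}. f q) = (\<Sum>i<n. f (enum_vec i :: (int, 'n::finite) vec))"
proof -
  have "inj_on (enum_vec :: nat \<Rightarrow> (int, 'n) vec) {..<n}"
    by (rule inj_on_subset[OF bij_betw_imp_inj_on[OF bij_enum_vec]]) simp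
  then show ?thesis by (simp add: sum.reindex)
qed

lemma infsum_enum_vec:
  fixes f :: "(int, 'n::finite) vec \<Rightarrow> 'a::{comm_monoid_add, t2_space}"
  assumes "f summable_on UNIV"
  shows "(\<lambda>n. \<Sum>q\<in>enum_vec ` {..<n}. f q) \<longlonglongrightarrow> infsum f UNIV"
proof -
  have "(f has_sum infsum f UNIV) UNIV" using assms by simp
  then have "((\<lambda>n. f (enum_vec n)) has_sum infsum f UNIV) UNIV"
    by (subst has_sum_reindex_bij_betw[OF bij_enum_vec])
  then have "(\<lambda>n. f (enum_vec n)) sums infsum f UNIV" by (rule has_sum_imp_sums)
  then show ?thesis by (simp add: sums_def sum_enum_vec)
qed

lemma nn_integral_count_enum_vec:
  fixes f :: "(int, 'n::finite) vec \<Rightarrow> ennreal"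
  shows "(\<lambda>n. \<Sum>q\<in>enum_vec ` {..<n}. f q) \<longlonglongrightarrow> (\<integral>\<^sup>+q. f q \<partial>count_space UNIV)"
proof -
  have eq: "(\<integral>\<^sup>+q. f q \<partial>count_space UNIV) = (\<Sum>n. f (enum_vec n))"
    unfolding nn_integral_count_space_nat[symmetric]
    by (rule nn_integral_bij_count_space[OF bij_enum_vec, symmetric])
  have "(\<lambda>n. f (enum_vec n)) sums (\<Sum>n. f (enum_vec n))"
    by (intro summable_sums summableI)
  then show ?thesis unfolding eq sums_def sum_enum_vec .
qed

text \<open>All partial sums are bounded by the sum of the moduli, a constant that is
  square-integrable because the torus has mass 1. So the finite identity passes to the limit by
  dominated convergence.\<close>

lemma Parseval_abs_summable:
  fixes c :: "(int, 'n::finite) vec \<Rightarrow> complex"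
  assumes c: "(\<lambda>q. cmod (c q)) summable_on UNIV"
  shows "sqnorm torus (\<lambda>x. infsum (\<lambda>q. c q * chr q x) UNIV) = (\<integral>\<^sup>+q. ennreal ((cmod (c q))\<^sup>2) \<partial>count_space UNIV)"
proof -
  let ?F = "\<lambda>n::nat. enum_vec ` {..<n} :: (int, 'n) vec set"
  let ?B = "infsum (\<lambda>q. cmod (c q)) UNIV"
  have lim: "(\<lambda>n. \<Sum>q\<in>?F n. c q * chr q x) \<longlonglongrightarrow> infsum (\<lambda>q. c q * chr q x) UNIV" for x
  proof (rule infsum_enum_vec[of "\<lambda>q. c q * chr q x"], rule abs_summable_summable)
    show "(\<lambda>q. cmod (c q * chr q x)) summable_on UNIV" using c by (simp add: norm_mult)
  qed
  have meas: "(\<lambda>x. \<Sum>q\<in>?F n. c q * chr q x) \<in> borel_measurable torus" for n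
    by (intro borel_imp_torus) measurable
  have "(\<lambda>n. sqnorm torus (\<lambda>x. \<Sum>q\<in>?F n. c q * chr q x)) \<longlonglongrightarrow> sqnorm torus (\<lambda>x. infsum (\<lambda>q. c q * chr q x) UNIV)"
    unfolding sqnorm_def
  proof (rule nn_integral_dominated_convergence[where w = "\<lambda>_. ennreal (?B\<^sup>2)"])
    show "(\<lambda>x. ennreal ((cmod (\<Sum>q\<in>?F n. c q * chr q x))\<^sup>2)) \<in> borel_measurable torus" for n
      using meas[of n] by measurable
    have "(\<lambda>x. infsum (\<lambda>q. c q * chr q x) UNIV) \<in> borel_measurable torus"
      by (rule borel_measurable_LIMSEQ_metric[OF meas lim])
    then show "(\<lambda>x. ennreal ((cmod (infsum (\<lambda>q. c q * chr q x) UNIV))\<^sup>2)) \<in> borel_measurable torus"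
      by measurable
    show "(\<integral>\<^sup>+x. ennreal (?B\<^sup>2) \<partial>torus) < \<infinity>"
      by (simp add: emeasure_torus)
    show "AE x in torus. ennreal ((cmod (\<Sum>q\<in>?F n. c q * chr q x))\<^sup>2) \<le> ennreal (?B\<^sup>2)" for n
    proof (intro AE_I2 ennreal_leI power_mono)
      fix x
      have "cmod (\<Sum>q\<in>?F n. c q * chr q x) \<le> (\<Sum>q\<in>?F n. cmod (c q))"
        by (rule order_trans[OF norm_sum]) (simp add: norm_mult)
      also have "\<dots> \<le> ?B" by (rule finite_sum_le_infsum[OF c]) auto
      finally show "cmod (\<Sum>q\<in>?F n. c q * chr q x) \<le> ?B" .
    qed simp
    show "AE x in torus. (\<lambda>n. ennreal ((cmod (\<Sum>q\<in>?F n. c q * chr q x))\<^sup>2))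
        \<longlonglongrightarrow> ennreal ((cmod (infsum (\<lambda>q. c q * chr q x) UNIV))\<^sup>2)"
      by (intro AE_I2 tendsto_ennrealI tendsto_power tendsto_norm lim)
  qed simp
  moreover have "sqnorm torus (\<lambda>x. \<Sum>q\<in>?F n. c q * chr q x) = (\<Sum>q\<in>?F n. ennreal ((cmod (c q))\<^sup>2))" for n
    by (subst Parseval_finite) auto
  ultimately show ?thesis
    using LIMSEQ_unique nn_integral_count_enum_vec[of "\<lambda>q. ennreal ((cmod (c q))\<^sup>2)"] by simp
qed

section \<open>The Weil--Brezin--Zak transform\<close>

text \<open>Divisibility is assumed only for neighbours, so the quotient is a telescoping product.
  The induction runs over the number of smaller coordinates, with \<open>p\<close> the immediate
  predecessor of \<open>i\<close>.\<close>

lemma admissible_ratio: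
  fixes l :: "real^'n::{finite,linorder}"
  assumes "admissible l"
  shows "l $ i / l $ first \<in> \<int>"
proof (induction i rule: measure_induct_rule[where f = "\<lambda>i. card {..<i}"])
  case (less i)
  have pos: "0 < l $ j" for j using assms by (simp add: admissible_def)
  show ?case
  proof (cases "{..<i} = {}")
    case True
    then have "i = first" unfolding first_def
      by (intro Min_eqI[symmetric]) (auto simp: set_eq_iff not_less)
    then show ?thesis using pos[of first] by simp
  next
    case False
    define p where "p = Max {..<i}"
    have p: "p < i" using Max_in[of "{..<i}"] False by (simp add: p_def)
    have gap: "{p<..<i} = {}"
      using Max_ge[of "{..<i}"] unfolding p_def by (auto simp: not_less[symmetric])
    have "l $ p / l $ first \<in> \<int>"
      by (rule less, rule psubset_card_mono) (use p in \<open>auto simp: psubset_eq\<close>)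
    moreover have "l $ i / l $ p \<in> \<int>"
      using assms p gap by (auto simp: admissible_def)
    ultimately have "(l $ i / l $ p) * (l $ p / l $ first) \<in> \<int>" by (rule Ints_mult[rotated])
    then show ?thesis using pos[of p] by simp
  qed
qed

text \<open>Extend the coefficients by 0 off the image of \<open>g\<close>. Injectivity prevents two
  coefficients from being added at one frequency, which would create cross terms.\<close>

lemma Parseval_inj:
  fixes c :: "'i \<Rightarrow> complex" and g :: "'i \<Rightarrow> (int, 'n::finite) vec"
  assumes inj: "inj_on g A" and c: "(\<lambda>i. cmod (c i)) summable_on A"
  shows "sqnorm torus (\<lambda>x. infsum (\<lambda>i. c i * chr (g i) x) A)
    = (\<integral>\<^sup>+i. ennreal ((cmod (c i))\<^sup>2) \<partial>count_space A)"
proof -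
  define c' where "c' q = (if q \<in> g ` A then c (inv_into A g q) else 0)" for q
  have c'g: "c' (g i) = c i" if "i \<in> A" for i
    using that inj by (simp add: c'_def)
  have c'0: "q \<notin> g ` A \<Longrightarrow> c' q = 0" for q by (simp add: c'_def)
  have "(\<lambda>q. cmod (c' q)) summable_on g ` A"
    by (subst summable_on_reindex[OF inj]) (use c in \<open>simp add: o_def c'g cong: summable_on_cong\<close>)
  then have "(\<lambda>q. cmod (c' q)) summable_on UNIV"
    by (rule summable_on_cong_neutral[THEN iffD1, rotated -1]) (auto simp: c'0)
  from Parseval_abs_summable[OF this]
  have "sqnorm torus (\<lambda>x. infsum (\<lambda>q. c' q * chr q x) UNIV)
      = (\<integral>\<^sup>+q. ennreal ((cmod (c' q))\<^sup>2) \<partial>count_space UNIV)" .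
  moreover have "infsum (\<lambda>q. c' q * chr q x) UNIV = infsum (\<lambda>i. c i * chr (g i) x) A" for x
  proof -
    have "infsum (\<lambda>q. c' q * chr q x) UNIV = infsum (\<lambda>q. c' q * chr q x) (g ` A)"
      by (rule infsum_cong_neutral) (auto simp: c'0)
    also have "\<dots> = infsum (\<lambda>i. c' (g i) * chr (g i) x) A"
      using infsum_reindex[OF inj, of "\<lambda>q. c' q * chr q x"] by (simp add: o_def)
    also have "\<dots> = infsum (\<lambda>i. c i * chr (g i) x) A"
      by (rule infsum_cong) (simp add: c'g)
    finally show ?thesis .
  qed
  moreover have "(\<integral>\<^sup>+q. ennreal ((cmod (c' q))\<^sup>2) \<partial>count_space UNIV)
      = (\<integral>\<^sup>+i. ennreal ((cmod (c i))\<^sup>2) \<partial>count_space A)"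
  proof -
    have "(\<integral>\<^sup>+q. ennreal ((cmod (c' q))\<^sup>2) \<partial>count_space UNIV)
        = (\<integral>\<^sup>+q. ennreal ((cmod (c' q))\<^sup>2) \<partial>count_space (g ` A))"
      by (rule nn_integral_count_space_eq) (auto simp: c'0)
    also have "\<dots> = (\<integral>\<^sup>+i. ennreal ((cmod (c' (g i)))\<^sup>2) \<partial>count_space A)"
      using nn_integral_bij_count_space[of g A "g ` A" "\<lambda>q. ennreal ((cmod (c' q))\<^sup>2)"] inj
      by (simp add: bij_betw_def)
    also have "\<dots> = (\<integral>\<^sup>+i. ennreal ((cmod (c i))\<^sup>2) \<partial>count_space A)"
      by (rule nn_integral_cong) (simp add: c'g)
    finally show ?thesis .
  qed
  ultimately show ?thesis by simp
qed

locale zak =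
  fixes l :: "real^'n::{finite,linorder}" and k :: int
  assumes adm: "admissible l" and k0: "k \<noteq> 0"
begin

abbreviation "\<mu> \<equiv> measure_M l"

lemma pos: "0 < l $ j"
  using adm by (simp add: admissible_def)

definition ratio :: "(int, 'n) vec" where
  "ratio = (\<chi> i. \<lfloor>l $ i / l $ first\<rfloor>)"

text \<open>This is 2 k p m: \<open>chr (dil m)\<close> is the exponential of the m-th term of V_k,
  and the cosets of the image of \<open>dil\<close> are the elements of
  \<open>Ak l k\<close>.\<close>

definition dil :: "(int, 'n) vec \<Rightarrow> (int, 'n) vec" where
  "dil m = (\<chi> i. 2 * k * ratio $ i * m $ i)"

lemma of_int_ratio: "of_int (ratio $ i) = l $ i / l $ first"
  using admissible_ratio[OF adm, of i] by (simp add: ratio_def Ints_def)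

lemma ratio_neq_0: "ratio $ i \<noteq> 0"
proof -
  have "real_of_int (ratio $ i) > 0" unfolding of_int_ratio using pos by simp
  then show ?thesis by auto
qed

lemma freq_l: "freq l k * l $ i = 2 * pi * of_int (2 * k * ratio $ i)"
  using pos[of first] by (simp add: freq_def of_int_ratio)

lemma dil_add: "dil (m + m') = dil m + dil m'"
  by (simp add: dil_def vec_eq_iff algebra_simps)

lemma dil_minus: "dil (- m) = - dil m"
  by (simp add: dil_def vec_eq_iff)

lemma inj_dil: "dil m = dil m' \<longleftrightarrow> m = m'"
  using ratio_neq_0 k0 by (auto simp: dil_def vec_eq_iff)

lemma chr_dil: "chr (dil m) x = cis (freq l k * (\<Sum>j\<in>UNIV. l $ j * of_int (m $ j) * x $ j))"
proof -
  have "2 * pi * (\<Sum>i\<in>UNIV. of_int (dil m $ i) * x $ i)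
      = (\<Sum>j\<in>UNIV. (freq l k * l $ j) * (of_int (m $ j) * x $ j))"
    unfolding freq_l sum_distrib_left by (intro sum.cong) (auto simp: dil_def mult_ac)
  then show ?thesis by (simp add: chr_def sum_distrib_left mult.assoc)
qed

text \<open>The factor common to all functions involved. Being unimodular, it drops out of every
  norm, and with it the dependence on \<xi>.\<close>

definition phase :: "'n heis \<Rightarrow> complex" where
  "phase = (\<lambda>(x, u, \<xi>). cis (freq l k * \<xi>) * cis (freq l k / 2 * (x \<bullet> u)))"

lemma cmod_phase [simp]: "cmod (phase p) = 1"
  by (simp add: phase_def norm_mult split: prod.split)

lemma continuous_phase: "continuous_on UNIV phase"
  unfolding phase_def case_prod_unfold by (intro continuous_intros)

lemma borel_measurable_phase [measurable]: "phase \<in> borel_measurable borel"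
  by (rule borel_measurable_continuous_onI[OF continuous_phase])

text \<open>The group law contributes half of b.x and minus half of a.u; expanding (x + a).(u + b)/2
  cancels the latter and doubles the former, and \<open>freq l k\<close> times b.x is the angle of
  \<open>chr (dil b) x\<close>. The remaining terms are full turns.\<close>

lemma phase_lattice:
  fixes a b :: "(int, 'n) vec"
  shows "phase (heis_mult (\<chi> j. of_int (a $ j), int_scale b l, of_int c * (l $ first / 2)) (x, u, \<xi>))
    = chr (dil b) x * phase (x, u, \<xi>)"
proof -
  let ?a = "(\<chi> j. of_int (a $ j)) :: (real, 'n) vec"
  let ?b = "int_scale b l"
  \<comment> \<open>The number of full turns: half of \<open>freq l k * l $ first\<close> is 2 pi k,
    which yields c k, and half of \<open>freq l k\<close> times a.b yields the sum.\<close>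
  define d :: int where "d = c * k + (\<Sum>j\<in>UNIV. a $ j * (k * ratio $ j * b $ j))"
  have b: "?b \<bullet> x = (\<Sum>j\<in>UNIV. l $ j * of_int (b $ j) * x $ j)"
    by (simp add: inner_vec_def int_scale_def mult_ac)
  have "freq l k * (?a \<bullet> ?b) = (\<Sum>j\<in>UNIV. (freq l k * l $ j) * (of_int (a $ j) * of_int (b $ j)))"
    by (simp add: inner_vec_def int_scale_def sum_distrib_left mult_ac)
  also have "\<dots> = 2 * (2 * pi * of_int (\<Sum>j\<in>UNIV. a $ j * (k * ratio $ j * b $ j)))"
    unfolding freq_l by (simp add: sum_distrib_left mult_ac)
  finally have ab: "freq l k * (?a \<bullet> ?b) = 2 * (2 * pi * of_int (\<Sum>j\<in>UNIV. a $ j * (k * ratio $ j * b $ j)))" .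
  have "freq l k * (\<xi> + of_int c * (l $ first / 2) + (?b \<bullet> x - ?a \<bullet> u) / 2)
        + freq l k / 2 * ((?a + x) \<bullet> (?b + u))
      = freq l k * (?b \<bullet> x) + (freq l k * \<xi> + freq l k / 2 * (x \<bullet> u))
        + of_int c * (freq l k * l $ first) / 2 + (freq l k * (?a \<bullet> ?b)) / 2"
    by (simp add: inner_add_left inner_add_right inner_commute[of x ?b] algebra_simps diff_divide_distrib add_divide_distrib)
  also have "\<dots> = freq l k * (?b \<bullet> x) + (freq l k * \<xi> + freq l k / 2 * (x \<bullet> u)) + 2 * pi * of_int d"
    unfolding ab freq_l using pos[of first] by (simp add: of_int_ratio d_def algebra_simps)
  finally have "phase (heis_mult (?a, ?b, of_int c * (l $ first / 2)) (x, u, \<xi>))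
      = cis (freq l k * (?b \<bullet> x) + (freq l k * \<xi> + freq l k / 2 * (x \<bullet> u)) + 2 * pi * of_int d)"
    by (simp add: phase_def cis_mult add.commute add.left_commute)
  also have "\<dots> = cis (freq l k * (?b \<bullet> x)) * (cis (freq l k * \<xi>) * cis (freq l k / 2 * (x \<bullet> u)))"
    using cis_2pi_int[of "of_int d"] by (simp add: cis_mult[symmetric])
  finally show ?thesis unfolding chr_dil b[symmetric] by (simp add: phase_def)
qed

definition Z :: "((real, 'n) vec \<Rightarrow> complex) \<Rightarrow> (real, 'n) vec \<Rightarrow> (real, 'n) vec \<Rightarrow> complex" where
  "Z f x u = infsum (\<lambda>m. chr (dil m) x * f (u + int_scale m l)) UNIV"

text \<open>\<open>W j f\<close> is \<open>V\<^sub>k\<^sub>,\<^sub>j f\<close>.\<close>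

definition W :: "(int, 'n) vec \<Rightarrow> ((real, 'n) vec \<Rightarrow> complex) \<Rightarrow> 'n heis \<Rightarrow> complex" where
  "W j f = (\<lambda>(x, u, \<xi>). chr j x * V_schwartz l k f (x, u, \<xi>))"

lemma W_eq: "W j f (x, u, \<xi>) = phase (x, u, \<xi>) * (chr j x * Z f x u)"
  unfolding W_def V_schwartz_def phase_def Z_def chr_dil by simp

lemma V_eq: "V_schwartz l k f = W 0 f"
  by (auto simp: W_def)

lemma Z_summable:
  assumes "schwartz f"
  shows "(\<lambda>m. cmod (f (u + int_scale m l))) summable_on UNIV"
proof -
  obtain A where A: "A summable_on UNIV"
    "\<And>v m. (\<And>i. \<bar>v $ i\<bar> \<le> norm u) \<Longrightarrow> cmod (f (v + int_scale m l)) \<le> A m"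
    using schwartz_lattice_decay[OF pos assms, of "norm u"] by metis
  show ?thesis
    by (rule summable_on_comparison_test[OF A(1)]) (auto intro!: A(2) component_le_norm_cart)
qed

lemma Z_summable':
  assumes "schwartz f"
  shows "(\<lambda>m. chr (dil m) x * f (u + int_scale m l)) summable_on UNIV"
  by (rule abs_summable_summable) (use Z_summable[OF assms] in \<open>simp add: norm_mult\<close>)

lemma Z_add:
  assumes "schwartz f" "schwartz g"
  shows "Z (\<lambda>v. f v + g v) x u = Z f x u + Z g x u"
  unfolding Z_def using infsum_add[OF Z_summable'[OF assms(1)] Z_summable'[OF assms(2)]]
  by (simp add: distrib_left)

lemma Z_cmult: "Z (\<lambda>v. c * f v) x u = c * Z f x u"
  unfolding Z_def infsum_cmult_right'[symmetric] by (simp add: mult.left_commute)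

lemma W_add: "schwartz f \<Longrightarrow> schwartz g \<Longrightarrow> W j (\<lambda>v. f v + g v) p = W j f p + W j g p"
  by (cases p) (simp add: W_eq Z_add algebra_simps)

lemma W_cmult: "W j (\<lambda>v. c * f v) p = c * W j f p"
  by (cases p) (simp add: W_eq Z_cmult algebra_simps)

lemma W_zero: "W j (\<lambda>_. 0) p = 0"
  using W_cmult[of j 0 "\<lambda>_. 0" p] by simp

lemma W_diff: "schwartz f \<Longrightarrow> schwartz g \<Longrightarrow> W j (\<lambda>v. f v - g v) p = W j f p - W j g p"
  using W_add[of f "\<lambda>v. (-1) * g v" j p] W_cmult[of j "-1" g p] schwartz_cmult[of g "-1"] by simp

lemma borel_measurable_Z:
  assumes "schwartz f"
  shows "(\<lambda>p. Z f (fst p) (snd p)) \<in> borel_measurable borel"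
proof (rule borel_measurable_LIMSEQ_metric)
  note [measurable] = schwartz_borel[OF assms]
  show "(\<lambda>p. \<Sum>m\<in>enum_vec ` {..<n}. chr (dil m) (fst p) * f (snd p + int_scale m l)) \<in> borel_measurable borel" for n :: nat
    unfolding borel_prod[symmetric] by measurable
  show "(\<lambda>n. \<Sum>m\<in>enum_vec ` {..<n}. chr (dil m) (fst p) * f (snd p + int_scale m l)) \<longlonglongrightarrow> Z f (fst p) (snd p)" for p
    unfolding Z_def
    by (rule infsum_enum_vec[of "\<lambda>m. chr (dil m) (fst p) * f (snd p + int_scale m l)", OF Z_summable'[OF assms]])
qed

lemma borel_measurable_W:
  assumes "schwartz f"
  shows "W j f \<in> borel_measurable borel"
proof -
  have 1: "(\<lambda>p::'n heis. Z f (fst p) (fst (snd p))) \<in> borel_measurable borel"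
    using measurable_compose[OF _ borel_measurable_Z[OF assms], of "\<lambda>p::'n heis. (fst p, fst (snd p))" borel]
    by (simp add: borel_measurable_continuous_onI continuous_intros)
  have 2: "(\<lambda>p::'n heis. chr j (fst p)) \<in> borel_measurable borel"
    by (intro borel_measurable_continuous_onI continuous_on_compose2[OF continuous_on_chr[of UNIV]] continuous_intros) auto
  have "W j f = (\<lambda>p. phase p * (chr j (fst p) * Z f (fst p) (fst (snd p))))"
    by (auto simp: fun_eq_iff W_eq)
  then show ?thesis using 1 2 by simp
qed

text \<open>Replacing the summation index m by b + m shows that translation by b l multiplies the
  lattice sum by \<open>chr (- dil b) x\<close>, the inverse of the factor produced by
  \<open>phase\<close>.\<close>

lemma lattice_invariant_W:
  "lattice_invariant l (W j f)"
  unfolding lattice_invariant_def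
proof (intro ballI allI)
  fix \<gamma> p :: "'n heis" assume "\<gamma> \<in> lattice l"
  then obtain a b c where \<gamma>: "\<gamma> = (\<chi> i. of_int (a $ i), int_scale b l, of_int c * (l $ first / 2))"
    by (auto simp: lattice_def)
  obtain x u \<xi> where p: "p = (x, u, \<xi>)" by (cases p)
  let ?a = "(\<chi> i. of_int (a $ i)) :: (real, 'n) vec"
  have chr: "chr q (?a + x) = chr q x" for q by (rule chr_periodic) simp
  have "Z f (?a + x) (int_scale b l + u)
      = infsum (\<lambda>m. chr (- dil b) x * (chr (dil (b + m)) x * f (u + int_scale (b + m) l))) UNIV"
  proof (unfold Z_def, rule infsum_cong)
    fix m
    have "int_scale b l + u + int_scale m l = u + int_scale (b + m) l"
      by (simp add: int_scale_def vec_eq_iff algebra_simps)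
    moreover have "chr (dil m) x = chr (- dil b) x * chr (dil (b + m)) x"
      by (simp add: dil_add flip: chr_add)
    ultimately show "chr (dil m) (?a + x) * f (int_scale b l + u + int_scale m l)
        = chr (- dil b) x * (chr (dil (b + m)) x * f (u + int_scale (b + m) l))"
      by (simp only: chr mult.assoc)
  qed
  also have "\<dots> = chr (- dil b) x * infsum (\<lambda>m. chr (dil (b + m)) x * f (u + int_scale (b + m) l)) UNIV"
    by (rule infsum_cmult_right')
  also have "infsum (\<lambda>m. chr (dil (b + m)) x * f (u + int_scale (b + m) l)) UNIV = Z f x u"
    unfolding Z_def
    by (rule infsum_reindex_bij_betw[of "(+) b" UNIV UNIV "\<lambda>m. chr (dil m) x * f (u + int_scale m l)"])
      (rule bij_plus)
  finally have Z: "Z f (?a + x) (int_scale b l + u) = chr (- dil b) x * Z f x u" .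
  have "W j f (heis_mult \<gamma> p)
      = phase (heis_mult \<gamma> p) * (chr j (?a + x) * Z f (?a + x) (int_scale b l + u))"
    unfolding \<gamma> p heis_mult.simps W_eq ..
  also have "\<dots> = (chr (- dil b) x * chr (dil b) x) * W j f p"
    unfolding chr Z \<gamma> p phase_lattice W_eq by (simp only: mult_ac)
  finally show "W j f (heis_mult \<gamma> p) = W j f p" by simp
qed

subsection \<open>Integration over the fundamental domain\<close>

definition cell :: "((real, 'n) vec) set" where
  "cell = {u. \<forall>j. 0 \<le> u $ j \<and> u $ j < l $ j}"

lemma cell_borel [measurable]: "cell \<in> sets borel"
  unfolding cell_def by measurable

lemma fund_domain_eq: "fund_domain l = unit_cube \<times> cell \<times> {0..<l $ first / 2}"
  by (simp add: fund_domain_def unit_cube_def cell_def)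

lemma fund_domain_borel [measurable]: "fund_domain l \<in> sets borel"
  unfolding fund_domain_eq borel_prod[symmetric] by measurable

lemma space_measure_M: "space \<mu> = fund_domain l"
  by (simp add: measure_M_def)

lemma borel_imp_M: "F \<in> borel_measurable borel \<Longrightarrow> F \<in> borel_measurable \<mu>"
  unfolding measure_M_def by (intro measurable_restrict_space1) simp

text \<open>Once the phase is gone, integrands do not depend on \<xi>, and the \<xi>-integral
  contributes only the length l_1/2. The x-integral is put inside so that Parseval applies at fixed
  u.\<close>

lemma nn_integral_measure_M:
  fixes h :: "((real, 'n) vec) \<times> ((real, 'n) vec) \<Rightarrow> ennreal"
  assumes [measurable]: "h \<in> borel_measurable borel"
  shows "(\<integral>\<^sup>+p. h (fst p, fst (snd p)) \<partial>\<mu>)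
    = ennreal (l $ first / 2) * (\<integral>\<^sup>+u. (\<integral>\<^sup>+x. h (x, u) \<partial>torus) * indicator cell u \<partial>lborel)"
proof -
  have h [measurable]: "h \<in> borel_measurable (borel \<Otimes>\<^sub>M borel)"
    unfolding borel_prod by fact
  have "(\<integral>\<^sup>+p. h (fst p, fst (snd p)) \<partial>\<mu>)
      = (\<integral>\<^sup>+p. h (fst p, fst (snd p)) * indicator (fund_domain l) p \<partial>(lborel \<Otimes>\<^sub>M (lborel \<Otimes>\<^sub>M lborel)))"
    unfolding measure_M_def by (subst nn_integral_restrict_space) (simp_all add: lborel_prod)
  also have "\<dots> = (\<integral>\<^sup>+x. \<integral>\<^sup>+p. h (x, fst p) * indicator (fund_domain l) (x, p) \<partial>(lborel \<Otimes>\<^sub>M lborel) \<partial>lborel)"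
    by (subst lborel_pair.nn_integral_fst[symmetric]) (simp_all add: fund_domain_eq)
  also have "\<dots> = (\<integral>\<^sup>+x. \<integral>\<^sup>+u. \<integral>\<^sup>+\<xi>. h (x, u) * indicator (fund_domain l) (x, u, \<xi>) \<partial>lborel \<partial>lborel \<partial>lborel)"
    by (intro nn_integral_cong, subst lborel.nn_integral_fst[symmetric]) (simp_all add: fund_domain_eq)
  also have "\<dots> = (\<integral>\<^sup>+x. \<integral>\<^sup>+u. ennreal (l $ first / 2) * (h (x, u) * indicator unit_cube x * indicator cell u) \<partial>lborel \<partial>lborel)"
  proof (intro nn_integral_cong)
    fix x u :: "(real, 'n) vec"
    have "(\<integral>\<^sup>+\<xi>. h (x, u) * indicator (fund_domain l) (x, u, \<xi>) \<partial>lborel)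
        = (\<integral>\<^sup>+\<xi>. (h (x, u) * indicator unit_cube x * indicator cell u) * indicator {0..<l $ first / 2} \<xi> \<partial>lborel)"
      by (intro nn_integral_cong) (auto simp: fund_domain_eq indicator_def)
    also have "\<dots> = (h (x, u) * indicator unit_cube x * indicator cell u) * ennreal (l $ first / 2)"
      using pos[of first] by (subst nn_integral_cmult_indicator) auto
    finally show "(\<integral>\<^sup>+\<xi>. h (x, u) * indicator (fund_domain l) (x, u, \<xi>) \<partial>lborel)
        = ennreal (l $ first / 2) * (h (x, u) * indicator unit_cube x * indicator cell u)"
      by (simp add: mult.commute)
  qed
  also have "\<dots> = (\<integral>\<^sup>+u. \<integral>\<^sup>+x. ennreal (l $ first / 2) * (h (x, u) * indicator unit_cube x * indicator cell u) \<partial>lborel \<partial>lborel)"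
    by (rule lborel_pair.Fubini') measurable
  also have "\<dots> = (\<integral>\<^sup>+u. ennreal (l $ first / 2) * ((\<integral>\<^sup>+x. h (x, u) * indicator unit_cube x \<partial>lborel) * indicator cell u) \<partial>lborel)"
    by (simp add: nn_integral_cmult nn_integral_multc)
  also have "\<dots> = ennreal (l $ first / 2) * (\<integral>\<^sup>+u. (\<integral>\<^sup>+x. h (x, u) * indicator unit_cube x \<partial>lborel) * indicator cell u \<partial>lborel)"
    by (subst nn_integral_cmult) auto
  also have "(\<lambda>u. \<integral>\<^sup>+x. h (x, u) * indicator unit_cube x \<partial>lborel) = (\<lambda>u. \<integral>\<^sup>+x. h (x, u) \<partial>torus)"
    unfolding torus_def by (subst nn_integral_restrict_space) simp_all
  finally show ?thesis .
qed

lemma finite_measure_M: "finite_measure \<mu>"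
proof (rule finite_measureI)
  have "bounded cell"
  proof -
    have "cell \<subseteq> cbox 0 l" by (auto simp: cell_def mem_box_cart less_imp_le)
    then show ?thesis by (rule bounded_subset[OF bounded_cbox])
  qed
  then have fin: "emeasure lborel cell < \<infinity>" by (rule emeasure_bounded_finite)
  have "emeasure \<mu> (space \<mu>) = (\<integral>\<^sup>+p. 1 \<partial>\<mu>)" by simp
  also have "\<dots> = ennreal (l $ first / 2) * (\<integral>\<^sup>+u. (\<integral>\<^sup>+x. 1 \<partial>(torus::((real, 'n) vec) measure)) * indicator cell u \<partial>lborel)"
    using nn_integral_measure_M[of "\<lambda>_. 1"] by (simp del: nn_integral_const)
  also have "\<dots> = ennreal (l $ first / 2) * emeasure lborel cell"
    by (simp add: emeasure_torus)
  finally show "emeasure \<mu> (space \<mu>) \<noteq> \<infinity>"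
    using fin by (simp add: ennreal_mult_eq_top_iff top.not_eq_extremum)
qed

text \<open>By Tonelli and translation invariance, g is integrated against the number of m for which
  v - m l lies in the cell; there is exactly one, given by the floors of v_j / l_j.\<close>

lemma nn_integral_tile:
  assumes [measurable]: "g \<in> borel_measurable borel"
  shows "(\<integral>\<^sup>+u. (\<integral>\<^sup>+m. g (u + int_scale m l) \<partial>count_space UNIV) * indicator cell u \<partial>lborel)
    = (\<integral>\<^sup>+v. g v \<partial>lborel)"
proof -
  have "(\<integral>\<^sup>+u. (\<integral>\<^sup>+m. g (u + int_scale m l) \<partial>count_space UNIV) * indicator cell u \<partial>lborel)
      = (\<integral>\<^sup>+u. \<integral>\<^sup>+m. g (u + int_scale m l) * indicator cell u \<partial>count_space UNIV \<partial>lborel)"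
    by (simp add: nn_integral_multc)
  also have "\<dots> = (\<integral>\<^sup>+m. \<integral>\<^sup>+u. g (u + int_scale m l) * indicator cell u \<partial>lborel \<partial>count_space UNIV)"
    by (rule nn_integral_count_space_nn_integral) auto
  also have "\<dots> = (\<integral>\<^sup>+m. \<integral>\<^sup>+v. g v * indicator cell (v - int_scale m l) \<partial>lborel \<partial>count_space UNIV)"
  proof (rule nn_integral_cong)
    fix m
    have "(\<integral>\<^sup>+v. g v * indicator cell (v - int_scale m l) \<partial>lborel)
        = (\<integral>\<^sup>+v. g v * indicator cell (v - int_scale m l) \<partial>distr lborel borel ((+) (int_scale m l)))"
      by (simp add: lborel_distr_plus)
    also have "\<dots> = (\<integral>\<^sup>+u. g (u + int_scale m l) * indicator cell u \<partial>lborel)"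
      by (subst nn_integral_distr) (auto simp: add.commute)
    finally show "(\<integral>\<^sup>+u. g (u + int_scale m l) * indicator cell u \<partial>lborel)
        = (\<integral>\<^sup>+v. g v * indicator cell (v - int_scale m l) \<partial>lborel)" by simp
  qed
  also have "\<dots> = (\<integral>\<^sup>+v. \<integral>\<^sup>+m. g v * indicator cell (v - int_scale m l) \<partial>count_space UNIV \<partial>lborel)"
    by (rule nn_integral_count_space_nn_integral[symmetric]) auto
  also have "\<dots> = (\<integral>\<^sup>+v. g v \<partial>lborel)"
  proof (intro nn_integral_cong)
    fix v :: "(real, 'n) vec"
    define m0 :: "(int, 'n) vec" where "m0 = (\<chi> j. \<lfloor>v $ j / l $ j\<rfloor>)"
    have "v - int_scale m l \<in> cell \<longleftrightarrow> m = m0" for m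
    proof -
      have "0 \<le> v $ j - of_int (m $ j) * l $ j \<and> v $ j - of_int (m $ j) * l $ j < l $ j
          \<longleftrightarrow> \<lfloor>v $ j / l $ j\<rfloor> = m $ j" for j
        unfolding floor_eq_iff using pos[of j] by (auto simp: field_simps)
      then show ?thesis by (auto simp: cell_def int_scale_def m0_def vec_eq_iff)
    qed
    then have ind: "indicator cell (v - int_scale m l) = (indicator {m0} m :: ennreal)" for m
      by (auto simp: indicator_def)
    have "(\<integral>\<^sup>+m. g v * indicator cell (v - int_scale m l) \<partial>count_space UNIV)
        = g v * emeasure (count_space UNIV) {m0}"
      unfolding ind by (subst nn_integral_cmult_indicator) auto
    then show "(\<integral>\<^sup>+m. g v * indicator cell (v - int_scale m l) \<partial>count_space UNIV) = g v"
      by simp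
  qed
  finally show ?thesis .
qed

text \<open>At fixed u the whole sum is, up to the phase, a single Fourier series in x indexed by
  pairs (J, m), with coefficient \<open>\<phi> J (u + int_scale m l)\<close> at frequency
  \<open>r J + dil m\<close>. Since no frequency repeats, Parseval leaves no cross terms, neither
  between different J nor between different m.\<close>

theorem sqnorm_sum_W:
  fixes r :: "'i \<Rightarrow> (int, 'n) vec"
  assumes I: "finite I" and inj: "inj_on (\<lambda>(J, m). r J + dil m) (I \<times> UNIV)"
    and \<phi>: "\<And>J. J \<in> I \<Longrightarrow> schwartz (\<phi> J)"
  shows "sqnorm \<mu> (\<lambda>p. \<Sum>J\<in>I. W (r J) (\<phi> J) p) = ennreal (l $ first / 2) * (\<Sum>J\<in>I. sqnorm lborel (\<phi> J))"
proof -
  define S where "S x u = (\<Sum>J\<in>I. chr (r J) x * Z (\<phi> J) x u)" for x u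
  have [measurable]: "\<phi> J \<in> borel_measurable borel" if "J \<in> I" for J
    by (rule schwartz_borel[OF \<phi>[OF that]])
  have S_meas: "(\<lambda>p. S (fst p) (snd p)) \<in> borel_measurable borel"
  proof -
    have "(\<lambda>p::((real, 'n) vec) \<times> ((real, 'n) vec). chr j (fst p)) \<in> borel_measurable borel" for j
      by (intro borel_measurable_continuous_onI continuous_on_compose2[OF continuous_on_chr[of UNIV]] continuous_intros) auto
    then show ?thesis unfolding S_def
      by (intro borel_measurable_sum borel_measurable_times borel_measurable_Z \<phi>)
  qed
  have "(\<Sum>J\<in>I. W (r J) (\<phi> J) p) = phase p * S (fst p) (fst (snd p))" for p
    by (cases p) (simp add: W_eq S_def sum_distrib_left)
  then have "sqnorm \<mu> (\<lambda>p. \<Sum>J\<in>I. W (r J) (\<phi> J) p)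
      = (\<integral>\<^sup>+p. (\<lambda>q. ennreal ((cmod (S (fst q) (snd q)))\<^sup>2)) (fst p, fst (snd p)) \<partial>\<mu>)"
    unfolding sqnorm_def by (simp add: norm_mult)
  also have "\<dots> = ennreal (l $ first / 2) * (\<integral>\<^sup>+u. (\<integral>\<^sup>+x. ennreal ((cmod (S x u))\<^sup>2) \<partial>torus) * indicator cell u \<partial>lborel)"
    by (subst nn_integral_measure_M) (use S_meas in \<open>auto\<close>)
  also have "(\<lambda>u. \<integral>\<^sup>+x. ennreal ((cmod (S x u))\<^sup>2) \<partial>torus)
      = (\<lambda>u. \<Sum>J\<in>I. \<integral>\<^sup>+m. ennreal ((cmod (\<phi> J (u + int_scale m l)))\<^sup>2) \<partial>count_space UNIV)"
  proof
    fix u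
    let ?c = "\<lambda>(J, m). \<phi> J (u + int_scale m l)"
    let ?q = "\<lambda>(J, m). r J + dil m"
    have summ: "(\<lambda>i. cmod (?c i)) summable_on I \<times> UNIV"
    proof -
      have "(\<lambda>i. cmod (?c i)) summable_on {J} \<times> UNIV" if "J \<in> I" for J
      proof -
        have "bij_betw (\<lambda>m. (J, m)) UNIV ({J} \<times> (UNIV :: (int, 'n) vec set))"
          by (auto simp: bij_betw_def inj_on_def)
        from summable_on_reindex_bij_betw[OF this, of "\<lambda>i. cmod (?c i)"]
        show ?thesis using Z_summable[OF \<phi>[OF that], of u] by simp
      qed
      moreover have "I \<times> UNIV = (\<Union>J\<in>I. {J} \<times> (UNIV :: (int, 'n) vec set))" by auto
      ultimately show ?thesis
        by (simp only:) (rule summable_on_finite_union_disjoint[OF I], auto)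
    qed
    have "S x u = infsum (\<lambda>i. ?c i * chr (?q i) x) (I \<times> UNIV)" for x
    proof -
      have "(\<lambda>i. ?c i * chr (?q i) x) summable_on I \<times> UNIV"
        by (rule abs_summable_summable) (use summ in \<open>simp add: norm_mult\<close>)
      then have "infsum (\<lambda>i. ?c i * chr (?q i) x) (I \<times> UNIV)
          = infsum (\<lambda>J. infsum (\<lambda>m. ?c (J, m) * chr (?q (J, m)) x) UNIV) I"
        by (subst infsum_Sigma'_banach[of "\<lambda>J m. ?c (J, m) * chr (?q (J, m)) x"]) (simp_all add: case_prod_unfold)
      also have "\<dots> = (\<Sum>J\<in>I. infsum (\<lambda>m. chr (r J) x * (chr (dil m) x * \<phi> J (u + int_scale m l))) UNIV)"
        using I by (simp add: chr_add mult_ac)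
      also have "\<dots> = S x u"
        unfolding S_def Z_def infsum_cmult_right' ..
      finally show ?thesis by simp
    qed
    then have "(\<integral>\<^sup>+x. ennreal ((cmod (S x u))\<^sup>2) \<partial>torus)
        = (\<integral>\<^sup>+i. ennreal ((cmod (?c i))\<^sup>2) \<partial>count_space (I \<times> UNIV))"
      using Parseval_inj[OF inj summ] by (simp add: sqnorm_def)
    also have "\<dots> = (\<Sum>J\<in>I. \<integral>\<^sup>+m. ennreal ((cmod (\<phi> J (u + int_scale m l)))\<^sup>2) \<partial>count_space UNIV)"
    proof -
      have "(\<integral>\<^sup>+i. ennreal ((cmod (?c i))\<^sup>2) \<partial>count_space (I \<times> UNIV))
          = (\<integral>\<^sup>+i. ennreal ((cmod (?c i))\<^sup>2) \<partial>(count_space I \<Otimes>\<^sub>M count_space UNIV))"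
        using I by (subst pair_measure_countable) (auto intro: countable_finite)
      also have "\<dots> = (\<integral>\<^sup>+J. \<integral>\<^sup>+m. ennreal ((cmod (?c (J, m)))\<^sup>2) \<partial>count_space UNIV \<partial>count_space I)"
        using I by (subst sigma_finite_measure.nn_integral_fst[symmetric])
          (auto intro: sigma_finite_measure_count_space_countable simp: pair_measure_countable countable_finite)
      also have "\<dots> = (\<Sum>J\<in>I. \<integral>\<^sup>+m. ennreal ((cmod (\<phi> J (u + int_scale m l)))\<^sup>2) \<partial>count_space UNIV)"
        using I by (simp add: nn_integral_count_space_finite)
      finally show ?thesis .
    qed
    finally show "(\<integral>\<^sup>+x. ennreal ((cmod (S x u))\<^sup>2) \<partial>torus)
        = (\<Sum>J\<in>I. \<integral>\<^sup>+m. ennreal ((cmod (\<phi> J (u + int_scale m l)))\<^sup>2) \<partial>count_space UNIV)" .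
  qed
  also have "(\<integral>\<^sup>+u. (\<Sum>J\<in>I. \<integral>\<^sup>+m. ennreal ((cmod (\<phi> J (u + int_scale m l)))\<^sup>2) \<partial>count_space UNIV) * indicator cell u \<partial>lborel)
      = (\<Sum>J\<in>I. \<integral>\<^sup>+u. (\<integral>\<^sup>+m. ennreal ((cmod (\<phi> J (u + int_scale m l)))\<^sup>2) \<partial>count_space UNIV) * indicator cell u \<partial>lborel)"
    unfolding sum_distrib_right
  proof (rule nn_integral_sum)
    fix J assume J: "J \<in> I"
    have "(\<lambda>u. \<integral>\<^sup>+m. ennreal ((cmod (\<phi> J (u + int_scale m l)))\<^sup>2) \<partial>count_space UNIV) \<in> borel_measurable borel"
    proof (rule borel_measurable_LIMSEQ_order)
      show "(\<lambda>n. \<Sum>m\<in>enum_vec ` {..<n}. ennreal ((cmod (\<phi> J (u + int_scale m l)))\<^sup>2))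
          \<longlonglongrightarrow> (\<integral>\<^sup>+m. ennreal ((cmod (\<phi> J (u + int_scale m l)))\<^sup>2) \<partial>count_space UNIV)" for u
        by (rule nn_integral_count_enum_vec[of "\<lambda>m. ennreal ((cmod (\<phi> J (u + int_scale m l)))\<^sup>2)"])
      show "(\<lambda>u. \<Sum>m\<in>enum_vec ` {..<n}. ennreal ((cmod (\<phi> J (u + int_scale m l)))\<^sup>2)) \<in> borel_measurable borel" for n :: nat
        using J by measurable
    qed
    then show "(\<lambda>u. (\<integral>\<^sup>+m. ennreal ((cmod (\<phi> J (u + int_scale m l)))\<^sup>2) \<partial>count_space UNIV) * indicator cell u)
        \<in> borel_measurable lborel" by simp
  qed
  also have "\<dots> = (\<Sum>J\<in>I. sqnorm lborel (\<phi> J))"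
    by (intro sum.cong refl, subst nn_integral_tile) (auto simp: sqnorm_def)
  finally show ?thesis .
qed

lemma sqnorm_W:
  assumes "schwartz f"
  shows "sqnorm \<mu> (W j f) = ennreal (l $ first / 2) * sqnorm lborel f"
  using sqnorm_sum_W[of "{()}" "\<lambda>_. j" "\<lambda>_. f"] assms
  by (auto simp: inj_on_def inj_dil)

lemma W_L2_M:
  assumes f: "schwartz f"
  shows "W j f \<in> L2_M l"
proof -
  have [measurable]: "W j f \<in> borel_measurable borel" by (rule borel_measurable_W[OF f])
  interpret finite_measure \<mu> by (rule finite_measure_M)
  \<comment> \<open>This bounds every coordinate of a point of the cell, so one majorant serves the
    whole fundamental domain, where W is therefore bounded.\<close>
  define R where "R = (\<Sum>j\<in>UNIV. l $ j)"
  obtain A where A: "A summable_on UNIV" "\<And>m. 0 \<le> A m"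
    "\<And>u m. (\<And>i. \<bar>u $ i\<bar> \<le> R) \<Longrightarrow> cmod (f (u + int_scale m l)) \<le> A m"
    using schwartz_lattice_decay[OF pos f, of R] by metis
  have bound: "cmod (W j f p) \<le> infsum A UNIV" if "p \<in> fund_domain l" for p
  proof -
    obtain x u \<xi> where p: "p = (x, u, \<xi>)" by (cases p)
    have u: "\<bar>u $ i\<bar> \<le> R" for i
    proof -
      have "0 \<le> u $ i" "u $ i < l $ i" using that p by (auto simp: fund_domain_eq cell_def)
      moreover have "l $ i \<le> R" unfolding R_def by (rule member_le_sum) (auto intro: less_imp_le pos)
      ultimately show ?thesis by simp
    qed
    have "cmod (W j f p) = cmod (Z f x u)" by (simp add: p W_eq norm_mult)
    also have "\<dots> \<le> infsum A UNIV"
      unfolding Z_def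
      by (rule norm_infsum_le[OF has_sum_infsum[OF Z_summable'[OF f]] has_sum_infsum[OF A(1)]])
        (simp add: norm_mult A(3)[OF u])
    finally show ?thesis .
  qed
  have "sqnorm \<mu> (W j f) \<le> (\<integral>\<^sup>+p. ennreal ((infsum A UNIV)\<^sup>2) \<partial>\<mu>)"
    unfolding sqnorm_def by (intro nn_integral_mono ennreal_leI power_mono bound) (auto simp: space_measure_M)
  also have "\<dots> < \<infinity>"
    by (simp add: ennreal_mult_eq_top_iff less_top[symmetric])
  finally show ?thesis
    by (auto simp: L2_M_def L2_iff borel_imp_M lattice_invariant_W)
qed

text \<open>The norm identity is read backwards: W is bounded on a domain of finite measure, so its
  norm there is finite, and so is the norm over R^n.\<close>

lemma schwartz_sqnorm_finite:
  fixes f :: "(real, 'n) vec \<Rightarrow> complex"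
  assumes "schwartz f"
  shows "sqnorm lborel f < \<infinity>"
proof -
  have "sqnorm \<mu> (W 0 f) < \<infinity>"
    using W_L2_M[OF assms] by (simp add: L2_M_def L2_iff)
  then have fin: "ennreal (l $ first / 2) * sqnorm lborel f < \<infinity>"
    unfolding sqnorm_W[OF assms] .
  show ?thesis
  proof (rule ccontr)
    assume "\<not> sqnorm lborel f < \<infinity>"
    then have "sqnorm lborel f = \<infinity>" by (simp add: less_top[symmetric])
    then show False using fin pos[of first] by (simp add: ennreal_mult_top)
  qed
qed

end

section \<open>Density of trigonometric polynomials\<close>

text \<open>The three rules are those under which membership in the span of the waves, after
  multiplication by a fixed bump, is inherited; no normal form as a finite sum is needed.\<close>

inductive trig :: "(real^'n::finite \<Rightarrow> complex) \<Rightarrow> bool" where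
  chr: "trig (chr q)"
| cmult: "trig f \<Longrightarrow> trig (\<lambda>x. c * f x)"
| add: "trig f \<Longrightarrow> trig g \<Longrightarrow> trig (\<lambda>x. f x + g x)"

lemma trig_const: "trig (\<lambda>x. c)"
  using trig.cmult[OF trig.chr[of 0], of c] by simp

lemma trig_sum: "finite A \<Longrightarrow> (\<And>a. a \<in> A \<Longrightarrow> trig (f a)) \<Longrightarrow> trig (\<lambda>x. \<Sum>a\<in>A. f a x)"
  by (induction A rule: finite_induct) (auto intro: trig_const trig.add)

lemma trig_mult:
  assumes "trig f" "trig g"
  shows "trig (\<lambda>x. f x * g x)"
  using assms(1)
proof induction
  case (chr q)
  from assms(2) show ?case
  proof induction
    case (chr q')
    then show ?case using trig.chr[of "q + q'"] by (simp add: chr_add[abs_def])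
  next
    case (cmult f c)
    from trig.cmult[OF cmult.IH, of c] show ?case by (simp add: mult_ac)
  next
    case (add f g)
    from trig.add[OF add.IH] show ?case by (simp add: distrib_left)
  qed
next
  case (cmult f c)
  from trig.cmult[OF cmult.IH, of c] show ?case by (simp add: mult_ac)
next
  case (add f g)
  from trig.add[OF add.IH] show ?case by (simp add: distrib_right)
qed

lemma trig_borel: "trig f \<Longrightarrow> f \<in> borel_measurable borel"
  by (induction rule: trig.induct) auto

text \<open>Stone-Weierstrass needs a compact set in a Euclidean space. This map sends R^n onto a
  product of circles in C^n, and real polynomials in the coordinates of C^n pull back to
  trigonometric polynomials.\<close>

definition torus_map :: "real^'n::finite \<Rightarrow> complex^'n" where
  "torus_map x = (\<chi> i. cis (2 * pi * x $ i))"

lemma trig_real_polynomial: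
  fixes g :: "complex^'n::finite \<Rightarrow> real"
  assumes "real_polynomial_function g"
  shows "trig (\<lambda>x. of_real (g (torus_map x)))"
  using assms
proof induction
  case (linear f)
  interpret bounded_linear f by fact
  have chr_axis: "chr (axis i s) x = cis (2 * pi * (of_int s * x $ i))" for i s and x :: "real^'n"
  proof -
    have "(\<Sum>j\<in>UNIV. of_int (axis i s $ j) * x $ j) = (\<Sum>j\<in>UNIV. if j = i then of_int s * x $ j else 0)"
      by (intro sum.cong) (auto simp: axis_def)
    then show ?thesis by (simp add: chr_def)
  qed
  have coord: "trig (\<lambda>x. complex_of_real (torus_map x \<bullet> b))" if b: "b \<in> Basis" for b :: "complex^'n"
  proof -
    obtain i where "b = axis i 1 \<or> b = axis i \<i>"
      using b by (auto simp: Basis_vec_def Basis_complex_def)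
    then show ?thesis
    proof
      assume "b = axis i 1"
      then have "complex_of_real (torus_map x \<bullet> b)
          = (1 / 2) * chr (axis i 1) x + (1 / 2) * chr (axis i (-1)) x" for x
        by (simp add: torus_map_def inner_axis chr_axis complex_eq_iff inner_complex_def)
      then show ?thesis by (simp only:) (intro trig.intros)
    next
      assume "b = axis i \<i>"
      then have "complex_of_real (torus_map x \<bullet> b)
          = (- \<i> / 2) * chr (axis i 1) x + (\<i> / 2) * chr (axis i (-1)) x" for x
        by (simp add: torus_map_def inner_axis chr_axis complex_eq_iff inner_complex_def)
      then show ?thesis by (simp only:) (intro trig.intros)
    qed
  qed
  have fz: "f z = (\<Sum>b\<in>Basis. (z \<bullet> b) * f b)" for z
  proof -
    have "f z = f (\<Sum>b\<in>Basis. (z \<bullet> b) *\<^sub>R b)" by (simp only: euclidean_representation)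
    then show ?thesis by (simp only: sum scaleR real_scaleR_def)
  qed
  have eq: "(\<lambda>x. complex_of_real (f (torus_map x)))
      = (\<lambda>x. \<Sum>b\<in>Basis. of_real (f b) * complex_of_real (torus_map x \<bullet> b))"
    by (rule ext, subst fz) (simp add: mult.commute)
  have "trig (\<lambda>x. of_real (f b) * complex_of_real (torus_map x \<bullet> b))" if "b \<in> Basis" for b
    by (rule trig.cmult[OF coord[OF that]])
  then have "trig (\<lambda>x. \<Sum>b\<in>Basis. of_real (f b) * complex_of_real (torus_map x \<bullet> b))"
    using trig_sum[of Basis "\<lambda>b x. of_real (f b) * complex_of_real (torus_map x \<bullet> b)"] by simp
  then show ?case unfolding eq .
next
  case (const c)
  then show ?case by (simp add: trig_const)
next
  case (add f g)
  then show ?case by (simp add: trig.add)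
next
  case (mult f g)
  then show ?case by (simp add: trig_mult)
qed

text \<open>The argument jumps across the nonnegative reals, which are removed. On the torus this
  discards only points with an integral coordinate.\<close>

lemma open_Arg2pi_interval: "open {z. z \<notin> \<real>\<^sub>\<ge>\<^sub>0 \<and> \<alpha> < Arg2pi z \<and> Arg2pi z < \<beta>}"
proof -
  have "continuous_on (- \<real>\<^sub>\<ge>\<^sub>0) Arg2pi"
    by (intro continuous_at_imp_continuous_on ballI continuous_at_Arg2pi) auto
  then have "open (Arg2pi -` {\<alpha><..<\<beta>} \<inter> - \<real>\<^sub>\<ge>\<^sub>0)"
    using continuous_on_open_vimage[OF open_Compl[OF closed_nonneg_Reals_complex], of Arg2pi] by simp
  moreover have "Arg2pi -` {\<alpha><..<\<beta>} \<inter> - \<real>\<^sub>\<ge>\<^sub>0 = {z. z \<notin> \<real>\<^sub>\<ge>\<^sub>0 \<and> \<alpha> < Arg2pi z \<and> Arg2pi z < \<beta>}"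
    by auto
  ultimately show ?thesis by simp
qed

lemma Arg2pi_cis:
  assumes "0 < t" "t < 1"
  shows "Arg2pi (cis (2 * pi * t)) = 2 * pi * t" "cis (2 * pi * t) \<notin> \<real>\<^sub>\<ge>\<^sub>0"
proof -
  show *: "Arg2pi (cis (2 * pi * t)) = 2 * pi * t"
    by (rule Arg2pi_unique[of 1]) (use assms in \<open>auto simp: cis_conv_exp\<close>)
  show "cis (2 * pi * t) \<notin> \<real>\<^sub>\<ge>\<^sub>0"
  proof
    assume "cis (2 * pi * t) \<in> \<real>\<^sub>\<ge>\<^sub>0"
    then have "Arg2pi (cis (2 * pi * t)) = 0"
      unfolding Arg2pi_eq_0 by (simp add: complex_nonneg_Reals_iff complex_is_Real_iff)
    then show False using * assms by simp
  qed
qed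

text \<open>Continuous substitutes for the indicator of an open set, bounded by 1 uniformly in
  n.\<close>

lemma tendsto_clamped_infdist:
  assumes "closed C" "C \<noteq> {}"
  shows "(\<lambda>n. min 1 (real n * infdist z C)) \<longlonglongrightarrow> indicator (- C) z"
proof (cases "z \<in> C")
  case True
  then show ?thesis by simp
next
  case False
  then have pos: "0 < infdist z C"
    using assms by (simp add: infdist_pos_not_in_closed)
  obtain N where N: "1 / infdist z C < real N" using reals_Archimedean2 by blast
  have "min 1 (real n * infdist z C) = 1" if "n \<ge> N" for n
  proof -
    have "1 / infdist z C < real n" using N that by linarith
    then show ?thesis using pos by (simp add: pos_divide_less_eq min_def)
  qed
  then have "\<forall>\<^sub>F n in sequentially. min 1 (real n * infdist z C) = 1"
    by (auto simp: eventually_sequentially)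
  then show ?thesis using False by (simp add: tendsto_eventually)
qed

text \<open>The box becomes an open set \<open>U\<close> of angles on the torus; clamped distances
  to its complement tend to its indicator, and polynomials approximate them on \<open>S\<close> with
  error 1/(n+1). The bound 2 is 1 plus the largest error and serves dominated convergence; the
  excluded faces of the cube are null sets.\<close>

lemma trig_approx_indicator:
  fixes a b :: "real^'n::finite"
  obtains T where "\<forall>n::nat. trig (T n)" "\<forall>n x. cmod (T n x) \<le> 2"
    "\<forall>x. (\<forall>i. 0 < x $ i \<and> x $ i < 1) \<longrightarrow> (\<lambda>n. T n x) \<longlonglongrightarrow> indicator (box a b) x"
proof -
  define S where "S = {z :: complex^'n. \<forall>i. z $ i \<in> sphere 0 1}"
  have "compact S"
  proof -
    have "bounded S"
    proof (rule boundedI)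
      show "norm z \<le> real CARD('n)" if "z \<in> S" for z
        unfolding norm_vec_def using L2_set_le_sum[of UNIV "\<lambda>i. norm (z $ i)"] that by (simp add: S_def)
    qed
    moreover have "closed S"
    proof -
      have "S = (\<Inter>i. (\<lambda>z. z $ i) -` sphere 0 1)" by (auto simp: S_def)
      then show ?thesis by (auto intro!: closed_INT closed_vimage continuous_intros)
    qed
    ultimately show ?thesis by (simp add: compact_eq_bounded_closed)
  qed
  define U where "U = {z :: complex^'n. \<forall>i. z $ i \<notin> \<real>\<^sub>\<ge>\<^sub>0 \<and> 2 * pi * a $ i < Arg2pi (z $ i) \<and> Arg2pi (z $ i) < 2 * pi * b $ i}"
  have "open U"
  proof -
    have "U = (\<Inter>i. (\<lambda>z. z $ i) -` {z. z \<notin> \<real>\<^sub>\<ge>\<^sub>0 \<and> 2 * pi * a $ i < Arg2pi z \<and> Arg2pi z < 2 * pi * b $ i})"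
      by (auto simp: U_def)
    also have "open \<dots>"
      by (intro open_INT finite ballI open_vimage open_Arg2pi_interval) (intro continuous_intros)
    finally show ?thesis .
  qed
  \<comment> \<open>The complement of \<open>U\<close> must be nonempty, as \<open>infdist z {} = 0\<close>.\<close>
  have "0 \<notin> U" by (simp add: U_def)
  define \<psi> where "\<psi> n z = min 1 (real n * infdist z (- U))" for n :: nat and z
  have \<psi>_cont: "continuous_on S (\<psi> n)" for n
    unfolding \<psi>_def by (intro continuous_intros)
  have "\<exists>g. real_polynomial_function g \<and> (\<forall>z\<in>S. \<bar>\<psi> n z - g z\<bar> < 1 / real (Suc n))" for n
    by (rule Stone_Weierstrass_real_polynomial_function[OF \<open>compact S\<close> \<psi>_cont[of n], of "1 / real (Suc n)"])
      auto
  then obtain g where g: "\<And>n. real_polynomial_function (g n)"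
      "\<And>n z. z \<in> S \<Longrightarrow> \<bar>\<psi> n z - g n z\<bar> < 1 / real (Suc n)" by metis
  have in_S: "torus_map x \<in> S" for x by (simp add: S_def torus_map_def)
  define T where "T n x = complex_of_real (g n (torus_map x))" for n x
  show ?thesis
  proof (rule that[of T]; intro allI impI)
    show "trig (T n)" for n
      unfolding T_def[abs_def] by (rule trig_real_polynomial[OF g(1)])
    show "cmod (T n x) \<le> 2" for n x
    proof -
      have "0 \<le> \<psi> n z" "\<psi> n z \<le> 1" for z by (auto simp: \<psi>_def infdist_nonneg)
      moreover have "1 / real (Suc n) \<le> 1" by simp
      ultimately have "\<bar>g n (torus_map x)\<bar> \<le> 2"
        using g(2)[OF in_S[of x], of n] by (simp only: abs_less_iff abs_le_iff) (smt (verit))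
      then show ?thesis by (simp add: T_def)
    qed
    fix x :: "real^'n" assume x: "\<forall>i. 0 < x $ i \<and> x $ i < 1"
    have "torus_map x \<in> U \<longleftrightarrow> x \<in> box a b"
    proof -
      have "Arg2pi (torus_map x $ i) = 2 * pi * x $ i" "torus_map x $ i \<notin> \<real>\<^sub>\<ge>\<^sub>0" for i
        unfolding torus_map_def using Arg2pi_cis[of "x $ i"] x by auto
      then show ?thesis by (simp add: U_def mem_box_cart)
    qed
    then have ind: "indicator (- (- U)) (torus_map x) = (indicator (box a b) x :: real)"
      by (simp add: indicator_def)
    have "(\<lambda>n. \<psi> n (torus_map x)) \<longlonglongrightarrow> indicator (- (- U)) (torus_map x)"
      unfolding \<psi>_def using \<open>open U\<close> \<open>0 \<notin> U\<close> by (intro tendsto_clamped_infdist) auto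
    then have lim: "(\<lambda>n. \<psi> n (torus_map x)) \<longlonglongrightarrow> indicator (box a b) x" unfolding ind .
    have "(\<lambda>n. g n (torus_map x) - \<psi> n (torus_map x)) \<longlonglongrightarrow> 0"
    proof (rule Lim_null_comparison)
      show "\<forall>\<^sub>F n in sequentially. norm (g n (torus_map x) - \<psi> n (torus_map x)) \<le> 1 / real (Suc n)"
        using g(2)[OF in_S[of x]] by (simp add: abs_minus_commute less_imp_le)
      show "(\<lambda>n. 1 / real (Suc n)) \<longlonglongrightarrow> 0" by (rule LIMSEQ_Suc[OF lim_1_over_n])
    qed
    from tendsto_add[OF this lim] have "(\<lambda>n. g n (torus_map x)) \<longlonglongrightarrow> indicator (box a b) x" by simp
    then have "(\<lambda>n. complex_of_real (g n (torus_map x))) \<longlonglongrightarrow> complex_of_real (indicator (box a b) x)"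
      by (rule tendsto_of_real)
    then show "(\<lambda>n. T n x) \<longlonglongrightarrow> indicator (box a b) x"
      by (simp add: T_def of_real_indicator)
  qed
qed

section \<open>Closures in \<open>L\<^sup>2\<close>\<close>

definition L2_adherent :: "'a measure \<Rightarrow> ('a \<Rightarrow> complex) set \<Rightarrow> ('a \<Rightarrow> complex) \<Rightarrow> bool" where
  "L2_adherent \<mu> A F \<longleftrightarrow> (\<exists>\<psi>. (\<forall>n. \<psi> n \<in> A) \<and> L2_tendsto \<mu> \<psi> F)"

text \<open>Diagonal argument: an element of \<open>A\<close> within 1/(n+1) of the n-th term, in
  squared norm, has the same limit.\<close>

lemma L2_adherent_limit:
  assumes A: "A \<subseteq> borel_measurable \<mu>" and [measurable]: "\<And>n. \<Phi> n \<in> borel_measurable \<mu>" "F \<in> borel_measurable \<mu>"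
    and adh: "\<And>n. L2_adherent \<mu> A (\<Phi> n)" and lim: "L2_tendsto \<mu> \<Phi> F"
  shows "L2_adherent \<mu> A F"
proof -
  have "\<exists>g\<in>A. sqnorm \<mu> (\<lambda>x. g x - \<Phi> n x) < ennreal (1 / real (Suc n))" for n
  proof -
    obtain \<psi> where \<psi>: "\<And>i. \<psi> i \<in> A" "L2_tendsto \<mu> \<psi> (\<Phi> n)"
      using adh[of n] by (auto simp: L2_adherent_def)
    obtain i where "sqnorm \<mu> (\<lambda>x. \<psi> i x - \<Phi> n x) < ennreal (1 / real (Suc n))"
      using L2_tendsto_eventually[OF \<psi>(2), of "1 / real (Suc n)"] by (auto simp: eventually_sequentially)
    then show ?thesis using \<psi>(1) by blast
  qed
  then obtain g where g: "\<And>n. g n \<in> A" "\<And>n. sqnorm \<mu> (\<lambda>x. g n x - \<Phi> n x) < ennreal (1 / real (Suc n))"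
    by metis
  have [measurable]: "g n \<in> borel_measurable \<mu>" for n using g(1)[of n] A by auto
  have "(\<lambda>n. ennreal (1 / real (Suc n))) \<longlonglongrightarrow> ennreal 0"
    by (intro tendsto_ennrealI LIMSEQ_Suc[OF lim_1_over_n])
  then have 0: "(\<lambda>n. ennreal (1 / real (Suc n))) \<longlonglongrightarrow> 0" by simp
  define d where "d n = sqnorm \<mu> (\<lambda>x. g n x - \<Phi> n x)" for n
  define d' where "d' n = sqnorm \<mu> (\<lambda>x. \<Phi> n x - F x)" for n
  have "d \<longlonglongrightarrow> 0"
    unfolding d_def[abs_def] by (rule ennreal_tendsto_0_mono[OF 0]) (rule less_imp_le[OF g(2)])
  moreover have "d' \<longlonglongrightarrow> 0" using lim by (simp add: L2_tendsto_sqnorm d'_def[abs_def])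
  ultimately have "(\<lambda>n. 2 * d n + 2 * d' n) \<longlonglongrightarrow> 0" by (rule ennreal_tendsto_0_lin)
  moreover have "sqnorm \<mu> (\<lambda>x. g n x - F x) \<le> 2 * d n + 2 * d' n" for n
    unfolding d_def d'_def by (rule sqnorm_triangle[of "g n" \<mu> "\<Phi> n" F]) simp_all
  ultimately have "(\<lambda>n. sqnorm \<mu> (\<lambda>x. g n x - F x)) \<longlonglongrightarrow> 0"
    by (rule ennreal_tendsto_0_mono)
  then show ?thesis using g(1) by (auto simp: L2_adherent_def L2_tendsto_sqnorm)
qed

lemma lim0_cmult:
  assumes "\<And>n. \<phi> n p = c * \<phi> n q" "c \<noteq> 0"
  shows "lim0 \<phi> p = c * lim0 \<phi> q"
proof -
  have "convergent (\<lambda>n. \<phi> n p) \<longleftrightarrow> convergent (\<lambda>n. \<phi> n q)"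
    unfolding assms(1) using assms(2) by (simp add: convergent_mult_const_iff)
  moreover have "lim (\<lambda>n. \<phi> n p) = c * lim (\<lambda>n. \<phi> n q)" if "convergent (\<lambda>n. \<phi> n q)"
    unfolding assms(1)
    by (intro limI tendsto_mult_left) (use that in \<open>simp add: convergent_LIMSEQ_iff\<close>)
  ultimately show ?thesis by (simp add: lim0_def)
qed

text \<open>Expanding the square leaves twice the real part of the cross term, which must vanish for
  every c. In this way orthogonality is read off from norm identities alone.\<close>

lemma L2_inner_eq_0_polarization:
  assumes F: "F \<in> L2 \<mu>" and G: "G \<in> L2 \<mu>"
    and pyth: "\<And>c. sqnorm \<mu> (\<lambda>x. F x + c * G x) = sqnorm \<mu> F + sqnorm \<mu> (\<lambda>x. c * G x)"
  shows "L2_inner \<mu> F G = 0"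
proof -
  have "Re (cnj c * L2_inner \<mu> F G) = 0" for c
  proof -
    have cG: "(\<lambda>x. c * G x) \<in> L2 \<mu>" by (rule L2_cmult[OF G])
    have S: "(\<lambda>x. F x + c * G x) \<in> L2 \<mu>" by (rule L2_add[OF F cG])
    have int: "integrable \<mu> (\<lambda>x. (cmod (H x))\<^sup>2)" if "H \<in> L2 \<mu>" for H
      using that by (simp add: L2_def)
    have sq: "sqnorm \<mu> H = ennreal (LINT x|\<mu>. (cmod (H x))\<^sup>2)" if "H \<in> L2 \<mu>" for H
      unfolding sqnorm_def by (rule nn_integral_eq_integral[OF int[OF that]]) simp
    have nonneg: "0 \<le> (LINT x|\<mu>. (cmod (H x))\<^sup>2)" for H by (rule Bochner_Integration.integral_nonneg) simp
    have eq: "(LINT x|\<mu>. (cmod (F x + c * G x))\<^sup>2)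
        = (LINT x|\<mu>. (cmod (F x))\<^sup>2) + (LINT x|\<mu>. (cmod (c * G x))\<^sup>2)"
      using pyth[of c] unfolding sq[OF F] sq[OF cG] sq[OF S]
      by (simp add: nonneg flip: ennreal_plus)
    have ip: "integrable \<mu> (\<lambda>x. F x * cnj (c * G x))" by (rule L2_integrable_inner[OF F cG])
    define R where "R x = Re (F x * cnj (c * G x))" for x
    have R: "integrable \<mu> R" unfolding R_def[abs_def] by (rule integrable_Re[OF ip])
    have pt: "(cmod (F x + c * G x))\<^sup>2 = (cmod (F x))\<^sup>2 + (cmod (c * G x))\<^sup>2 + 2 * R x" for x
      unfolding cmod_power2 R_def by (simp add: power2_eq_square algebra_simps)
    have "(LINT x|\<mu>. (cmod (F x + c * G x))\<^sup>2)
        = (LINT x|\<mu>. (cmod (F x))\<^sup>2) + (LINT x|\<mu>. (cmod (c * G x))\<^sup>2) + 2 * (LINT x|\<mu>. R x)"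
      unfolding pt using int[OF F] int[OF cG] R by simp
    then have "(LINT x|\<mu>. R x) = 0" using eq by simp
    then have "Re (LINT x|\<mu>. F x * cnj (c * G x)) = 0" by (simp only: R_def integral_Re[OF ip])
    moreover have "(LINT x|\<mu>. F x * cnj (c * G x)) = cnj c * L2_inner \<mu> F G"
      unfolding L2_inner_def integral_mult_right_zero[symmetric] by (simp add: mult_ac)
    ultimately show ?thesis by simp
  qed
  \<comment> \<open>c = 1 kills the real part of the inner product, c = \<i> the imaginary
    part.\<close>
  from this[of 1] this[of \<i>] show ?thesis by (simp add: complex_eq_iff)
qed

section \<open>Invariant functions and equivariant representatives\<close>

context zak
begin

lemma L2_MD:
  assumes "F \<in> L2_M l"
  shows "F \<in> borel_measurable borel" "F \<in> borel_measurable \<mu>" "lattice_invariant l F" "F \<in> L2 \<mu>"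
  using assms by (auto simp: L2_M_def L2_iff)

lemma lattice_invariantD: "lattice_invariant l F \<Longrightarrow> \<gamma> \<in> lattice l \<Longrightarrow> F (heis_mult \<gamma> p) = F p"
  unfolding lattice_invariant_def by blast

lemma L2_M_add: "F \<in> L2_M l \<Longrightarrow> G \<in> L2_M l \<Longrightarrow> (\<lambda>p. F p + G p) \<in> L2_M l"
  by (auto simp: L2_M_def lattice_invariant_def intro: L2_add)

lemma L2_M_cmult: "F \<in> L2_M l \<Longrightarrow> (\<lambda>p. c * F p) \<in> L2_M l"
  by (auto simp: L2_M_def lattice_invariant_def intro: L2_cmult)

lemma L2_M_sum:
  "finite I \<Longrightarrow> (\<And>i. i \<in> I \<Longrightarrow> F i \<in> L2_M l) \<Longrightarrow> (\<lambda>p. \<Sum>i\<in>I. F i p) \<in> L2_M l"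
proof (induction I rule: finite_induct)
  case empty
  then show ?case by (auto simp: L2_M_def lattice_invariant_def L2_iff)
next
  case (insert i I)
  then show ?case using L2_M_add[of "F i" "\<lambda>p. \<Sum>i\<in>I. F i p"] by simp
qed

lemma borel_chr_fst: "(\<lambda>p::'n heis. chr j (fst p)) \<in> borel_measurable borel"
  by (intro borel_measurable_continuous_onI continuous_on_compose2[OF continuous_on_chr[of UNIV]] continuous_intros) auto

lemma L2_M_chr:
  assumes F: "F \<in> L2_M l"
  shows "(\<lambda>p. chr j (fst p) * F p) \<in> L2_M l"
proof -
  have [measurable]: "(\<lambda>p. chr j (fst p) * F p) \<in> borel_measurable borel"
    by (intro borel_measurable_times borel_chr_fst L2_MD[OF F])
  have "lattice_invariant l (\<lambda>p. chr j (fst p) * F p)"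
    unfolding lattice_invariant_def
  proof (intro ballI allI)
    fix \<gamma> p :: "'n heis" assume \<gamma>: "\<gamma> \<in> lattice l"
    then obtain a b c where g: "\<gamma> = (\<chi> i. of_int (a $ i), int_scale b l, of_int c * (l $ first / 2))"
      by (auto simp: lattice_def)
    have "chr j (fst (heis_mult \<gamma> p)) = chr j (fst p)"
      by (cases p) (simp add: g chr_periodic)
    then show "chr j (fst (heis_mult \<gamma> p)) * F (heis_mult \<gamma> p) = chr j (fst p) * F p"
      using lattice_invariantD[OF L2_MD(3)[OF F] \<gamma>, of p] by simp
  qed
  moreover have "sqnorm \<mu> (\<lambda>p. chr j (fst p) * F p) = sqnorm \<mu> F"
    by (rule sqnorm_cong) (simp add: norm_mult)
  ultimately show ?thesis
    using L2_MD(4)[OF F] by (simp add: L2_M_def L2_iff borel_imp_M)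
qed

definition equivariant :: "('n heis \<Rightarrow> complex) \<Rightarrow> bool" where
  "equivariant G \<longleftrightarrow> (\<forall>x u \<xi>. G (x, u, \<xi>) = cis (freq l k * \<xi>) * G (x, u, 0))"

lemma equivariant_W: "equivariant (W j f)"
  by (simp add: equivariant_def W_eq phase_def)

lemma Hk_iff: "F \<in> Hk l k \<longleftrightarrow> F \<in> L2_M l \<and> (\<exists>G\<in>L2_M l. (AE p in \<mu>. F p = G p) \<and> equivariant G)"
  by (simp add: Hk_def equivariant_def)

text \<open>An arbitrary L2 limit is equivariant only almost everywhere, whereas \<open>Hk\<close>
  demands a representative that is so everywhere. The limit \<open>lim0\<close> satisfies the
  identity at every point, because the factors are nonzero and the default value is 0.\<close>

lemma equivariant_complete:
  assumes \<psi>: "\<And>n. \<psi> n \<in> L2_M l" "\<And>n. equivariant (\<psi> n)" and Cauchy: "L2_Cauchy \<mu> \<psi>"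
  obtains G where "G \<in> L2_M l" "equivariant G" "L2_tendsto \<mu> \<psi> G"
proof -
  have meas: "\<psi> n \<in> borel_measurable \<mu>" for n using L2_MD[OF \<psi>(1)[of n]] by simp
  obtain r where r: "L2_tendsto \<mu> \<psi> (lim0 (\<lambda>i. \<psi> (r i)))"
    by (rule L2_complete[OF meas Cauchy])
  let ?G = "lim0 (\<lambda>i. \<psi> (r i))"
  have G_borel: "?G \<in> borel_measurable borel"
    by (rule borel_measurable_lim0) (rule L2_MD(1)[OF \<psi>(1)])
  have "?G \<in> L2 \<mu>"
    by (rule L2_tendsto_imp_L2[OF L2_MD(4)[OF \<psi>(1)] borel_imp_M[OF G_borel] r])
  moreover have "lattice_invariant l ?G"
    unfolding lattice_invariant_def
  proof (intro ballI allI)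
    fix \<gamma> p :: "'n heis" assume "\<gamma> \<in> lattice l"
    then have "\<psi> (r i) (heis_mult \<gamma> p) = 1 * \<psi> (r i) p" for i
      using lattice_invariantD[OF L2_MD(3)[OF \<psi>(1)[of "r i"]], of \<gamma> p] by simp
    then show "?G (heis_mult \<gamma> p) = ?G p"
      using lim0_cmult[of "\<lambda>i. \<psi> (r i)" "heis_mult \<gamma> p" 1 p] by simp
  qed
  moreover have "equivariant ?G"
    unfolding equivariant_def
  proof (intro allI)
    fix x u \<xi>
    have "\<psi> (r i) (x, u, \<xi>) = cis (freq l k * \<xi>) * \<psi> (r i) (x, u, 0)" for i
      using \<psi>(2) unfolding equivariant_def by blast
    then show "?G (x, u, \<xi>) = cis (freq l k * \<xi>) * ?G (x, u, 0)"
      by (rule lim0_cmult) simp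
  qed
  ultimately show ?thesis using that r G_borel by (auto simp: L2_M_def)
qed

lemma Hk_add: "F \<in> Hk l k \<Longrightarrow> F' \<in> Hk l k \<Longrightarrow> (\<lambda>p. F p + F' p) \<in> Hk l k"
proof -
  assume "F \<in> Hk l k" "F' \<in> Hk l k"
  then obtain G G' where *: "F \<in> L2_M l" "F' \<in> L2_M l" "G \<in> L2_M l" "G' \<in> L2_M l"
      "AE p in \<mu>. F p = G p" "AE p in \<mu>. F' p = G' p" "equivariant G" "equivariant G'"
    by (auto simp: Hk_iff)
  have "AE p in \<mu>. F p + F' p = G p + G' p" using *(5,6) by eventually_elim simp
  moreover have "equivariant (\<lambda>p. G p + G' p)"
    using *(7,8) unfolding equivariant_def by (metis distrib_left)
  ultimately show ?thesis
    using * by (auto simp: Hk_iff intro!: L2_M_add bexI[of _ "\<lambda>p. G p + G' p"])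
qed

lemma Hk_sum: "finite I \<Longrightarrow> (\<And>i. i \<in> I \<Longrightarrow> F i \<in> Hk l k) \<Longrightarrow> (\<lambda>p. \<Sum>i\<in>I. F i p) \<in> Hk l k"
proof (induction I rule: finite_induct)
  case empty
  have "(\<lambda>p. 0) \<in> L2_M l" using L2_M_sum[of "{}"] by simp
  then show ?case by (auto simp: Hk_iff equivariant_def)
next
  case (insert i I)
  then show ?case using Hk_add[of "F i" "\<lambda>p. \<Sum>i\<in>I. F i p"] by simp
qed

section \<open>The subspaces \<open>H\<^sub>k\<^sub>,\<^sub>j\<close>\<close>

text \<open>W scales squared norms of Schwartz functions by l_1/2 > 0, so a Cauchy property on M
  pulls back to R^n. This is what produces the L2 function whose transform a limit of waves
  is.\<close>

lemma Cauchy_of_W_Cauchy: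
  assumes \<phi>: "\<And>n. schwartz (\<phi> n)" and C: "L2_Cauchy \<mu> (\<lambda>n. W j (\<phi> n))"
  shows "L2_Cauchy lborel \<phi>"
  unfolding L2_Cauchy_def
proof (intro allI impI)
  fix e :: real assume e: "0 < e"
  let ?c = "l $ first / 2"
  have c: "0 < ?c" using pos[of first] by simp
  obtain M where M: "\<And>m n. m \<ge> M \<Longrightarrow> n \<ge> M \<Longrightarrow>
      sqnorm \<mu> (\<lambda>x. W j (\<phi> m) x - W j (\<phi> n) x) < ennreal (?c * e)"
    using C[unfolded L2_Cauchy_def] mult_pos_pos[OF c e] by meson
  have "sqnorm lborel (\<lambda>x. \<phi> m x - \<phi> n x) < ennreal e" if "m \<ge> M" "n \<ge> M" for m n
  proof (rule ccontr)
    assume "\<not> sqnorm lborel (\<lambda>x. \<phi> m x - \<phi> n x) < ennreal e"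
    then have "ennreal ?c * ennreal e \<le> ennreal ?c * sqnorm lborel (\<lambda>x. \<phi> m x - \<phi> n x)"
      by (intro mult_left_mono) auto
    also have "\<dots> = sqnorm \<mu> (W j (\<lambda>x. \<phi> m x - \<phi> n x))"
      by (rule sqnorm_W[symmetric]) (intro schwartz_diff \<phi>)
    also have "W j (\<lambda>x. \<phi> m x - \<phi> n x) = (\<lambda>x. W j (\<phi> m) x - W j (\<phi> n) x)"
      by (rule ext) (rule W_diff[OF \<phi> \<phi>])
    also have "sqnorm \<mu> \<dots> < ennreal (?c * e)" by (rule M[OF that])
    finally show False using c e by (simp flip: ennreal_mult)
  qed
  then show "\<exists>M. \<forall>m\<ge>M. \<forall>n\<ge>M. sqnorm lborel (\<lambda>x. \<phi> m x - \<phi> n x) < ennreal e" by blast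
qed

lemma W_chr: "chr i (fst p) * W j f p = W (i + j) f p"
  by (cases p) (simp add: W_eq chr_add)

text \<open>Only the convergence on M is recorded, which makes closedness a diagonal argument; the
  preimage on R^n required by \<open>is_V\<close> is recovered separately.\<close>

definition Wclosure :: "(int, 'n) vec \<Rightarrow> ('n heis \<Rightarrow> complex) set" where
  "Wclosure j = {F \<in> L2_M l. L2_adherent \<mu> (W j ` {f. schwartz f}) F}"

lemma WclosureE:
  assumes "F \<in> Wclosure j"
  obtains \<phi> where "F \<in> L2_M l" "\<forall>n. schwartz (\<phi> n)" "L2_tendsto \<mu> (\<lambda>n. W j (\<phi> n)) F"
proof -
  obtain \<psi> where *: "F \<in> L2_M l" "\<forall>n. \<psi> n \<in> W j ` {f. schwartz f}" "L2_tendsto \<mu> \<psi> F"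
    using assms by (auto simp: Wclosure_def L2_adherent_def)
  then obtain \<phi> where \<phi>: "\<And>n. schwartz (\<phi> n)" "\<And>n. \<psi> n = W j (\<phi> n)"
    by (simp add: image_iff) metis
  then have "\<psi> = (\<lambda>n. W j (\<phi> n))" by auto
  then show ?thesis by (intro that[of \<phi>]) (use * \<phi>(1) in auto)
qed

lemma WclosureI:
  assumes "F \<in> L2_M l" "\<And>n. schwartz (\<phi> n)" "L2_tendsto \<mu> (\<lambda>n. W j (\<phi> n)) F"
  shows "F \<in> Wclosure j"
  using assms unfolding Wclosure_def L2_adherent_def by (auto intro!: exI[of _ "\<lambda>n. W j (\<phi> n)"])

lemma measurable_W_M: "schwartz f \<Longrightarrow> W j f \<in> borel_measurable \<mu>"
  by (intro borel_imp_M borel_measurable_W)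

text \<open>Multiplication by a character preserves distances and exchanges W j with V_k, so the
  approximating sequences correspond. For the inclusion of the closure in \<open>Hkj\<close>,
  completeness of L2 on R^n supplies the limit of the pulled-back Cauchy sequence.\<close>

lemma Hkj_eq_Wclosure: "Hkj l k j = Wclosure j"
proof (intro equalityI subsetI)
  fix F assume "F \<in> Hkj l k j"
  then obtain f G where F: "F = (\<lambda>(x, u, \<xi>). chr j x * G (x, u, \<xi>))" and "is_V l k f G"
    by (auto simp: Hkj_def chr_def)
  then obtain \<phi> where G: "G \<in> L2_M l" and \<phi>: "\<And>n. schwartz (\<phi> n)"
      and lim: "L2_tendsto \<mu> (\<lambda>n. V_schwartz l k (\<phi> n)) G"
    by (auto simp: is_V_def)
  have F': "F = (\<lambda>p. chr j (fst p) * G p)" by (auto simp: F)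
  have "sqnorm \<mu> (\<lambda>p. W j (\<phi> n) p - F p) = sqnorm \<mu> (\<lambda>p. V_schwartz l k (\<phi> n) p - G p)" for n
  proof (rule sqnorm_cong)
    fix p
    have "W j (\<phi> n) p - F p = chr j (fst p) * (V_schwartz l k (\<phi> n) p - G p)"
      unfolding F' V_eq right_diff_distrib W_chr by simp
    then show "cmod (W j (\<phi> n) p - F p) = cmod (V_schwartz l k (\<phi> n) p - G p)"
      by (simp add: norm_mult)
  qed
  then have "L2_tendsto \<mu> (\<lambda>n. W j (\<phi> n)) F" using lim by (simp add: L2_tendsto_sqnorm)
  then show "F \<in> Wclosure j" using \<phi> L2_M_chr[OF G, of j] by (intro WclosureI) (auto simp: F')
next
  fix F assume "F \<in> Wclosure j"
  then obtain \<phi> where F: "F \<in> L2_M l" and "\<forall>n. schwartz (\<phi> n)" and lim: "L2_tendsto \<mu> (\<lambda>n. W j (\<phi> n)) F"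
    by (rule WclosureE)
  then have \<phi>: "\<And>n. schwartz (\<phi> n)" by blast
  define G where "G = (\<lambda>p. chr (- j) (fst p) * F p)"
  have G: "G \<in> L2_M l" unfolding G_def by (rule L2_M_chr[OF F])
  have "sqnorm \<mu> (\<lambda>p. V_schwartz l k (\<phi> n) p - G p) = sqnorm \<mu> (\<lambda>p. W j (\<phi> n) p - F p)" for n
  proof (rule sqnorm_cong)
    fix p
    have "V_schwartz l k (\<phi> n) p - G p = chr (- j) (fst p) * (W j (\<phi> n) p - F p)"
      unfolding G_def V_eq right_diff_distrib W_chr by simp
    then show "cmod (V_schwartz l k (\<phi> n) p - G p) = cmod (W j (\<phi> n) p - F p)"
      by (simp add: norm_mult)
  qed
  then have limG: "L2_tendsto \<mu> (\<lambda>n. V_schwartz l k (\<phi> n)) G" using lim by (simp add: L2_tendsto_sqnorm)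
  have \<phi>_meas: "\<phi> n \<in> borel_measurable lborel" for n using schwartz_borel[OF \<phi>[of n]] by simp
  have "L2_Cauchy \<mu> (\<lambda>n. W j (\<phi> n))"
    by (rule L2_tendsto_imp_Cauchy[OF measurable_W_M[OF \<phi>] L2_MD(2)[OF F] lim])
  then have "L2_Cauchy lborel \<phi>" by (rule Cauchy_of_W_Cauchy[OF \<phi>])
  then obtain r where r: "L2_tendsto lborel \<phi> (lim0 (\<lambda>i. \<phi> (r i)))"
    by (rule L2_complete[OF \<phi>_meas])
  have "lim0 (\<lambda>i. \<phi> (r i)) \<in> L2 lborel"
    by (rule L2_tendsto_imp_L2[OF _ borel_measurable_lim0[OF \<phi>_meas] r])
      (use \<phi>_meas schwartz_sqnorm_finite[OF \<phi>] in \<open>auto simp: L2_iff\<close>)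
  then have "is_V l k (lim0 (\<lambda>i. \<phi> (r i))) G"
    unfolding is_V_def using G \<phi> r limG by blast
  moreover have "F = (\<lambda>(x, u, \<xi>). chr j x * G (x, u, \<xi>))"
    by (auto simp: G_def fun_eq_iff mult.assoc[symmetric])
  ultimately show "F \<in> Hkj l k j"
    unfolding Hkj_def chr_def by blast
qed

lemma closed_subspace_Wclosure: "closed_subspace \<mu> (L2_M l) (Wclosure j)"
  unfolding closed_subspace_def
proof (intro conjI ballI allI impI)
  show "Wclosure j \<subseteq> L2_M l" by (auto simp: Wclosure_def)
  show "(\<lambda>_. 0) \<in> Wclosure j"
    using L2_M_sum[of "{}"] schwartz_zero
    by (intro WclosureI[of _ "\<lambda>_ _. 0"]) (auto simp: L2_tendsto_sqnorm W_zero)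
next
  fix F G assume F: "F \<in> Wclosure j" and G: "G \<in> Wclosure j"
  obtain \<phi> where "F \<in> L2_M l" "\<forall>n. schwartz (\<phi> n)" "L2_tendsto \<mu> (\<lambda>n. W j (\<phi> n)) F"
    by (rule WclosureE[OF F])
  then have F': "F \<in> L2_M l" "\<And>n. schwartz (\<phi> n)" "L2_tendsto \<mu> (\<lambda>n. W j (\<phi> n)) F"
    by blast+
  obtain \<psi> where "G \<in> L2_M l" "\<forall>n. schwartz (\<psi> n)" "L2_tendsto \<mu> (\<lambda>n. W j (\<psi> n)) G"
    by (rule WclosureE[OF G])
  then have G': "G \<in> L2_M l" "\<And>n. schwartz (\<psi> n)" "L2_tendsto \<mu> (\<lambda>n. W j (\<psi> n)) G"
    by blast+
  note * = F' G'
  have "L2_tendsto \<mu> (\<lambda>n p. W j (\<phi> n) p + W j (\<psi> n) p) (\<lambda>p. F p + G p)"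
    by (intro L2_tendsto_add measurable_W_M L2_MD *)
  moreover have "W j (\<lambda>v. \<phi> n v + \<psi> n v) = (\<lambda>p. W j (\<phi> n) p + W j (\<psi> n) p)" for n
    by (rule ext) (rule W_add[OF *(2,5)])
  ultimately show "(\<lambda>p. F p + G p) \<in> Wclosure j"
    by (intro WclosureI[of _ "\<lambda>n v. \<phi> n v + \<psi> n v"] L2_M_add schwartz_add *) simp
next
  fix c F assume "F \<in> Wclosure j"
  then obtain \<phi> where "F \<in> L2_M l" "\<forall>n. schwartz (\<phi> n)" "L2_tendsto \<mu> (\<lambda>n. W j (\<phi> n)) F"
    by (rule WclosureE)
  then have *: "F \<in> L2_M l" "\<And>n. schwartz (\<phi> n)" "L2_tendsto \<mu> (\<lambda>n. W j (\<phi> n)) F"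
    by blast+
  have "L2_tendsto \<mu> (\<lambda>n p. c * W j (\<phi> n) p) (\<lambda>p. c * F p)"
    by (intro L2_tendsto_cmult measurable_W_M L2_MD *)
  moreover have "W j (\<lambda>v. c * \<phi> n v) = (\<lambda>p. c * W j (\<phi> n) p)" for n
    by (rule ext) (rule W_cmult)
  ultimately show "(\<lambda>p. c * F p) \<in> Wclosure j"
    by (intro WclosureI[of _ "\<lambda>n v. c * \<phi> n v"] L2_M_cmult schwartz_cmult *) simp
next
  fix \<Phi> F assume F: "F \<in> L2_M l" and "(\<forall>n. \<Phi> n \<in> Wclosure j) \<and> L2_tendsto \<mu> \<Phi> F"
  then have \<Phi>: "\<And>n. \<Phi> n \<in> Wclosure j" and lim: "L2_tendsto \<mu> \<Phi> F" by auto
  have "\<Phi> n \<in> borel_measurable \<mu>" for n using \<Phi>[of n] L2_MD by (auto simp: Wclosure_def)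
  moreover have "L2_adherent \<mu> (W j ` {f. schwartz f}) (\<Phi> n)" for n using \<Phi>[of n] by (simp add: Wclosure_def)
  moreover have "W j ` {f. schwartz f} \<subseteq> borel_measurable \<mu>" using measurable_W_M by blast
  ultimately have "L2_adherent \<mu> (W j ` {f. schwartz f}) F"
    using L2_adherent_limit[of "W j ` {f. schwartz f}" \<mu> \<Phi> F] lim L2_MD(2)[OF F] by blast
  then show "F \<in> Wclosure j" using F by (simp add: Wclosure_def)
qed

text \<open>An element of the closure need not be equivariant at every point. The approximating
  waves also converge to an equivariant function, which equals it almost everywhere.\<close>

lemma Wclosure_subset_Hk: "Wclosure j \<subseteq> Hk l k"
proof
  fix F assume "F \<in> Wclosure j"
  then obtain \<phi> where "F \<in> L2_M l" "\<forall>n. schwartz (\<phi> n)" "L2_tendsto \<mu> (\<lambda>n. W j (\<phi> n)) F"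
    by (rule WclosureE)
  then have *: "F \<in> L2_M l" "\<And>n. schwartz (\<phi> n)" "L2_tendsto \<mu> (\<lambda>n. W j (\<phi> n)) F"
    by blast+
  have "L2_Cauchy \<mu> (\<lambda>n. W j (\<phi> n))"
    by (rule L2_tendsto_imp_Cauchy[OF measurable_W_M[OF *(2)] L2_MD(2)[OF *(1)] *(3)])
  then obtain G where G: "G \<in> L2_M l" "equivariant G" "L2_tendsto \<mu> (\<lambda>n. W j (\<phi> n)) G"
    by (rule equivariant_complete[of "\<lambda>n. W j (\<phi> n)", OF W_L2_M[OF *(2)] equivariant_W])
  have "AE p in \<mu>. F p = G p"
    by (rule L2_tendsto_unique[OF measurable_W_M[OF *(2)] L2_MD(2)[OF *(1)] L2_MD(2)[OF G(1)] *(3) G(3)])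
  then show "F \<in> Hk l k" using *(1) G by (auto simp: Hk_iff)
qed

text \<open>The norm identity for two indices, with the second function scaled by an arbitrary c, is
  the Pythagorean hypothesis of polarization. Distinct residue classes mean that the two families of
  frequencies are disjoint.\<close>

lemma L2_inner_W_eq_0:
  assumes f: "schwartz f" and g: "schwartz g" and ij: "\<And>m. i - j \<noteq> dil m"
  shows "L2_inner \<mu> (W i f) (W j g) = 0"
proof (rule L2_inner_eq_0_polarization)
  show "W i f \<in> L2 \<mu>" "W j g \<in> L2 \<mu>"
    using W_L2_M f g by (auto intro: L2_MD)
  fix c
  let ?r = "\<lambda>b. if b then i else j" and ?\<phi> = "\<lambda>b. if b then f else (\<lambda>v. c * g v)"
  have cg: "schwartz (\<lambda>v. c * g v)" by (rule schwartz_cmult[OF g])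
  have Wcg: "W j (\<lambda>v. c * g v) = (\<lambda>p. c * W j g p)" by (rule ext) (rule W_cmult)
  have neq: "i + dil m \<noteq> j + dil m'" for m m'
  proof
    assume "i + dil m = j + dil m'"
    moreover have "dil m' = dil (m' - m) + dil m" by (simp flip: dil_add)
    ultimately have "i + dil m = (j + dil (m' - m)) + dil m" by (simp only: add.assoc)
    then have "i = j + dil (m' - m)" by (rule add_right_imp_eq)
    then have "i - j = dil (m' - m)" by simp
    then show False using ij by blast
  qed
  have "inj_on (\<lambda>(b, m). ?r b + dil m) ({True, False} \<times> UNIV)"
    using neq neq[symmetric] by (auto simp: inj_on_def inj_dil split: if_splits)
  then have "sqnorm \<mu> (\<lambda>p. \<Sum>b\<in>{True, False}. W (?r b) (?\<phi> b) p)
      = ennreal (l $ first / 2) * (\<Sum>b\<in>{True, False}. sqnorm lborel (?\<phi> b))"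
    by (intro sqnorm_sum_W) (auto simp: f cg)
  then have "sqnorm \<mu> (\<lambda>p. W i f p + c * W j g p)
      = ennreal (l $ first / 2) * sqnorm lborel f + ennreal (l $ first / 2) * sqnorm lborel (\<lambda>v. c * g v)"
    by (simp add: Wcg distrib_left)
  then show "sqnorm \<mu> (\<lambda>p. W i f p + c * W j g p) = sqnorm \<mu> (W i f) + sqnorm \<mu> (\<lambda>p. c * W j g p)"
    by (simp add: sqnorm_W[OF f, symmetric] sqnorm_W[OF cg, of j, symmetric] Wcg)
qed

lemma Wclosure_orthogonal:
  assumes F: "F \<in> Wclosure i" and G: "G \<in> Wclosure j" and ij: "\<And>m. i - j \<noteq> dil m"
  shows "L2_inner \<mu> F G = 0"
proof -
  obtain \<phi> where "F \<in> L2_M l" "\<forall>n. schwartz (\<phi> n)" "L2_tendsto \<mu> (\<lambda>n. W i (\<phi> n)) F"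
    by (rule WclosureE[OF F])
  then have F': "F \<in> L2_M l" "\<And>n. schwartz (\<phi> n)" "L2_tendsto \<mu> (\<lambda>n. W i (\<phi> n)) F"
    by blast+
  obtain \<psi> where "G \<in> L2_M l" "\<forall>n. schwartz (\<psi> n)" "L2_tendsto \<mu> (\<lambda>n. W j (\<psi> n)) G"
    by (rule WclosureE[OF G])
  then have G': "G \<in> L2_M l" "\<And>n. schwartz (\<psi> n)" "L2_tendsto \<mu> (\<lambda>n. W j (\<psi> n)) G"
    by blast+
  note * = F' G'
  have L2: "F \<in> L2 \<mu>" "G \<in> L2 \<mu>" by (intro L2_MD(4) *)+
  have \<phi>: "W i (\<phi> n) \<in> L2 \<mu>" for n by (rule L2_MD(4)[OF W_L2_M[OF *(2)]])
  have \<psi>: "W j (\<psi> n) \<in> L2 \<mu>" for n by (rule L2_MD(4)[OF W_L2_M[OF *(5)]])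
  \<comment> \<open>Limits are available in the first argument only, so they are taken one at a
    time, with conjugation exchanging the arguments.\<close>
  have "L2_inner \<mu> (W j (\<psi> m)) (W i (\<phi> n)) = 0" for m n
    using L2_inner_W_eq_0[OF *(2,5) ij, of n m] L2_inner_commute[of \<mu> "W j (\<psi> m)" "W i (\<phi> n)"] by simp
  then have "L2_inner \<mu> G (W i (\<phi> n)) = 0" for n
    by (rule L2_inner_zero_limit[OF \<psi> L2(2) \<phi> *(6)])
  then have "L2_inner \<mu> (W i (\<phi> n)) G = 0" for n
    using L2_inner_commute[of \<mu> "W i (\<phi> n)" G] by simp
  then show ?thesis
    by (rule L2_inner_zero_limit[OF \<phi> L2(1) L2(2) *(3)])
qed

end

section \<open>Completeness of the decomposition\<close>

text \<open>The last two assumptions say that (J, m) \<mapsto> \<open>r J + dil m\<close> is a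
  bijection onto Z^n. Injectivity enters through the norm identity, surjectivity through
  density.\<close>

locale zak_reps = zak l k for l :: "real^'n::{finite,linorder}" and k :: int +
  fixes I :: "'i set" and r :: "'i \<Rightarrow> (int, 'n) vec"
  assumes finite_I: "finite I"
    and inj_r: "inj_on (\<lambda>(J, m). r J + dil m) (I \<times> UNIV)"
    and surj_r: "\<exists>J\<in>I. \<exists>m. q = r J + dil m"
begin

definition wave_span :: "('n heis \<Rightarrow> complex) set" where
  "wave_span = {\<lambda>p. \<Sum>J\<in>I. W (r J) (\<phi> J) p |\<phi>. \<forall>J\<in>I. schwartz (\<phi> J)}"

lemma wave_span_add:
  assumes "g \<in> wave_span" "g' \<in> wave_span"
  shows "(\<lambda>p. g p + g' p) \<in> wave_span"
proof -
  obtain \<phi> \<phi>' where *: "g = (\<lambda>p. \<Sum>J\<in>I. W (r J) (\<phi> J) p)" "\<forall>J\<in>I. schwartz (\<phi> J)"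
      "g' = (\<lambda>p. \<Sum>J\<in>I. W (r J) (\<phi>' J) p)" "\<forall>J\<in>I. schwartz (\<phi>' J)"
    using assms by (auto simp: wave_span_def)
  have "(\<lambda>p. g p + g' p) = (\<lambda>p. \<Sum>J\<in>I. W (r J) (\<lambda>v. \<phi> J v + \<phi>' J v) p)"
    unfolding * sum.distrib[symmetric] using *(2,4) by (intro ext sum.cong refl) (simp add: W_add)
  moreover have "\<forall>J\<in>I. schwartz (\<lambda>v. \<phi> J v + \<phi>' J v)" using *(2,4) by (simp add: schwartz_add)
  ultimately show ?thesis
    unfolding wave_span_def by (intro CollectI exI[of _ "\<lambda>J v. \<phi> J v + \<phi>' J v"] conjI)
qed

lemma wave_span_cmult:
  assumes "g \<in> wave_span"
  shows "(\<lambda>p. c * g p) \<in> wave_span"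
proof -
  obtain \<phi> where *: "g = (\<lambda>p. \<Sum>J\<in>I. W (r J) (\<phi> J) p)" "\<forall>J\<in>I. schwartz (\<phi> J)"
    using assms by (auto simp: wave_span_def)
  have "(\<lambda>p. c * g p) = (\<lambda>p. \<Sum>J\<in>I. W (r J) (\<lambda>v. c * \<phi> J v) p)"
    unfolding * sum_distrib_left by (simp add: W_cmult)
  moreover have "\<forall>J\<in>I. schwartz (\<lambda>v. c * \<phi> J v)" using *(2) by (simp add: schwartz_cmult)
  ultimately show ?thesis
    unfolding wave_span_def by (intro CollectI exI[of _ "\<lambda>J v. c * \<phi> J v"] conjI)
qed

lemma wave_span_measurable: "wave_span \<subseteq> borel_measurable \<mu>"
  by (auto simp: wave_span_def intro!: borel_measurable_sum measurable_W_M)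

section \<open>Density of the sums of waves, reduced to functions of (x, u)\<close>

definition lift :: "((real, 'n) vec \<times> (real, 'n) vec \<Rightarrow> complex) \<Rightarrow> 'n heis \<Rightarrow> complex" where
  "lift h = (\<lambda>p. phase p * h (fst p, fst (snd p)))"

abbreviation proj :: "'n heis \<Rightarrow> (real, 'n) vec \<times> (real, 'n) vec" where
  "proj \<equiv> (\<lambda>p. (fst p, fst (snd p)))"

text \<open>The image measure for which \<open>lift\<close> preserves norms. It is finite, so the
  induction over boxes applies to functions of (x, u) instead of functions on M.\<close>

definition \<nu> :: "((real, 'n) vec \<times> (real, 'n) vec) measure" where
  "\<nu> = distr \<mu> borel proj"

lemma proj_borel: "proj \<in> borel_measurable borel"
  by (intro borel_measurable_continuous_onI continuous_intros)

lemma proj_M: "proj \<in> measurable \<mu> borel"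
  unfolding measure_M_def by (intro measurable_restrict_space1) (use proj_borel in simp)

lemma finite_measure_\<nu>: "finite_measure \<nu>"
  unfolding \<nu>_def by (rule finite_measure.finite_measure_distr[OF finite_measure_M proj_M])

lemma lift_borel:
  assumes "h \<in> borel_measurable borel"
  shows "lift h \<in> borel_measurable borel"
  unfolding lift_def
  by (intro borel_measurable_times borel_measurable_phase measurable_compose[OF proj_borel assms])

lemma sqnorm_lift:
  assumes [measurable]: "h \<in> borel_measurable borel"
  shows "sqnorm \<mu> (lift h) = sqnorm \<nu> h"
proof -
  have "sqnorm \<nu> h = (\<integral>\<^sup>+p. ennreal ((cmod (h (proj p)))\<^sup>2) \<partial>\<mu>)"
    unfolding sqnorm_def \<nu>_def by (rule nn_integral_distr[OF proj_M]) measurable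
  then show ?thesis by (simp add: sqnorm_def lift_def norm_mult)
qed

lemma L2_tendsto_lift:
  assumes "\<And>n. \<phi> n \<in> borel_measurable borel" "f \<in> borel_measurable borel" "L2_tendsto \<nu> \<phi> f"
  shows "L2_tendsto \<mu> (\<lambda>n. lift (\<phi> n)) (lift f)"
proof -
  have "sqnorm \<mu> (\<lambda>p. lift (\<phi> n) p - lift f p) = sqnorm \<nu> (\<lambda>q. \<phi> n q - f q)" for n
  proof -
    have "(\<lambda>p. lift (\<phi> n) p - lift f p) = lift (\<lambda>q. \<phi> n q - f q)"
      by (simp add: lift_def right_diff_distrib)
    then show ?thesis using sqnorm_lift[of "\<lambda>q. \<phi> n q - f q"] assms(1,2) by simp
  qed
  then show ?thesis using assms(3) by (simp add: L2_tendsto_sqnorm)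
qed

lemma cell_unique:
  assumes "u \<in> cell" "u + int_scale m l \<in> cell"
  shows "m = 0"
proof -
  have "m $ i = 0" for i
  proof -
    have "0 \<le> u $ i" "u $ i < l $ i" "0 \<le> u $ i + of_int (m $ i) * l $ i" "u $ i + of_int (m $ i) * l $ i < l $ i"
      using assms by (auto simp: cell_def int_scale_def)
    then have "of_int (m $ i) * l $ i < 1 * l $ i" "(-1) * l $ i < of_int (m $ i) * l $ i" by linarith+
    then have "real_of_int (m $ i) < 1" "-1 < real_of_int (m $ i)"
      using pos[of i] by (simp_all only: mult_less_cancel_right_pos)
    then show ?thesis by linarith
  qed
  then show ?thesis by (simp add: vec_eq_iff)
qed

text \<open>With q = \<open>r J + dil m\<close>, the bump is moved by m l. At points of the cell
  only the m-th term of the lattice sum then survives, and its factor \<open>chr (dil m) x\<close>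
  completes \<open>chr (r J) x\<close> to \<open>chr q x\<close>. Equality is claimed on the
  fundamental domain only, as the lift is not lattice-invariant.\<close>

lemma chr_bump_in_wave_span:
  assumes \<epsilon>: "0 < \<epsilon>" and ab: "box a b \<subseteq> cell"
  shows "\<exists>g\<in>wave_span. \<forall>p\<in>fund_domain l. lift (\<lambda>z. chr q (fst z) * bump \<epsilon> a b (snd z)) p = g p"
proof -
  obtain J m where J: "J \<in> I" and q: "q = r J + dil m" using surj_r by blast
  let ?f = "bump \<epsilon> (a + int_scale m l) (b + int_scale m l)"
  define \<phi> where "\<phi> J' = (if J' = J then ?f else (\<lambda>_. 0))" for J'
  have sch: "schwartz (\<phi> J')" for J'
    unfolding \<phi>_def by (simp add: schwartz_bump[OF \<epsilon>] schwartz_zero)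
  have sum: "(\<Sum>J'\<in>I. W (r J') (\<phi> J') p) = W (r J) ?f p" for p
  proof -
    have "(\<Sum>J'\<in>I. W (r J') (\<phi> J') p) = (\<Sum>J'\<in>I. if J' = J then W (r J) ?f p else 0)"
      by (intro sum.cong refl) (auto simp: \<phi>_def W_zero)
    then show ?thesis using finite_I J by simp
  qed
  have "lift (\<lambda>z. chr q (fst z) * bump \<epsilon> a b (snd z)) p = W (r J) ?f p" if p: "p \<in> fund_domain l" for p
  proof -
    obtain x u \<xi> where pe: "p = (x, u, \<xi>)" by (cases p)
    have u: "u \<in> cell" using p by (simp add: pe fund_domain_eq)
    have zero: "bump \<epsilon> a b (u + int_scale m' l - int_scale m l) = 0" if "m' \<noteq> m" for m'
    proof (rule bump_eq_0, rule notI)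
      assume "u + int_scale m' l - int_scale m l \<in> box a b"
      moreover have "u + int_scale m' l - int_scale m l = u + int_scale (m' - m) l"
        by (simp add: int_scale_def vec_eq_iff algebra_simps)
      ultimately have "u + int_scale (m' - m) l \<in> cell" using ab by auto
      from cell_unique[OF u this] that show False by simp
    qed
    have "Z ?f x u = infsum (\<lambda>m'. chr (dil m') x * bump \<epsilon> a b (u + int_scale m' l - int_scale m l)) UNIV"
      by (simp add: Z_def bump_translate)
    also have "\<dots> = infsum (\<lambda>m'. chr (dil m') x * bump \<epsilon> a b (u + int_scale m' l - int_scale m l)) {m}"
      by (rule infsum_cong_neutral) (auto simp: zero)
    also have "\<dots> = chr (dil m) x * bump \<epsilon> a b u" by simp
    finally show ?thesis by (simp add: pe lift_def W_eq q chr_add)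
  qed
  then have "\<forall>p\<in>fund_domain l. lift (\<lambda>z. chr q (fst z) * bump \<epsilon> a b (snd z)) p = (\<Sum>J'\<in>I. W (r J') (\<phi> J') p)"
    unfolding sum by blast
  moreover have "(\<lambda>p. \<Sum>J'\<in>I. W (r J') (\<phi> J') p) \<in> wave_span"
    using sch unfolding wave_span_def by blast
  ultimately show ?thesis by (rule bexI)
qed

lemma trig_bump_in_wave_span:
  assumes "trig T" and \<epsilon>: "0 < \<epsilon>" and ab: "box a b \<subseteq> cell"
  shows "\<exists>g\<in>wave_span. \<forall>p\<in>fund_domain l. lift (\<lambda>z. T (fst z) * bump \<epsilon> a b (snd z)) p = g p"
  using assms(1)
proof induction
  case (chr q)
  show ?case by (rule chr_bump_in_wave_span[OF \<epsilon> ab])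
next
  case (cmult f c)
  then obtain g where "g \<in> wave_span" "\<forall>p\<in>fund_domain l. lift (\<lambda>z. f (fst z) * bump \<epsilon> a b (snd z)) p = g p"
    by blast
  then show ?case
    by (intro bexI[of _ "\<lambda>p. c * g p"] wave_span_cmult) (auto simp: lift_def algebra_simps)
next
  case (add f f')
  then obtain g g' where "g \<in> wave_span" "\<forall>p\<in>fund_domain l. lift (\<lambda>z. f (fst z) * bump \<epsilon> a b (snd z)) p = g p"
      "g' \<in> wave_span" "\<forall>p\<in>fund_domain l. lift (\<lambda>z. f' (fst z) * bump \<epsilon> a b (snd z)) p = g' p"
    by blast
  then show ?case
    by (intro bexI[of _ "\<lambda>p. g p + g' p"] wave_span_add) (auto simp: lift_def algebra_simps)
qed

text \<open>The faces lie in coordinate hyperplanes, which are null. There the trigonometric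
  approximation, or the box cut down to the open interior of the cell, may give the wrong
  limit.\<close>

lemma AE_M_interior:
  "AE p in \<mu>. p \<in> fund_domain l \<and> (\<forall>i. 0 < fst p $ i) \<and> (\<forall>i. 0 < fst (snd p) $ i)"
proof -
  have b1: "(axis i 1, 0) \<in> (Basis :: 'n heis set)" and b2: "(0, axis i 1, 0) \<in> (Basis :: 'n heis set)" for i
    unfolding Basis_prod_def by (intro UnI1 image_eqI[OF refl], simp, intro UnI2 image_eqI[OF refl] UnI1, simp)
  have "AE p in (lborel :: 'n heis measure). \<forall>i\<in>UNIV. p \<bullet> (axis i 1, 0) \<noteq> (0::real) \<and> p \<bullet> (0, axis i 1, 0) \<noteq> 0"
    by (intro AE_finite_allI AE_conjI AE_lborel_inner_neq b1 b2) simp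
  then have "AE p in lborel. p \<in> fund_domain l \<longrightarrow>
      (p \<in> fund_domain l \<and> (\<forall>i. 0 < fst p $ i) \<and> (\<forall>i. 0 < fst (snd p) $ i))"
  proof eventually_elim
    case (elim p)
    show ?case
    proof (intro impI)
      assume p: "p \<in> fund_domain l"
      obtain x u \<xi> where pe: "p = (x, u, \<xi>)" by (cases p)
      have "x $ i \<noteq> 0 \<and> u $ i \<noteq> 0" for i
        using elim by (simp add: pe inner_axis)
      moreover have "0 \<le> x $ i" "0 \<le> u $ i" for i
        using p by (auto simp: pe fund_domain_eq unit_cube_def cell_def)
      ultimately have "0 < x $ i" "0 < u $ i" for i by (metis order_le_less)+
      then show "p \<in> fund_domain l \<and> (\<forall>i. 0 < fst p $ i) \<and> (\<forall>i. 0 < fst (snd p) $ i)"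
        using p by (simp add: pe)
    qed
  qed
  then show ?thesis
    unfolding measure_M_def by (subst AE_restrict_space_iff) auto
qed

lemma mem_box_Pair: "(x, u) \<in> box (a, a') (b, b') \<longleftrightarrow> x \<in> box a b \<and> u \<in> box a' b'"
  by (simp add: mem_box Basis_prod_def ball_Un)

lemma indicator_box_adherent: "L2_adherent \<mu> wave_span (lift (indicator (box a b)))"
proof -
  obtain a1 a2 b1 b2 where a: "a = (a1, a2)" and b: "b = (b1, b2)" by (cases a, cases b)
  \<comment> \<open>The u-side of the box is cut down to the cell, where bumps are usable; at
    interior points of the fundamental domain this changes nothing. The x-side may stay
    arbitrary.\<close>
  define a' :: "(real, 'n) vec" where "a' = (\<chi> i. max 0 (a2 $ i))"
  define b' :: "(real, 'n) vec" where "b' = (\<chi> i. min (l $ i) (b2 $ i))"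
  have cell: "box a' b' \<subseteq> cell"
    by (auto simp: a'_def b'_def cell_def mem_box_cart less_imp_le)
  obtain T where "\<forall>n::nat. trig (T n)" "\<forall>n x. cmod (T n x) \<le> 2"
      "\<forall>x. (\<forall>i. 0 < x $ i \<and> x $ i < 1) \<longrightarrow> (\<lambda>n. T n x) \<longlonglongrightarrow> indicator (box a1 b1) x"
    by (rule trig_approx_indicator[of a1 b1])
  then have T: "\<And>n. trig (T n)" "\<And>n x. cmod (T n x) \<le> 2"
      "\<And>x. (\<And>i. 0 < x $ i \<and> x $ i < 1) \<Longrightarrow> (\<lambda>n. T n x) \<longlonglongrightarrow> indicator (box a1 b1) x"
    by blast+
  let ?\<epsilon> = "\<lambda>n. 1 / real (Suc n)"
  define h where "h n = (\<lambda>z. T n (fst z) * bump (?\<epsilon> n) a' b' (snd z))" for n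
  have "\<exists>g\<in>wave_span. \<forall>p\<in>fund_domain l. lift (h n) p = g p" for n
    unfolding h_def by (rule trig_bump_in_wave_span[OF T(1) _ cell]) simp
  then obtain g where g: "\<And>n. g n \<in> wave_span" "\<And>n p. p \<in> fund_domain l \<Longrightarrow> lift (h n) p = g n p"
    by metis
  have h_borel: "h n \<in> borel_measurable borel" for n
  proof -
    have "fst \<in> borel_measurable (borel :: ((real, 'n) vec \<times> (real, 'n) vec) measure)"
      "snd \<in> borel_measurable (borel :: ((real, 'n) vec \<times> (real, 'n) vec) measure)"
      by (intro borel_measurable_continuous_onI continuous_intros)+
    then show ?thesis
      unfolding h_def
      by (intro borel_measurable_times measurable_compose[OF _ trig_borel[OF T(1)]]
          measurable_compose[OF _ schwartz_borel[OF schwartz_bump]]) auto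
  qed
  have "L2_tendsto \<mu> (\<lambda>n. lift (h n)) (lift (indicator (box a b)))"
  proof (rule L2_tendsto_dominated[where w = "\<lambda>_. 2"])
    show "lift (h n) \<in> borel_measurable \<mu>" for n by (intro borel_imp_M lift_borel h_borel)
    show "lift (indicator (box a b)) \<in> borel_measurable \<mu>"
      by (intro borel_imp_M lift_borel borel_measurable_indicator) simp
    show "cmod (lift (h n) p) \<le> 2" for n p
    proof -
      have "cmod (T n (fst p)) * cmod (bump (?\<epsilon> n) a' b' (fst (snd p))) \<le> 2 * 1"
        by (intro mult_mono T cmod_bump_le_1) auto
      then show ?thesis by (simp add: lift_def h_def norm_mult)
    qed
    show "(\<integral>\<^sup>+p. ennreal (2\<^sup>2) \<partial>\<mu>) < \<infinity>"
      using finite_measure.emeasure_finite[OF finite_measure_M]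
      by (simp add: ennreal_mult_eq_top_iff less_top[symmetric])
    show "AE p in \<mu>. (\<lambda>n. lift (h n) p) \<longlonglongrightarrow> lift (indicator (box a b)) p"
      using AE_M_interior
    proof eventually_elim
      case (elim p)
      obtain x u \<xi> where p: "p = (x, u, \<xi>)" by (cases p)
      have x: "0 < x $ i \<and> x $ i < 1" and u: "0 < u $ i" "u $ i < l $ i" for i
        using elim by (auto simp: p fund_domain_eq unit_cube_def cell_def)
      have "u \<in> box a' b' \<longleftrightarrow> u \<in> box a2 b2"
        using u by (auto simp: a'_def b'_def mem_box_cart)
      then have "indicator (box a b) (x, u) = (indicator (box a1 b1) x * indicator (box a' b') u :: complex)"
        by (simp add: a b mem_box_Pair indicator_def)
      moreover have "(\<lambda>n. phase p * (T n x * bump (?\<epsilon> n) a' b' u))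
          \<longlonglongrightarrow> phase p * (indicator (box a1 b1) x * indicator (box a' b') u)"
        by (intro tendsto_mult tendsto_const T(3)[OF x] bump_tendsto_indicator)
      ultimately show ?case by (simp add: lift_def h_def p)
    qed
  qed simp
  \<comment> \<open>Products and waves agree only on the fundamental domain, but the norm sees
    nothing else.\<close>
  moreover have "sqnorm \<mu> (\<lambda>p. lift (h n) p - lift (indicator (box a b)) p)
      = sqnorm \<mu> (\<lambda>p. g n p - lift (indicator (box a b)) p)" for n
    by (rule sqnorm_cong) (simp add: space_measure_M g(2))
  ultimately have "L2_tendsto \<mu> g (lift (indicator (box a b)))"
    by (simp add: L2_tendsto_sqnorm)
  then show ?thesis using g(1) by (auto simp: L2_adherent_def)
qed

lemma lift_adherent:
  assumes "h \<in> L2 \<nu>"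
  shows "L2_adherent \<mu> wave_span (lift h)"
proof (rule L2_induct_box[where P = "\<lambda>h. L2_adherent \<mu> wave_span (lift h)", OF finite_measure_\<nu> _ _ _ _ _ assms])
  show "sets \<nu> = sets borel" by (simp add: \<nu>_def)
  show "L2_adherent \<mu> wave_span (lift (indicator (box a b)))" for a b
    by (rule indicator_box_adherent)
next
  fix f g assume fg: "f \<in> borel_measurable borel" "g \<in> borel_measurable borel"
    and "L2_adherent \<mu> wave_span (lift f)" "L2_adherent \<mu> wave_span (lift g)"
  then obtain \<psi> \<psi>' where *: "\<forall>n. \<psi> n \<in> wave_span" "\<forall>n. \<psi>' n \<in> wave_span"
      "L2_tendsto \<mu> \<psi> (lift f)" "L2_tendsto \<mu> \<psi>' (lift g)"
    by (auto simp: L2_adherent_def)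
  have "L2_tendsto \<mu> (\<lambda>n p. \<psi> n p + \<psi>' n p) (\<lambda>p. lift f p + lift g p)"
    by (rule L2_tendsto_add) (use * wave_span_measurable borel_imp_M[OF lift_borel] fg in auto)
  moreover have "(\<lambda>p. lift f p + lift g p) = lift (\<lambda>x. f x + g x)"
    by (simp add: lift_def distrib_left)
  ultimately show "L2_adherent \<mu> wave_span (lift (\<lambda>x. f x + g x))"
    using * wave_span_add unfolding L2_adherent_def by (intro exI[of _ "\<lambda>n p. \<psi> n p + \<psi>' n p"]) simp
next
  fix c f assume f: "f \<in> borel_measurable borel" and "L2_adherent \<mu> wave_span (lift f)"
  then obtain \<psi> where *: "\<forall>n. \<psi> n \<in> wave_span" "L2_tendsto \<mu> \<psi> (lift f)"
    by (auto simp: L2_adherent_def)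
  have "L2_tendsto \<mu> (\<lambda>n p. c * \<psi> n p) (\<lambda>p. c * lift f p)"
    by (rule L2_tendsto_cmult) (use * wave_span_measurable borel_imp_M[OF lift_borel] f in auto)
  moreover have "(\<lambda>p. c * lift f p) = lift (\<lambda>x. c * f x)"
    by (simp add: lift_def mult.left_commute)
  ultimately show "L2_adherent \<mu> wave_span (lift (\<lambda>x. c * f x))"
    using * wave_span_cmult unfolding L2_adherent_def by (intro exI[of _ "\<lambda>n p. c * \<psi> n p"]) simp
next
  fix \<phi> f assume *: "\<And>n::nat. \<phi> n \<in> borel_measurable borel" "f \<in> borel_measurable borel"
    "\<And>n. L2_adherent \<mu> wave_span (lift (\<phi> n))" "L2_tendsto \<nu> \<phi> f"
  show "L2_adherent \<mu> wave_span (lift f)"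
    by (rule L2_adherent_limit[OF wave_span_measurable _ _ *(3) L2_tendsto_lift[OF *(1,2,4)]])
      (intro borel_imp_M lift_borel *)+
qed

lemma Hk_adherent:
  assumes "F \<in> Hk l k"
  shows "L2_adherent \<mu> wave_span F"
proof -
  obtain G where G: "G \<in> L2_M l" "AE p in \<mu>. F p = G p" "equivariant G"
    using assms by (auto simp: Hk_iff)
  \<comment> \<open>The phase at \<xi> = 0 is divided out by its conjugate; equivariance then
    restores the factor in \<xi>, so the lift of \<open>h\<close> is \<open>G\<close> at every
    point.\<close>
  define h where "h = (\<lambda>z. cnj (cis (freq l k / 2 * (fst z \<bullet> snd z))) * G (fst z, snd z, 0))"
  have lift: "lift h = G"
  proof
    fix p :: "'n heis"
    obtain x u \<xi> where p: "p = (x, u, \<xi>)" by (cases p)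
    have "lift h p = (cis (freq l k / 2 * (x \<bullet> u)) * cnj (cis (freq l k / 2 * (x \<bullet> u))))
        * (cis (freq l k * \<xi>) * G (x, u, 0))"
      by (simp only: p lift_def h_def phase_def fst_conv snd_conv prod.case mult_ac)
    also have "cis (freq l k / 2 * (x \<bullet> u)) * cnj (cis (freq l k / 2 * (x \<bullet> u))) = 1"
      by (simp add: cis_cnj cis_mult)
    also have "cis (freq l k * \<xi>) * G (x, u, 0) = G p"
      using G(3) unfolding equivariant_def p by metis
    finally show "lift h p = G p" by simp
  qed
  have "(\<lambda>z::(real, 'n) vec \<times> (real, 'n) vec. (fst z, snd z, 0::real)) \<in> borel_measurable borel"
    "(\<lambda>z::(real, 'n) vec \<times> (real, 'n) vec. cnj (cis (freq l k / 2 * (fst z \<bullet> snd z)))) \<in> borel_measurable borel"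
    by (intro borel_measurable_continuous_onI continuous_intros)+
  then have h: "h \<in> borel_measurable borel"
    unfolding h_def by (intro borel_measurable_times measurable_compose[OF _ L2_MD(1)[OF G(1)]])
  have "sqnorm \<nu> h < \<infinity>"
    using sqnorm_lift[OF h] L2_MD(4)[OF G(1)] by (simp add: lift L2_iff)
  then have "h \<in> L2 \<nu>"
    using h by (simp add: L2_iff \<nu>_def)
  from lift_adherent[OF this] obtain \<psi> where "\<forall>n. \<psi> n \<in> wave_span" "L2_tendsto \<mu> \<psi> G"
    by (auto simp: L2_adherent_def lift)
  moreover have "AE p in \<mu>. G p = F p" using G(2) by eventually_elim simp
  ultimately show ?thesis
    using L2_tendsto_cong_AE unfolding L2_adherent_def by blast
qed

section \<open>Extraction of the components\<close>

theorem Hk_decomposition: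
  assumes F: "F \<in> Hk l k"
  shows "\<exists>F'. (\<forall>J\<in>I. F' J \<in> Wclosure (r J)) \<and> F = (\<lambda>p. \<Sum>J\<in>I. F' J p)"
proof -
  have FL: "F \<in> L2_M l" using F by (simp add: Hk_iff)
  obtain \<psi> where \<psi>: "\<And>n. \<psi> n \<in> wave_span" "L2_tendsto \<mu> \<psi> F"
    using Hk_adherent[OF F] by (auto simp: L2_adherent_def)
  have "\<exists>\<phi>. \<psi> n = (\<lambda>p. \<Sum>J\<in>I. W (r J) (\<phi> J) p) \<and> (\<forall>J\<in>I. schwartz (\<phi> J))" for n
    using \<psi>(1)[of n] by (auto simp: wave_span_def)
  then obtain \<phi> where \<phi>: "\<And>n. \<psi> n = (\<lambda>p. \<Sum>J\<in>I. W (r J) (\<phi> n J) p)" "\<And>n J. J \<in> I \<Longrightarrow> schwartz (\<phi> n J)"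
    by metis
  have \<psi>_meas: "\<psi> n \<in> borel_measurable \<mu>" for n using \<psi>(1) wave_span_measurable by blast
  have Cauchy: "L2_Cauchy \<mu> \<psi>"
    by (rule L2_tendsto_imp_Cauchy[OF \<psi>_meas L2_MD(2)[OF FL] \<psi>(2)])
  have "L2_Cauchy \<mu> (\<lambda>n. W (r J) (\<phi> n J))" if J: "J \<in> I" for J
  proof -
    have le: "sqnorm \<mu> (\<lambda>p. W (r J) (\<phi> m J) p - W (r J) (\<phi> n J) p) \<le> sqnorm \<mu> (\<lambda>p. \<psi> m p - \<psi> n p)" for m n
    proof -
      have diff: "J' \<in> I \<Longrightarrow> schwartz (\<lambda>v. \<phi> m J' v - \<phi> n J' v)" for J'
        by (intro schwartz_diff \<phi>)
      have "sqnorm \<mu> (\<lambda>p. W (r J) (\<phi> m J) p - W (r J) (\<phi> n J) p) = sqnorm \<mu> (W (r J) (\<lambda>v. \<phi> m J v - \<phi> n J v))"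
        using W_diff[OF \<phi>(2)[OF J] \<phi>(2)[OF J]] by (simp add: sqnorm_def)
      also have "\<dots> = ennreal (l $ first / 2) * sqnorm lborel (\<lambda>v. \<phi> m J v - \<phi> n J v)"
        by (rule sqnorm_W[OF diff[OF J]])
      \<comment> \<open>The other terms of the norm identity are nonnegative, so the increment of
        one component is dominated by that of the whole sum.\<close>
      also have "\<dots> \<le> ennreal (l $ first / 2) * (\<Sum>J'\<in>I. sqnorm lborel (\<lambda>v. \<phi> m J' v - \<phi> n J' v))"
        using finite_I J by (intro mult_left_mono member_le_sum) auto
      also have "\<dots> = sqnorm \<mu> (\<lambda>p. \<Sum>J'\<in>I. W (r J') (\<lambda>v. \<phi> m J' v - \<phi> n J' v) p)"
        by (rule sqnorm_sum_W[symmetric, OF finite_I inj_r diff])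
      also have "\<dots> = sqnorm \<mu> (\<lambda>p. \<psi> m p - \<psi> n p)"
        by (simp add: \<phi>(1) sum_subtractf[symmetric] W_diff[OF \<phi>(2) \<phi>(2)])
      finally show ?thesis .
    qed
    show ?thesis
      unfolding L2_Cauchy_def
    proof (intro allI impI)
      fix e :: real assume "0 < e"
      then obtain M where M: "\<forall>m\<ge>M. \<forall>n\<ge>M. sqnorm \<mu> (\<lambda>p. \<psi> m p - \<psi> n p) < ennreal e"
        using Cauchy[unfolded L2_Cauchy_def] by blast
      show "\<exists>M. \<forall>m\<ge>M. \<forall>n\<ge>M. sqnorm \<mu> (\<lambda>p. W (r J) (\<phi> m J) p - W (r J) (\<phi> n J) p) < ennreal e"
        by (intro exI[of _ M] allI impI le_less_trans[OF le]) (use M in blast)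
    qed
  qed
  then have "\<exists>G\<in>L2_M l. L2_tendsto \<mu> (\<lambda>n. W (r J) (\<phi> n J)) G" if J: "J \<in> I" for J
    using equivariant_complete[of "\<lambda>n. W (r J) (\<phi> n J)", OF W_L2_M[OF \<phi>(2)[OF J]] equivariant_W] J by blast
  then obtain G where G: "\<And>J. J \<in> I \<Longrightarrow> G J \<in> L2_M l"
      "\<And>J. J \<in> I \<Longrightarrow> L2_tendsto \<mu> (\<lambda>n. W (r J) (\<phi> n J)) (G J)" by metis
  have GL: "(\<lambda>p. \<Sum>J\<in>I. G J p) \<in> L2_M l" by (rule L2_M_sum[OF finite_I G(1)])
  have "L2_tendsto \<mu> (\<lambda>n p. \<Sum>J\<in>I. W (r J) (\<phi> n J) p) (\<lambda>p. \<Sum>J\<in>I. G J p)"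
    by (rule L2_tendsto_sum[OF finite_I measurable_W_M[OF \<phi>(2)] L2_MD(2)[OF G(1)] G(2)])
  then have lim: "L2_tendsto \<mu> \<psi> (\<lambda>p. \<Sum>J\<in>I. G J p)"
    by (simp add: \<phi>(1)[abs_def])
  have null: "AE p in \<mu>. F p = (\<Sum>J\<in>I. G J p)"
    by (rule L2_tendsto_unique[OF \<psi>_meas L2_MD(2)[OF FL] L2_MD(2)[OF GL] \<psi>(2) lim])
  \<comment> \<open>The limits add up to \<open>F\<close> only almost everywhere; one component absorbs the difference.\<close>
  define N where "N p = F p + (-1) * (\<Sum>J\<in>I. G J p)" for p
  have NL: "N \<in> L2_M l" unfolding N_def[abs_def] by (intro L2_M_add L2_M_cmult FL GL)
  obtain J0 where J0: "J0 \<in> I" using surj_r by blast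
  define F' where "F' J = (if J = J0 then (\<lambda>p. G J0 p + N p) else G J)" for J
  have "F' J \<in> Wclosure (r J)" if J: "J \<in> I" for J
  proof (rule WclosureI[OF _ \<phi>(2)[OF J]])
    show "F' J \<in> L2_M l" using G(1)[OF J] NL by (auto simp: F'_def intro: L2_M_add)
    have "AE p in \<mu>. G J p = F' J p" using null by eventually_elim (auto simp: F'_def N_def)
    then show "L2_tendsto \<mu> (\<lambda>n. W (r J) (\<phi> n J)) (F' J)"
      by (rule L2_tendsto_cong_AE[OF G(2)[OF J]])
  qed
  moreover have "F = (\<lambda>p. \<Sum>J\<in>I. F' J p)"
  proof
    fix p
    have "(\<Sum>J\<in>I. F' J p) = (\<Sum>J\<in>I. G J p + (if J = J0 then N p else 0))"
      by (intro sum.cong) (auto simp: F'_def)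
    also have "\<dots> = (\<Sum>J\<in>I. G J p) + N p" using finite_I J0 by (simp add: sum.distrib)
    finally show "F p = (\<Sum>J\<in>I. F' J p)" by (simp add: N_def)
  qed
  ultimately show ?thesis by blast
qed

end

subsection \<open>The residue classes\<close>

context zak
begin

definition cong_rel :: "((int, 'n) vec \<times> (int, 'n) vec) set" where
  "cong_rel = {(a, b). \<forall>i. \<exists>q::int. of_int (a $ i) - of_int (b $ i) = 2 * of_int k * (l $ i / l $ first) * of_int q}"

text \<open>The definition speaks of real quotients l_i / l_1; these are the integers
  \<open>ratio $ i\<close>, so congruence means that the difference lies in the image of
  \<open>dil\<close>.\<close>

lemma cong_rel_iff: "(a, b) \<in> cong_rel \<longleftrightarrow> (\<exists>m. a = b + dil m)"
proof -
  have "(real_of_int (a $ i) - of_int (b $ i) = 2 * of_int k * (l $ i / l $ first) * of_int q)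
      \<longleftrightarrow> a $ i = b $ i + 2 * k * ratio $ i * q" for i q
  proof -
    have "(real_of_int (a $ i) - of_int (b $ i) = 2 * of_int k * (l $ i / l $ first) * of_int q)
        \<longleftrightarrow> real_of_int (a $ i) = real_of_int (b $ i + 2 * k * ratio $ i * q)"
      unfolding of_int_ratio[symmetric] by (simp add: algebra_simps)
    then show ?thesis by (simp only: of_int_eq_iff)
  qed
  then have "(a, b) \<in> cong_rel \<longleftrightarrow> (\<forall>i. \<exists>q. a $ i = b $ i + 2 * k * ratio $ i * q)"
    by (simp add: cong_rel_def)
  also have "\<dots> \<longleftrightarrow> (\<exists>m. \<forall>i. a $ i = b $ i + 2 * k * ratio $ i * m $ i)"
  proof
    assume "\<forall>i. \<exists>q. a $ i = b $ i + 2 * k * ratio $ i * q"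
    then obtain q where "\<forall>i. a $ i = b $ i + 2 * k * ratio $ i * q i" by metis
    then show "\<exists>m. \<forall>i. a $ i = b $ i + 2 * k * ratio $ i * m $ i"
      by (intro exI[of _ "\<chi> i. q i"]) simp
  qed blast
  also have "\<dots> \<longleftrightarrow> (\<exists>m. a = b + dil m)" by (simp add: vec_eq_iff dil_def)
  finally show ?thesis .
qed

lemma Ak_eq: "Ak l k = UNIV // cong_rel"
  by (simp add: Ak_def cong_rel_def)

lemma equiv_cong_rel: "equiv UNIV cong_rel"
proof (rule equivI)
  show "refl cong_rel"
    by (intro refl_onI) (auto simp: cong_rel_iff dil_def vec_eq_iff intro!: exI[of _ 0])
  show "sym cong_rel"
  proof (rule symI)
    fix a b assume "(a, b) \<in> cong_rel"
    then obtain m where "a = b + dil m" by (auto simp: cong_rel_iff)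
    then have "b = a + dil (- m)" by (simp add: dil_minus)
    then show "(b, a) \<in> cong_rel" by (auto simp: cong_rel_iff)
  qed
  show "trans cong_rel"
  proof (rule transI)
    fix a b c assume "(a, b) \<in> cong_rel" "(b, c) \<in> cong_rel"
    then obtain m m' where "a = b + dil m" "b = c + dil m'" by (auto simp: cong_rel_iff)
    then have "a = c + dil (m' + m)" by (simp add: dil_add add.assoc)
    then show "(a, c) \<in> cong_rel" by (auto simp: cong_rel_iff)
  qed
qed simp

lemma finite_Ak: "finite (Ak l k)"
proof -
  define d where "d i = 2 * k * ratio $ i" for i
  have d: "d i \<noteq> 0" for i using k0 ratio_neq_0 by (simp add: d_def)
  have dil: "dil m $ i = d i * m $ i" for m i by (simp add: dil_def d_def)
  \<comment> \<open>The interval is symmetric because k, and with it the modulus \<open>d i\<close>,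
    may be negative, and remainders take the sign of the modulus.\<close>
  define B where "B = (\<lambda>f. (\<chi> i. f i) :: (int, 'n) vec) ` (PiE UNIV (\<lambda>i. {- \<bar>d i\<bar>..\<bar>d i\<bar>}))"
  have "finite B" unfolding B_def by (intro finite_imageI finite_PiE) auto
  moreover have "Ak l k \<subseteq> (\<lambda>a. cong_rel `` {a}) ` B"
  proof
    fix J assume "J \<in> Ak l k"
    then obtain a where J: "J = cong_rel `` {a}" by (auto simp: Ak_eq quotient_def)
    define b where "b = (\<chi> i. a $ i mod d i)"
    have "a = b + dil (\<chi> i. a $ i div d i)"
      by (simp add: vec_eq_iff b_def dil)
    then have "(a, b) \<in> cong_rel" by (auto simp: cong_rel_iff)
    then have "J = cong_rel `` {b}"
      unfolding J by (rule equiv_class_eq[OF equiv_cong_rel])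
    moreover have "b \<in> B"
    proof -
      have mod: "a $ i mod d i \<in> {- \<bar>d i\<bar>..\<bar>d i\<bar>}" for i
        using abs_mod_less[OF d[of i], of "a $ i"] unfolding atLeastAtMost_iff by linarith
      show ?thesis
        unfolding B_def b_def by (rule imageI) (rule PiE_I, rule mod, simp)
    qed
    ultimately show "J \<in> (\<lambda>a. cong_rel `` {a}) ` B" by blast
  qed
  ultimately show ?thesis by (meson finite_imageI finite_subset)
qed

end

text \<open>The arbitrary choice function \<open>rep\<close> reflects that \<open>Hkj\<close> does
  not depend on the representative. Existence and uniqueness of the pair (J, m) with q =
  \<open>rep J + dil m\<close> come from the partition of Z^n into cosets and the injectivity of
  \<open>dil\<close>.\<close>

theorem proposition2p4:
  fixes l :: "real^'n::{finite,linorder}" and k :: int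
    and rep :: "(int, 'n) vec set \<Rightarrow> (int, 'n) vec"
  assumes "admissible l"
    and "k \<noteq> 0"
    and "\<And>J. J \<in> Ak l k \<Longrightarrow> rep J \<in> J"
  shows "orthogonal_direct_sum (measure_M l) (L2_M l) (Hk l k) (Ak l k) (\<lambda>J. Hkj l k (rep J))"
proof -
  interpret zak l k by unfold_locales (fact assms)+
  have cls: "J = cong_rel `` {rep J}" if "J \<in> Ak l k" for J
    using that assms(3)[OF that] equiv_class_eq[OF equiv_cong_rel]
    by (auto simp: Ak_eq quotient_def)
  have same: "J = J'" if "J \<in> Ak l k" "J' \<in> Ak l k" "(rep J, rep J') \<in> cong_rel" for J J'
    using cls[OF that(1)] cls[OF that(2)] equiv_class_eq[OF equiv_cong_rel that(3)] by simp
  interpret zak_reps l k "Ak l k" rep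
  proof
    show "finite (Ak l k)" by (rule finite_Ak)
    show "inj_on (\<lambda>(J, m). rep J + dil m) (Ak l k \<times> UNIV)"
    proof (rule inj_onI, clarify)
      fix J m J' m' assume *: "J \<in> Ak l k" "J' \<in> Ak l k" "rep J + dil m = rep J' + dil m'"
      have "dil m' = dil (m' - m) + dil m" by (simp flip: dil_add)
      then have "rep J + dil m = (rep J' + dil (m' - m)) + dil m" using *(3) by (simp only: add.assoc)
      then have "rep J = rep J' + dil (m' - m)" by (rule add_right_imp_eq)
      then have "J = J'" using same[OF *(1,2)] by (auto simp: cong_rel_iff)
      then show "J = J' \<and> m = m'" using *(3) by (simp add: inj_dil)
    qed
    show "\<exists>J\<in>Ak l k. \<exists>m. q = rep J + dil m" for q
    proof (intro bexI[of _ "cong_rel `` {q}"])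
      show *: "cong_rel `` {q} \<in> Ak l k" by (simp add: Ak_eq quotientI)
      from assms(3)[OF this] show "\<exists>m. q = rep (cong_rel `` {q}) + dil m"
        by (simp add: cong_rel_iff)
    qed
  qed
  show ?thesis
    unfolding orthogonal_direct_sum_def Hkj_eq_Wclosure
  proof (intro conjI ballI impI)
    show "finite (Ak l k)" by (rule finite_Ak)
    show "closed_subspace \<mu> (L2_M l) (Wclosure (rep J))" for J
      by (rule closed_subspace_Wclosure)
  next
    fix J J' F G assume *: "J \<in> Ak l k" "J' \<in> Ak l k" "J \<noteq> J'" "F \<in> Wclosure (rep J)" "G \<in> Wclosure (rep J')"
    have "rep J - rep J' \<noteq> dil m" for m
    proof
      assume "rep J - rep J' = dil m"
      then have "rep J = rep J' + dil m" by (simp add: algebra_simps)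
      then show False using same[OF *(1,2)] *(3) by (auto simp: cong_rel_iff)
    qed
    then show "L2_inner \<mu> F G = 0" by (rule Wclosure_orthogonal[OF *(4,5)])
  next
    show "Hk l k = {\<lambda>p. \<Sum>J\<in>Ak l k. F J p |F. \<forall>J\<in>Ak l k. F J \<in> Wclosure (rep J)}"
    proof (intro equalityI subsetI)
      fix F assume "F \<in> Hk l k"
      from Hk_decomposition[OF this]
      show "F \<in> {\<lambda>p. \<Sum>J\<in>Ak l k. F J p |F. \<forall>J\<in>Ak l k. F J \<in> Wclosure (rep J)}" by blast
    next
      fix H assume "H \<in> {\<lambda>p. \<Sum>J\<in>Ak l k. F J p |F. \<forall>J\<in>Ak l k. F J \<in> Wclosure (rep J)}"
      then obtain F where "H = (\<lambda>p. \<Sum>J\<in>Ak l k. F J p)" "\<forall>J\<in>Ak l k. F J \<in> Wclosure (rep J)" by blast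
      then show "H \<in> Hk l k" using Wclosure_subset_Hk by (auto intro!: Hk_sum[OF finite_Ak])
    qed
  qed
qed

end
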